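(* Let $\mu,\nu$ be Radon measures on $\mathbb{R}^d$, let $\mathcal{D}$ be a dyadic lattice in $\mathbb{R}^d$, and let $\mathbb{S}$ be a (finite) elementary generalized dyadic shift with parameters $m$ and $n$ with respect to $\mathcal{D}$. Suppose that there exists a constant $B$ such that for every $Q\in\mathcal{D}$ \[ \int_Q|\mathbb{S}_\mu\mathbf 1_Q|^2\,d\nu\le B\,\mu(Q),\qquad \int_Q|\mathbb{S}^*_\nu\mathbf 1_Q|^2\,d\mu\le B\,\nu(Q). \] Then for all $f\in L^2(\mu)$ \[ \|\mathbb{S}_\mu f\|_{L^2(\nu)}\le C\Big(2^{d/2}(r+1)\big(B^{1/2}+[\mu,\nu]_{A_2}^{1/2}\big)+r^2[\mu,\nu]_{A_2}^{1/2}\Big)\|f\|_{L^2(\mu)}, \] where $r=\max(m,n)$ and $C$ is an absolute constant.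
   Context: Dyadic lattices: $\mathcal{D}^0=\bigcup_{k\in\mathbb{Z}}\mathcal{D}^0_k$, $\mathcal{D}^0_k=\{2^k([0,1)^d+m):m\in\mathbb{Z}^d\}$. For $\omega=(\omega_j)_{j\in\mathbb{Z}}\in(\{0,1\}^d)^{\mathbb{Z}}$ and $I\in\mathcal{D}^0_k$ put $I\dot+\omega:=I+\sum_{j<k}\omega_j2^j$; a dyadic lattice is $\mathcal{D}=\mathcal{D}^\omega=\{I\dot+\omega:I\in\mathcal{D}^0\}$ for some $\omega$. $\ell(Q)$ is the side length of a cube $Q$; the children of $Q\in\mathcal{D}$ are the $2^d$ cubes of $\mathcal{D}$ of side $\ell(Q)/2$ contained in $Q$. A generalized Haar function for a cube $Q$ is a function supported on $Q$ and constant on each child of $Q$ (a Haar function is one which in addition has integral zero). Elementary generalized dyadic shift with parameters $m,n\in\{0,1,2,\dots\}$: an operator \[ \mathbb{S}f=\sum_{Q\in\mathcal{D}}\ \sum_{\substack{Q',Q''\in\mathcal{D},\ Q',Q''\subset Q\\ \ell(Q')=2^{-m}\ell(Q),\ \ell(Q'')=2^{-n}\ell(Q)}}|Q|^{-1}(f,h_{Q'}^{Q''})\,h_{Q''}^{Q'},\qquad (f,h)=\int fh\,dx, \] where $h_{Q'}^{Q''}$ and $h_{Q''}^{Q'}$ are generalized Haar functions for $Q'$ and $Q''$ respectively, with $\|h_{Q'}^{Q''}\|_\infty\|h_{Q''}^{Q'}\|_\infty\le1$. Standing assumption: the shift is finite, i.e. only finitely many $Q$ contribute nonzero terms (the constants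 do not depend on their number). Thus $\mathbb{S}$ has kernel \[ A(x,y)=\sum_{Q\in\mathcal{D}}|Q|^{-1}a_Q(x,y),\qquad a_Q(x,y)=\sum_{\substack{Q',Q''\in\mathcal{D},\ Q',Q''\subset Q\\ \ell(Q')=2^{-m}\ell(Q),\ \ell(Q'')=2^{-n}\ell(Q)}}h_{Q''}^{Q'}(x)h_{Q'}^{Q''}(y); \] $a_Q$ is supported on $Q\times Q$ and $\|a_Q\|_\infty\le1$. Define \[ \mathbb{S}_\mu f(x)=\int A(x,y)f(y)\,d\mu(y),\qquad \mathbb{S}^*_\nu g(y)=\int\overline{A(x,y)}\,g(x)\,d\nu(x). \] Finally $[\mu,\nu]_{A_2}:=\sup_I\langle\mu\rangle_I\langle\nu\rangle_I$, $\langle\sigma\rangle_I=|I|^{-1}\sigma(I)$, the supremum being over cubes $I\subset\mathbb{R}^d$. *)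

theory Defs
  imports "HOL-Analysis.Analysis"
begin

text \<open>
  The constant in the theorem does not depend on the dimension, so the dimension has to be a
  number that can be quantified inside the statement.  Hence a point of the Euclidean space of
  dimension \<open>d\<close> is an extensional function on \<open>{..<d}\<close>, and measures live on the product
  sigma-algebra.
\<close>

definition lebesgue_Rd :: "nat \<Rightarrow> (nat \<Rightarrow> real) measure" where
  "lebesgue_Rd d = (\<Pi>\<^sub>M i\<in>{..<d}. lborel)"

definition Rd :: "nat \<Rightarrow> (nat \<Rightarrow> real) set" where
  "Rd d = (\<Pi>\<^sub>E i\<in>{..<d}. UNIV)"

text \<open>
  On the Euclidean space a Borel measure that is finite on compact sets is automatically regular.
  Compactness refers to the product topology, which on \<^term>\<open>Rd d\<close> is the Euclidean one.
\<close>

definition radon_measure :: "nat \<Rightarrow> (nat \<Rightarrow> real) measure \<Rightarrow> bool" where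
  "radon_measure d \<mu> \<longleftrightarrow> sets \<mu> = sets (lebesgue_Rd d) \<and>
     (\<forall>K. compact K \<and> K \<subseteq> Rd d \<longrightarrow> emeasure \<mu> K < \<infinity>)"

definition volume :: "nat \<Rightarrow> (nat \<Rightarrow> real) set \<Rightarrow> real" where
  "volume d Q = measure (lebesgue_Rd d) Q"

subsection \<open>Cubes and dyadic lattices\<close>

definition cube :: "nat \<Rightarrow> (nat \<Rightarrow> real) \<Rightarrow> real \<Rightarrow> (nat \<Rightarrow> real) set" where
  "cube d a l = (\<Pi>\<^sub>E i\<in>{..<d}. {a i ..< a i + l})"

definition cubes :: "nat \<Rightarrow> (nat \<Rightarrow> real) set set" where
  "cubes d = {cube d a l | a l. l > 0}"

text \<open>Well defined for \<open>d \<ge> 1\<close> only.\<close>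

definition side_length :: "nat \<Rightarrow> (nat \<Rightarrow> real) set \<Rightarrow> real" where
  "side_length d Q = (THE l. l > 0 \<and> (\<exists>a. Q = cube d a l))"

definition translate :: "nat \<Rightarrow> (nat \<Rightarrow> real) \<Rightarrow> (nat \<Rightarrow> real) set \<Rightarrow> (nat \<Rightarrow> real) set" where
  "translate d v I = (\<lambda>x. \<lambda>i\<in>{..<d}. x i + v i) ` I"

definition standard_dyadic :: "nat \<Rightarrow> int \<Rightarrow> (nat \<Rightarrow> real) set set" where
  "standard_dyadic d k =
     {cube d (\<lambda>i. 2 powi k * of_int (m i)) (2 powi k) | m :: nat \<Rightarrow> int. True}"

definition lattice_offset :: "(int \<Rightarrow> nat \<Rightarrow> real) \<Rightarrow> int \<Rightarrow> nat \<Rightarrow> real" where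
  "lattice_offset \<omega> k i = (\<Sum>\<^sub>\<infinity>j\<in>{..<k}. \<omega> j i * 2 powi j)"

definition dyadic_lattice :: "nat \<Rightarrow> (nat \<Rightarrow> real) set set \<Rightarrow> bool" where
  "dyadic_lattice d D \<longleftrightarrow>
     (\<exists>\<omega>. (\<forall>j. \<forall>i<d. \<omega> j i \<in> {0, 1}) \<and>
          D = (\<Union>k. translate d (lattice_offset \<omega> k) ` standard_dyadic d k))"

text \<open>The cubes of the lattice contained in \<open>Q\<close> with side \<open>2\<close> to the power \<open>- m\<close> times that of
  \<open>Q\<close>; the children of \<open>Q\<close> are the case \<open>m = 1\<close>.\<close>

definition descendants ::
  "nat \<Rightarrow> (nat \<Rightarrow> real) set set \<Rightarrow> nat \<Rightarrow> (nat \<Rightarrow> real) set \<Rightarrow> (nat \<Rightarrow> real) set set" where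
  "descendants d D m Q = {R \<in> D. R \<subseteq> Q \<and> side_length d R = side_length d Q / 2 ^ m}"

subsection \<open>Generalized Haar functions and shifts\<close>

definition generalized_haar ::
  "nat \<Rightarrow> (nat \<Rightarrow> real) set set \<Rightarrow> (nat \<Rightarrow> real) set \<Rightarrow> ((nat \<Rightarrow> real) \<Rightarrow> complex) \<Rightarrow> bool" where
  "generalized_haar d D Q h \<longleftrightarrow>
     (\<forall>x\<in>Rd d - Q. h x = 0) \<and> (\<forall>R\<in>descendants d D 1 Q. h constant_on R)"

definition sup_norm :: "nat \<Rightarrow> ((nat \<Rightarrow> real) \<Rightarrow> complex) \<Rightarrow> ennreal" where
  "sup_norm d h = (SUP x\<in>Rd d. ennreal (cmod (h x)))"

text \<open>
  A shift is given by two families of functions: \<open>hin Q' Q''\<close> is the generalized Haar function for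
  \<open>Q'\<close> that is paired with the argument of the shift, and \<open>hout Q' Q''\<close> is the one for \<open>Q''\<close>, which
  appears in the output.  No cube \<open>Q\<close> has to be recorded, since it is determined by \<open>Q'\<close>.
\<close>

type_synonym haar_family =
  "(nat \<Rightarrow> real) set \<Rightarrow> (nat \<Rightarrow> real) set \<Rightarrow> (nat \<Rightarrow> real) \<Rightarrow> complex"

definition shift_block ::
  "nat \<Rightarrow> (nat \<Rightarrow> real) set set \<Rightarrow> nat \<Rightarrow> nat \<Rightarrow> haar_family \<Rightarrow> haar_family \<Rightarrow>
   (nat \<Rightarrow> real) set \<Rightarrow> (nat \<Rightarrow> real) \<Rightarrow> (nat \<Rightarrow> real) \<Rightarrow> complex" where
  "shift_block d D m n hin hout Q x y =
     (\<Sum>Q'\<in>descendants d D m Q. \<Sum>Q''\<in>descendants d D n Q. hout Q' Q'' x * hin Q' Q'' y)"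

text \<open>
  In the finiteness condition, the term of the operator that belongs to \<open>Q\<close> vanishes if and only
  if its kernel vanishes identically, because the kernel is a step function on half-open boxes.
\<close>

definition finite_elementary_shift ::
  "nat \<Rightarrow> (nat \<Rightarrow> real) set set \<Rightarrow> nat \<Rightarrow> nat \<Rightarrow> haar_family \<Rightarrow> haar_family \<Rightarrow> bool" where
  "finite_elementary_shift d D m n hin hout \<longleftrightarrow>
     (\<forall>Q\<in>D. \<forall>Q'\<in>descendants d D m Q. \<forall>Q''\<in>descendants d D n Q.
        generalized_haar d D Q' (hin Q' Q'') \<and>
        generalized_haar d D Q'' (hout Q' Q'') \<and>
        sup_norm d (hin Q' Q'') * sup_norm d (hout Q' Q'') \<le> 1) \<and>
     finite {Q \<in> D. \<exists>x\<in>Rd d. \<exists>y\<in>Rd d. shift_block d D m n hin hout Q x y \<noteq> 0}"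

definition shift_kernel ::
  "nat \<Rightarrow> (nat \<Rightarrow> real) set set \<Rightarrow> nat \<Rightarrow> nat \<Rightarrow> haar_family \<Rightarrow> haar_family \<Rightarrow>
   (nat \<Rightarrow> real) \<Rightarrow> (nat \<Rightarrow> real) \<Rightarrow> complex" where
  "shift_kernel d D m n hin hout x y =
     (\<Sum>\<^sub>\<infinity>Q\<in>D. of_real (inverse (volume d Q)) * shift_block d D m n hin hout Q x y)"

definition integral_op ::
  "((nat \<Rightarrow> real) \<Rightarrow> (nat \<Rightarrow> real) \<Rightarrow> complex) \<Rightarrow> (nat \<Rightarrow> real) measure \<Rightarrow>
   ((nat \<Rightarrow> real) \<Rightarrow> complex) \<Rightarrow> (nat \<Rightarrow> real) \<Rightarrow> complex" where
  "integral_op A \<mu> f x = (LINT y|\<mu>. A x y * f y)"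

text \<open>The shift itself is \<^term>\<open>integral_op (shift_kernel d D m n hin hout) (lebesgue_Rd d)\<close>.\<close>

definition integral_op_adj ::
  "((nat \<Rightarrow> real) \<Rightarrow> (nat \<Rightarrow> real) \<Rightarrow> complex) \<Rightarrow> (nat \<Rightarrow> real) measure \<Rightarrow>
   ((nat \<Rightarrow> real) \<Rightarrow> complex) \<Rightarrow> (nat \<Rightarrow> real) \<Rightarrow> complex" where
  "integral_op_adj A \<nu> g y = (LINT x|\<nu>. cnj (A x y) * g x)"

subsection \<open>Norms and the joint Muckenhoupt constant\<close>

definition ennreal_sqrt :: "ennreal \<Rightarrow> ennreal" where
  "ennreal_sqrt t = (if t = \<infinity> then \<infinity> else ennreal (sqrt (enn2real t)))"

definition L2_norm :: "(nat \<Rightarrow> real) measure \<Rightarrow> ((nat \<Rightarrow> real) \<Rightarrow> complex) \<Rightarrow> ennreal" where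
  "L2_norm \<mu> f = ennreal_sqrt (\<integral>\<^sup>+x. ennreal ((cmod (f x))\<^sup>2) \<partial>\<mu>)"

definition average :: "nat \<Rightarrow> (nat \<Rightarrow> real) measure \<Rightarrow> (nat \<Rightarrow> real) set \<Rightarrow> ennreal" where
  "average d \<sigma> I = emeasure \<sigma> I / ennreal (volume d I)"

definition A2_const :: "nat \<Rightarrow> (nat \<Rightarrow> real) measure \<Rightarrow> (nat \<Rightarrow> real) measure \<Rightarrow> ennreal" where
  "A2_const d \<mu> \<nu> = (SUP I\<in>cubes d. average d \<mu> I * average d \<nu> I)"

end

theory Submission
  imports Defs
begin

text \<open>
  Only finitely many cubes contribute to the shift, so the kernel is constant on products of cubes of
  a sufficiently small side and vanishes outside of finitely many of them.  Testing the kernel on one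
  point per such leaf cube turns the theorem into an inequality for a finite tree of cubes with two
  weights, and functions are replaced by their averages over the leaves.

  On the tree, \<open>f\<close> and \<open>g\<close> are expanded into weighted martingale differences \<open>\<Delta>\<^sub>k f\<close>, \<open>\<Delta>\<^sub>l g\<close>, and the
  bilinear form of the shift becomes a sum over triples \<open>(k, l, p)\<close>, where \<open>p\<close> is the level of the
  cube of the block.  If \<open>l > k + r\<close>, the sum over \<open>k\<close> telescopes to averages of \<open>f\<close>, and one gets a
  paraproduct that the testing condition controls via the Carleson embedding theorem; \<open>k > l + r\<close> is
  symmetric.  If \<open>\<bar>k - l\<bar> \<le> r\<close> and \<open>p \<ge> min k l\<close>, the blocks live below a cube on which one
  of the two functions is constant, and the testing condition applies after the larger blocks have been
  subtracted, which sum up to a geometric series controlled by the \<open>A\<^sub>2\<close> constant.  If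
  \<open>p < min k l\<close>, the term vanishes unless \<open>k, l \<le> p + r + 1\<close>, and each of the \<open>(r + 1)\<^sup>2\<close> remaining
  diagonals is bounded by the \<open>A\<^sub>2\<close> constant.
\<close>

subsection \<open>Martingale differences and the Carleson embedding on a finite tree\<close>

text \<open>Generalized Haar functions need not have mean zero, so a block of level
  \<open>p > k\<close> does not annihilate a function that varies only down to level
  \<open>k\<close>. The number of such \<open>p\<close> is not controlled by \<open>r\<close>, and
  bounding the blocks one at a time by the \<open>A\<^sub>2\<close> constant would cost the number
  of levels. This is why all \<open>p \<ge> min k l\<close> are summed before norms are taken, with
  the testing condition for the whole kernel. The larger blocks that testing brings in have size at
  most 1/volume, and volumes at least double towards coarser levels, so these blocks together are no
  worse than one block of the test cube. The test cube is the cell on which the coarser function is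
  constant, not a child of it, and no constant in the argument depends on the dimension. Weights may
  vanish on cells. Averages are then 0 by the convention for division by zero, and martingale
  identities are used after multiplication by the weight.\<close>

lemma norm_sum_sq_le:
  fixes s :: "'i \<Rightarrow> complex" and t :: "'i \<Rightarrow> real"
  assumes "\<And>i. i \<in> I \<Longrightarrow> t i \<ge> 0" and "\<And>i. i \<in> I \<Longrightarrow> t i = 0 \<Longrightarrow> s i = 0"
  shows "(cmod (\<Sum>i\<in>I. s i))\<^sup>2 \<le> (\<Sum>i\<in>I. t i) * (\<Sum>i\<in>I. (cmod (s i))\<^sup>2 / t i)"
proof -
  have "cmod (\<Sum>i\<in>I. s i) \<le> (\<Sum>i\<in>I. cmod (s i))"
    by (rule norm_sum)
  \<comment> \<open>Where \<open>t i = 0\<close> the quotient is 0 by convention; the second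
    hypothesis makes the left-hand term vanish as well.\<close>
  also have "\<dots> = (\<Sum>i\<in>I. \<bar>sqrt (t i)\<bar> * \<bar>cmod (s i) / sqrt (t i)\<bar>)"
    using assms by (intro sum.cong) (auto simp: field_simps)
  also have "\<dots> \<le> L2_set (\<lambda>i. sqrt (t i)) I * L2_set (\<lambda>i. cmod (s i) / sqrt (t i)) I"
    by (rule L2_set_mult_ineq)
  finally have "(cmod (\<Sum>i\<in>I. s i))\<^sup>2 \<le>
      (L2_set (\<lambda>i. sqrt (t i)) I * L2_set (\<lambda>i. cmod (s i) / sqrt (t i)) I)\<^sup>2"
    by (intro power_mono) auto
  also have "\<dots> = (\<Sum>i\<in>I. t i) * (\<Sum>i\<in>I. (cmod (s i))\<^sup>2 / t i)"
    using assms(1) unfolding power_mult_distrib L2_set_def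
    by (simp add: sum_nonneg power_divide cong: sum.cong)
  finally show ?thesis .
qed

text \<open>Cauchy--Schwarz over the tuples in \<open>T\<close>: an index of \<open>I\<close> or
  \<open>J\<close> is hit by at most \<open>R\<close> tuples, so either factor costs
  \<open>sqrt R\<close>.\<close>

lemma sum_mult_le_card:
  fixes a :: "'i \<Rightarrow> real" and b :: "'j \<Rightarrow> real"
  assumes T: "finite T" and I: "finite I" and J: "finite J"
    and \<kappa>: "\<kappa> ` T \<subseteq> I" "\<And>i. i \<in> I \<Longrightarrow> card {t \<in> T. \<kappa> t = i} \<le> R"
    and \<tau>: "\<tau> ` T \<subseteq> J" "\<And>j. j \<in> J \<Longrightarrow> card {t \<in> T. \<tau> t = j} \<le> R"
  shows "(\<Sum>t\<in>T. \<bar>a (\<kappa> t)\<bar> * \<bar>b (\<tau> t)\<bar>) \<le> real R * (L2_set a I * L2_set b J)"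
proof -
  have *: "L2_set (\<lambda>t. c (\<rho> t)) T \<le> sqrt (real R) * L2_set c L"
    if "finite L" "\<rho> ` T \<subseteq> L" "\<And>i. i \<in> L \<Longrightarrow> card {t \<in> T. \<rho> t = i} \<le> R"
    for c :: "'k \<Rightarrow> real" and \<rho> L
  proof -
    have "(\<Sum>t\<in>T. (c (\<rho> t))\<^sup>2) = (\<Sum>i\<in>L. \<Sum>t | t \<in> T \<and> \<rho> t = i. (c (\<rho> t))\<^sup>2)"
      using that T by (intro sum.group[symmetric]) auto
    also have "\<dots> = (\<Sum>i\<in>L. real (card {t \<in> T. \<rho> t = i}) * (c i)\<^sup>2)"
      by (intro sum.cong) auto
    also have "\<dots> \<le> (\<Sum>i\<in>L. real R * (c i)\<^sup>2)"
      using that by (intro sum_mono mult_right_mono) auto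
    finally show ?thesis
      unfolding L2_set_def by (simp add: sum_distrib_left flip: real_sqrt_mult)
  qed
  have "(\<Sum>t\<in>T. \<bar>a (\<kappa> t)\<bar> * \<bar>b (\<tau> t)\<bar>) \<le> L2_set (\<lambda>t. a (\<kappa> t)) T * L2_set (\<lambda>t. b (\<tau> t)) T"
    by (rule L2_set_mult_ineq)
  also have "\<dots> \<le> (sqrt (real R) * L2_set a I) * (sqrt (real R) * L2_set b J)"
    using I J \<kappa> \<tau> by (intro mult_mono *) auto
  also have "\<dots> = (sqrt (real R) * sqrt (real R)) * (L2_set a I * L2_set b J)"
    by (simp only: mult_ac)
  finally show ?thesis by simp
qed

text \<open>With \<open>w\<close> the volumes of shrinking cubes, this adds up the kernel sizes of
  all larger cubes. In the induction the new term turns \<open>1 / w k\<close> into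
  \<open>2 / w k\<close>, which the halving absorbs.\<close>

lemma sum_le_sum_div_of_halving:
  fixes w :: "nat \<Rightarrow> real"
  assumes pos: "\<And>p. p \<le> k \<Longrightarrow> w p > 0" and half: "\<And>p. p < k \<Longrightarrow> w (Suc p) \<le> w p / 2"
  shows "(\<Sum>p<k. 1 / w p) \<le> 1 / w k"
  using assms
proof (induction k)
  case 0
  then show ?case by (simp add: less_imp_le)
next
  case (Suc k)
  have "(\<Sum>p<Suc k. 1 / w p) \<le> 2 / w k"
    using Suc by simp
  also have "\<dots> \<le> 1 / w (Suc k)"
    using Suc.prems(1)[of k] Suc.prems(1)[of "Suc k"] Suc.prems(2)[of k] by (simp add: field_simps)
  finally show ?case .
qed

text \<open>\<open>\<pi> k x\<close> is merely a label for the cell of level \<open>k\<close>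
  containing \<open>x\<close>; larger \<open>k\<close> means finer cells. In the application the
  label is the dyadic cube itself and \<open>X\<close> has one point per leaf.\<close>

locale partition_tower =
  fixes X :: "'a set" and \<pi> :: "nat \<Rightarrow> 'a \<Rightarrow> 'b"
  assumes finite_X: "finite X"
    and refine: "\<lbrakk>x \<in> X; y \<in> X; \<pi> (Suc k) x = \<pi> (Suc k) y\<rbrakk> \<Longrightarrow> \<pi> k x = \<pi> k y"
begin

definition cell :: "nat \<Rightarrow> 'a \<Rightarrow> 'a set" where
  "cell k x = {y \<in> X. \<pi> k y = \<pi> k x}"

text \<open>Conditional expectation of \<open>f\<close> with respect to the weight \<open>u\<close>.
  On a cell without mass its value is 0 by division by zero.\<close>

definition avg :: "('a \<Rightarrow> real) \<Rightarrow> nat \<Rightarrow> ('a \<Rightarrow> complex) \<Rightarrow> 'a \<Rightarrow> complex" where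
  "avg u k f x = (\<Sum>y\<in>cell k x. f y * u y) / of_real (\<Sum>y\<in>cell k x. u y)"

text \<open>Level 0 is the average over the top cells and has no cancellation; with it the
  differences telescope to \<open>avg u n f\<close> without a remainder.\<close>

definition mdiff :: "('a \<Rightarrow> real) \<Rightarrow> nat \<Rightarrow> ('a \<Rightarrow> complex) \<Rightarrow> 'a \<Rightarrow> complex" where
  "mdiff u k f x = avg u k f x - (if k = 0 then 0 else avg u (k - 1) f x)"

definition level_const :: "nat \<Rightarrow> ('a \<Rightarrow> 'c) \<Rightarrow> bool" where
  "level_const k h \<longleftrightarrow> (\<forall>x\<in>X. \<forall>y\<in>X. \<pi> k x = \<pi> k y \<longrightarrow> h x = h y)"

definition wnorm :: "('a \<Rightarrow> real) \<Rightarrow> ('a \<Rightarrow> complex) \<Rightarrow> real" where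
  "wnorm u f = L2_set (\<lambda>x. cmod (f x) * sqrt (u x)) X"

lemma finite_cell [simp]: "finite (cell k x)"
  using finite_X by (simp add: cell_def)

lemma in_cellD: "y \<in> cell k x \<Longrightarrow> y \<in> X"
  by (simp add: cell_def)

lemma eq_0_if_sum_cell_eq_0:
  fixes u :: "'a \<Rightarrow> real"
  assumes u: "\<And>x. x \<in> X \<Longrightarrow> u x \<ge> 0" and "(\<Sum>y\<in>cell k x. u y) = 0" "y \<in> cell k x"
  shows "u y = 0"
  using assms(2,3) sum_nonneg_eq_0_iff[of "cell k x" u] u[OF in_cellD] by simp

lemma self_in_cell: "x \<in> X \<Longrightarrow> x \<in> cell k x"
  by (simp add: cell_def)

lemma cell_eq: "y \<in> cell k x \<Longrightarrow> cell k y = cell k x"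
  by (auto simp: cell_def)

lemma refine_le:
  assumes "j \<le> k" "x \<in> X" "y \<in> X" "\<pi> k x = \<pi> k y"
  shows "\<pi> j x = \<pi> j y"
  using assms by (induction rule: inc_induct) (auto intro: refine)

lemma level_constD:
  "level_const k h \<Longrightarrow> x \<in> X \<Longrightarrow> y \<in> X \<Longrightarrow> \<pi> k x = \<pi> k y \<Longrightarrow> h x = h y"
  unfolding level_const_def by blast

lemma level_const_mono: "level_const j h \<Longrightarrow> j \<le> k \<Longrightarrow> level_const k h"
  unfolding level_const_def using refine_le by blast

lemma level_const_avg: "level_const k (avg u k f)"
  by (auto simp: level_const_def avg_def cell_def)

lemma level_const_mdiff: "level_const k (mdiff u k f)"
proof -
  have "level_const k (avg u (k - 1) f)"
    using level_const_avg level_const_mono by (metis diff_le_self)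
  with level_const_avg[of k u f] show ?thesis
    unfolding level_const_def mdiff_def by metis
qed

lemma sum_cells: "sum h X = (\<Sum>q\<in>\<pi> k ` X. \<Sum>x | x \<in> X \<and> \<pi> k x = q. h x)"
  using finite_X by (rule sum.image_gen)

lemma sum_children:
  fixes h :: "'a \<Rightarrow> 'c::comm_monoid_add"
  assumes "x \<in> X"
  shows "sum h (cell k x) =
    (\<Sum>q\<in>\<pi> (Suc k) ` cell k x. \<Sum>y | y \<in> X \<and> \<pi> (Suc k) y = q. h y)"
proof -
  have "sum h (cell k x) =
      (\<Sum>q\<in>\<pi> (Suc k) ` cell k x. sum h {y \<in> cell k x. \<pi> (Suc k) y = q})"
    by (rule sum.image_gen) simp
  moreover have "{y \<in> cell k x. \<pi> (Suc k) y = q} = {y \<in> X. \<pi> (Suc k) y = q}"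
    if "q \<in> \<pi> (Suc k) ` cell k x" for q
  proof -
    from that obtain z where z: "z \<in> X" "\<pi> k z = \<pi> k x" "q = \<pi> (Suc k) z"
      by (auto simp: cell_def)
    then have "\<pi> k y = \<pi> k x" if "y \<in> X" "\<pi> (Suc k) y = q" for y
      using that refine[of y z k] by simp
    then show ?thesis by (auto simp: cell_def)
  qed
  ultimately show ?thesis by simp
qed

section \<open>Weighted conditional expectations: projections and orthogonality\<close>

lemma sum_avg_cell:
  assumes u: "\<And>x. x \<in> X \<Longrightarrow> u x \<ge> 0"
  shows "(\<Sum>y\<in>cell k x. avg u k f y * u y) = (\<Sum>y\<in>cell k x. f y * u y)"
proof (cases "(\<Sum>y\<in>cell k x. u y) = 0")
  case True
  then have "u y = 0" if "y \<in> cell k x" for y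
    using eq_0_if_sum_cell_eq_0[of u k x y, OF u] that by simp
  then show ?thesis by simp
next
  case False
  have "(\<Sum>y\<in>cell k x. avg u k f y * u y) = (\<Sum>y\<in>cell k x. avg u k f x * u y)"
    by (intro sum.cong) (auto simp: avg_def dest: cell_eq)
  also have "\<dots> = avg u k f x * of_real (\<Sum>y\<in>cell k x. u y)"
    by (simp add: sum_distrib_left)
  also have "\<dots> = (\<Sum>y\<in>cell k x. f y * u y)"
    unfolding avg_def using False by (simp del: of_real_sum)
  finally show ?thesis .
qed

text \<open>Defining property of the conditional expectation: \<open>h\<close> can be pulled out of
  each cell of level \<open>k\<close>, and \<open>f\<close> and its average have the same integral
  there.\<close>

lemma sum_avg:
  assumes u: "\<And>x. x \<in> X \<Longrightarrow> u x \<ge> 0" and h: "level_const k h"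
  shows "(\<Sum>x\<in>X. avg u k f x * h x * u x) = (\<Sum>x\<in>X. f x * h x * u x)"
  unfolding sum_cells[of _ k]
proof (rule sum.cong[OF refl])
  fix q assume "q \<in> \<pi> k ` X"
  then obtain z where z: "z \<in> X" "q = \<pi> k z" by auto
  have *: "(\<Sum>x\<in>{x \<in> X. \<pi> k x = q}. e x * h x * u x) = (\<Sum>x\<in>cell k z. e x * u x) * h z" for e
    unfolding sum_distrib_right
  proof (rule sum.cong)
    fix x assume "x \<in> cell k z"
    then have "h x = h z"
      using z by (intro level_constD[OF h]) (auto simp: cell_def)
    then show "e x * h x * u x = e x * u x * h z" by (simp only: mult_ac)
  qed (simp add: cell_def z)
  show "(\<Sum>x\<in>{x \<in> X. \<pi> k x = q}. avg u k f x * h x * u x) =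
      (\<Sum>x\<in>{x \<in> X. \<pi> k x = q}. f x * h x * u x)"
    by (simp only: * sum_avg_cell[of u k f z, OF u])
qed

text \<open>Orthogonality to coarser functions: both averages in the difference have the same
  pairing with \<open>h\<close>. The index is \<open>Suc k\<close> because level 0 has no
  cancellation.\<close>

lemma sum_mdiff_Suc:
  assumes u: "\<And>x. x \<in> X \<Longrightarrow> u x \<ge> 0" and h: "level_const k h"
  shows "(\<Sum>x\<in>X. mdiff u (Suc k) f x * h x * u x) = 0"
  using sum_avg[of u k h f, OF u h]
    sum_avg[of u "Suc k" h f, OF u level_const_mono[OF h, of "Suc k"]]
  by (simp add: mdiff_def algebra_simps sum_subtractf)

text \<open>The difference operator is a self-adjoint projection for the bilinear pairing.\<close>

lemma sum_mdiff_mult: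
  assumes u: "\<And>x. x \<in> X \<Longrightarrow> u x \<ge> 0"
  shows "(\<Sum>x\<in>X. f x * mdiff u k g x * u x) = (\<Sum>x\<in>X. mdiff u k f x * mdiff u k g x * u x)"
proof (cases k)
  case 0
  show ?thesis
    using sum_avg[of u k "mdiff u k g" f, OF u level_const_mdiff] 0
    by (simp add: mdiff_def)
next
  case (Suc j)
  have "(\<Sum>x\<in>X. mdiff u k f x * mdiff u k g x * u x) =
     (\<Sum>x\<in>X. avg u k f x * mdiff u k g x * u x) - (\<Sum>x\<in>X. mdiff u (Suc j) g x * avg u j f x * u x)"
    unfolding sum_subtractf[symmetric] using Suc
    by (intro sum.cong) (auto simp: mdiff_def algebra_simps)
  also have "\<dots> = (\<Sum>x\<in>X. f x * mdiff u k g x * u x)"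
    using sum_mdiff_Suc[of u j "avg u j f" g, OF u level_const_avg]
      sum_avg[of u k "mdiff u k g" f, OF u level_const_mdiff] by simp
  finally show ?thesis ..
qed

lemma wnorm_nonneg [simp]: "wnorm u f \<ge> 0"
  by (simp add: wnorm_def)

lemma wnorm_sq:
  assumes u: "\<And>x. x \<in> X \<Longrightarrow> u x \<ge> 0"
  shows "(wnorm u f)\<^sup>2 = (\<Sum>x\<in>X. (cmod (f x))\<^sup>2 * u x)"
  unfolding wnorm_def L2_set_def using u
  by (simp add: sum_nonneg power_mult_distrib cong: sum.cong)

lemma sum_wnorm_le:
  assumes u: "\<And>x. x \<in> X \<Longrightarrow> u x \<ge> 0"
  shows "(\<Sum>x\<in>X. cmod (f x) * cmod (g x) * u x) \<le> wnorm u f * wnorm u g"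
proof -
  have "(\<Sum>x\<in>X. cmod (f x) * cmod (g x) * u x) =
      (\<Sum>x\<in>X. \<bar>cmod (f x) * sqrt (u x)\<bar> * \<bar>cmod (g x) * sqrt (u x)\<bar>)"
    using u by (intro sum.cong) (auto simp: abs_mult)
  also have "\<dots> \<le> wnorm u f * wnorm u g"
    unfolding wnorm_def by (rule L2_set_mult_ineq)
  finally show ?thesis .
qed

lemma wnorm_sq_orthogonal:
  assumes u: "\<And>x. x \<in> X \<Longrightarrow> u x \<ge> 0"
    and orth: "(\<Sum>x\<in>X. (f x - g x) * cnj (g x) * u x) = 0"
  shows "(wnorm u f)\<^sup>2 = (wnorm u (\<lambda>x. f x - g x))\<^sup>2 + (wnorm u g)\<^sup>2"
proof -
  have "(cmod (f x))\<^sup>2 * u x = (cmod (f x - g x))\<^sup>2 * u x + (cmod (g x))\<^sup>2 * u x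
      + 2 * Re ((f x - g x) * cnj (g x) * u x)" for x
    unfolding cmod_power2 by (simp add: power2_eq_square algebra_simps)
  then have "(\<Sum>x\<in>X. (cmod (f x))\<^sup>2 * u x) =
      (\<Sum>x\<in>X. (cmod (f x - g x))\<^sup>2 * u x) + (\<Sum>x\<in>X. (cmod (g x))\<^sup>2 * u x)
      + 2 * Re (\<Sum>x\<in>X. (f x - g x) * cnj (g x) * u x)"
    by (simp only: sum.distrib sum_distrib_left Re_sum)
  then show ?thesis
    by (simp only: wnorm_sq[of u, OF u] orth) simp
qed

text \<open>Bessel's inequality: by Pythagoras the squares add up exactly to that of
  \<open>avg u n f\<close>, and one more application compares this with \<open>f\<close>.\<close>

lemma sum_wnorm_mdiff:
  assumes u: "\<And>x. x \<in> X \<Longrightarrow> u x \<ge> 0"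
  shows "(\<Sum>k\<le>n. (wnorm u (mdiff u k f))\<^sup>2) \<le> (wnorm u f)\<^sup>2"
proof -
  have cnj: "level_const n (\<lambda>x. cnj (avg u n f x))" for n
    using level_const_avg[of n u f] unfolding level_const_def by (intro ballI impI) (metis)
  have "(\<Sum>k\<le>n. (wnorm u (mdiff u k f))\<^sup>2) = (wnorm u (avg u n f))\<^sup>2"
  proof (induction n)
    case 0
    show ?case by (simp add: mdiff_def)
  next
    case (Suc n)
    have "(wnorm u (avg u (Suc n) f))\<^sup>2 =
        (wnorm u (\<lambda>x. avg u (Suc n) f x - avg u n f x))\<^sup>2 + (wnorm u (avg u n f))\<^sup>2"
      using sum_mdiff_Suc[of u n _ f, OF u cnj]
      by (intro wnorm_sq_orthogonal u) (simp_all add: mdiff_def)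
    moreover have "(\<lambda>x. avg u (Suc n) f x - avg u n f x) = mdiff u (Suc n) f"
      by (simp add: mdiff_def fun_eq_iff)
    ultimately show ?case using Suc by simp
  qed
  also have "\<dots> \<le> (wnorm u f)\<^sup>2"
  proof -
    have "(wnorm u f)\<^sup>2 = (wnorm u (\<lambda>x. f x - avg u n f x))\<^sup>2 + (wnorm u (avg u n f))\<^sup>2"
      using sum_avg[of u n _ f, OF u cnj]
      by (intro wnorm_sq_orthogonal u) (simp_all add: left_diff_distrib sum_subtractf)
    then show ?thesis by simp
  qed
  finally show ?thesis .
qed

lemma L2_set_wnorm_mdiff:
  assumes u: "\<And>x. x \<in> X \<Longrightarrow> u x \<ge> 0"
  shows "L2_set (\<lambda>k. wnorm u (mdiff u k f)) {..n} \<le> wnorm u f"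
  unfolding L2_set_def using sum_wnorm_mdiff[of u f n, OF u] by (simp add: real_le_lsqrt)

lemma sum_mdiff: "(\<Sum>k\<le>n. mdiff u k f x) = avg u n f x"
  by (induction n) (auto simp: mdiff_def)

text \<open>At the finest level a cell is a single point, so averaging changes \<open>f\<close> at
  most where \<open>u\<close> vanishes.\<close>

lemma avg_inj:
  assumes "inj_on (\<pi> n) X" "x \<in> X"
  shows "avg u n f x * u x = f x * u x"
proof -
  have "cell n x = {x}"
    using assms by (auto simp: cell_def inj_on_def)
  then show ?thesis by (simp add: avg_def)
qed

text \<open>The induction carries the Bellman function \<open>\<bar>s\<bar>\<^sup>2 / (B u + M)\<close> of a cell, where \<open>s\<close> is the
  integral of \<open>f\<close> over the cell and \<open>M\<close> the total Carleson mass below it.\<close>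

lemma carleson_embedding:
  assumes u: "\<And>x. x \<in> X \<Longrightarrow> u x \<ge> 0"
    and \<beta>: "\<And>k x. x \<in> X \<Longrightarrow> \<beta> k x \<ge> 0" and B: "B \<ge> 0"
    and carleson: "\<And>k x. x \<in> X \<Longrightarrow> k \<le> n \<Longrightarrow>
      (\<Sum>i\<in>{k..<n}. \<Sum>y\<in>cell k x. \<beta> i y) \<le> B * (\<Sum>y\<in>cell k x. u y)"
  shows "(\<Sum>k<n. \<Sum>x\<in>X. (cmod (avg u k f x))\<^sup>2 * \<beta> k x) \<le> 4 * B * (wnorm u f)\<^sup>2"
proof -
  define m where "m k x = (\<Sum>y\<in>cell k x. u y)" for k x
  define s where "s k x = (\<Sum>y\<in>cell k x. f y * u y)" for k x
  define F where "F k x = (\<Sum>y\<in>cell k x. (cmod (f y))\<^sup>2 * u y)" for k x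
  define M where "M k x = (\<Sum>i\<in>{k..<n}. \<Sum>y\<in>cell k x. \<beta> i y)" for k x
  define L where "L k x = (\<Sum>i\<in>{k..<n}. \<Sum>y\<in>cell k x. (cmod (avg u i f y))\<^sup>2 * \<beta> i y)" for k x
  have m0: "m k x \<ge> 0" for k x
    unfolding m_def by (intro sum_nonneg u) (rule in_cellD)
  have M0: "M k x \<ge> 0" for k x
    unfolding M_def by (intro sum_nonneg \<beta>) (rule in_cellD)
  have F0: "F k x \<ge> 0" for k x
    unfolding F_def by (intro sum_nonneg mult_nonneg_nonneg u) (auto intro: in_cellD)
  have s0: "s k x = 0" if "m k x = 0" for k x
  proof -
    have "u y = 0" if "y \<in> cell k x" for y
      using eq_0_if_sum_cell_eq_0[of u k x y, OF u] \<open>m k x = 0\<close> that by (simp add: m_def)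
    then show ?thesis by (simp add: s_def)
  qed
  \<comment> \<open>Backward induction from the finest level. By the Carleson condition
    \<open>B * m + M\<close> lies between \<open>B * m\<close> and \<open>2 * B * m\<close>, so the
    Bellman term stays comparable to \<open>|s|^2 / m\<close>.\<close>
  have key: "L k x + 4 * B\<^sup>2 * ((cmod (s k x))\<^sup>2 / (B * m k x + M k x)) \<le> 4 * B * F k x"
    if B: "B > 0" and "k \<le> n" "x \<in> X" for k x
    using that(2,3)
  proof (induction arbitrary: x rule: inc_induct)
    case base
    have "(cmod (s n x))\<^sup>2 \<le> m n x * F n x"
    proof -
      have "(cmod (s n x))\<^sup>2 \<le> (\<Sum>y\<in>cell n x. u y) * (\<Sum>y\<in>cell n x. (cmod (f y * u y))\<^sup>2 / u y)"
        unfolding s_def using u in_cellD by (intro norm_sum_sq_le) auto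
      also have "(\<Sum>y\<in>cell n x. (cmod (f y * u y))\<^sup>2 / u y) = F n x"
        unfolding F_def using u in_cellD
        by (intro sum.cong) (auto simp: norm_mult power_mult_distrib power2_eq_square)
      finally show ?thesis by (simp add: m_def)
    qed
    then have "(cmod (s n x))\<^sup>2 / m n x \<le> F n x"
      using m0[of n x] F0 by (cases "m n x = 0") (auto simp: field_simps)
    from mult_left_mono[OF this, of "4 * B"] B show ?case
      by (simp add: L_def M_def power2_eq_square)
  next
    case (step k)
    define q where "q = \<pi> (Suc k) ` cell k x"
    define c where "c = (\<Sum>y\<in>cell k x. \<beta> k y)"
    have c0: "c \<ge> 0"
      unfolding c_def by (intro sum_nonneg \<beta>) (rule in_cellD)
    define rep where "rep p = (SOME y. y \<in> cell k x \<and> \<pi> (Suc k) y = p)" for p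
    have rep: "rep p \<in> cell k x" "\<pi> (Suc k) (rep p) = p" if "p \<in> q" for p
      using someI_ex[of "\<lambda>y. y \<in> cell k x \<and> \<pi> (Suc k) y = p"] that
      unfolding q_def rep_def by auto
    have split: "sum h (cell k x) = (\<Sum>p\<in>q. sum h (cell (Suc k) (rep p)))"
      for h :: "'a \<Rightarrow> 'c::comm_monoid_add"
      unfolding sum_children[OF step.prems] q_def[symmetric]
    proof (rule sum.cong[OF refl])
      fix p assume "p \<in> q"
      show "sum h {y \<in> X. \<pi> (Suc k) y = p} = sum h (cell (Suc k) (rep p))"
        unfolding cell_def rep(2)[OF \<open>p \<in> q\<close>] ..
    qed
    have ivl: "{k..<n} = insert k {Suc k..<n}"
      using step.hyps by auto
    have m_split: "m k x = (\<Sum>p\<in>q. m (Suc k) (rep p))"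
      unfolding m_def split ..
    have s_split: "s k x = (\<Sum>p\<in>q. s (Suc k) (rep p))"
      unfolding s_def split ..
    have F_split: "F k x = (\<Sum>p\<in>q. F (Suc k) (rep p))"
      unfolding F_def split ..
    have M_split: "M k x = c + (\<Sum>p\<in>q. M (Suc k) (rep p))"
    proof -
      have "M k x = c + (\<Sum>i\<in>{Suc k..<n}. \<Sum>y\<in>cell k x. \<beta> i y)"
        unfolding M_def ivl c_def by simp
      also have "(\<Sum>i\<in>{Suc k..<n}. \<Sum>y\<in>cell k x. \<beta> i y) = (\<Sum>p\<in>q. M (Suc k) (rep p))"
        unfolding M_def split by (rule sum.swap)
      finally show ?thesis .
    qed
    have L_split: "L k x = (cmod (s k x) / m k x)\<^sup>2 * c + (\<Sum>p\<in>q. L (Suc k) (rep p))"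
    proof -
      have "(cmod (avg u k f y))\<^sup>2 * \<beta> k y = (cmod (s k x) / m k x)\<^sup>2 * \<beta> k y"
        if "y \<in> cell k x" for y
        unfolding avg_def cell_eq[OF that] s_def[symmetric] m_def[symmetric]
        using m0[of k x] by (simp add: norm_divide)
      then have "(\<Sum>y\<in>cell k x. (cmod (avg u k f y))\<^sup>2 * \<beta> k y) = (cmod (s k x) / m k x)\<^sup>2 * c"
        unfolding c_def sum_distrib_left by (intro sum.cong) auto
      then have "L k x = (cmod (s k x) / m k x)\<^sup>2 * c +
          (\<Sum>i\<in>{Suc k..<n}. \<Sum>y\<in>cell k x. (cmod (avg u i f y))\<^sup>2 * \<beta> i y)"
        unfolding L_def ivl by simp
      also have "(\<Sum>i\<in>{Suc k..<n}. \<Sum>y\<in>cell k x. (cmod (avg u i f y))\<^sup>2 * \<beta> i y) =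
          (\<Sum>p\<in>q. L (Suc k) (rep p))"
        unfolding L_def split by (rule sum.swap)
      finally show ?thesis .
    qed
    define t where "t = (\<Sum>p\<in>q. B * m (Suc k) (rep p) + M (Suc k) (rep p))"
    have t: "B * m k x + M k x = t + c"
      unfolding t_def m_split M_split by (simp add: sum.distrib sum_distrib_left)
    have t0: "t \<ge> 0"
      unfolding t_def using B m0 M0 by (intro sum_nonneg) (simp add: add_nonneg_nonneg)
    \<comment> \<open>Convexity of \<open>|s|^2 / t\<close> over the children; the new Carleson mass
      \<open>c\<close> of the cell itself is not yet included in \<open>t\<close>.\<close>
    have convex: "(cmod (s k x))\<^sup>2 \<le>
        t * (\<Sum>p\<in>q. (cmod (s (Suc k) (rep p)))\<^sup>2 / (B * m (Suc k) (rep p) + M (Suc k) (rep p)))"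
      unfolding t_def s_split
    proof (intro norm_sum_sq_le)
      fix p assume "p \<in> q"
      show "B * m (Suc k) (rep p) + M (Suc k) (rep p) \<ge> 0"
        using B m0 M0 by (simp add: add_nonneg_nonneg)
      assume "B * m (Suc k) (rep p) + M (Suc k) (rep p) = 0"
      then have "m (Suc k) (rep p) = 0"
        using B m0[of "Suc k" "rep p"] M0[of "Suc k" "rep p"]
        by (simp add: add_nonneg_eq_0_iff)
      then show "s (Suc k) (rep p) = 0" by (rule s0)
    qed
    have IH: "(\<Sum>p\<in>q. L (Suc k) (rep p)) + 4 * B\<^sup>2 *
        (\<Sum>p\<in>q. (cmod (s (Suc k) (rep p)))\<^sup>2 / (B * m (Suc k) (rep p) + M (Suc k) (rep p)))
        \<le> 4 * B * F k x"
      unfolding F_split sum_distrib_left sum.distrib[symmetric]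
      using step.IH rep in_cellD by (intro sum_mono) blast
    have tm: "t + c \<le> 2 * B * m k x"
      using carleson[OF step.prems, of k] step.hyps unfolding t[symmetric] M_def m_def by simp
    have "(cmod (s k x) / m k x)\<^sup>2 * c + 4 * B\<^sup>2 * ((cmod (s k x))\<^sup>2 / (t + c)) \<le>
      4 * B\<^sup>2 * (\<Sum>p\<in>q. (cmod (s (Suc k) (rep p)))\<^sup>2 / (B * m (Suc k) (rep p) + M (Suc k) (rep p)))"
      (is "?l \<le> 4 * B\<^sup>2 * ?S")
    proof (cases "m k x = 0 \<or> t = 0")
      case True
      have "s k x = 0"
        using True s0[of k x] convex by auto
      moreover have "?S \<ge> 0"
        using B m0 M0 by (intro sum_nonneg divide_nonneg_nonneg add_nonneg_nonneg mult_nonneg_nonneg) auto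
      ultimately show ?thesis using B by simp
    next
      case False
      then have pos: "t > 0" "m k x > 0" using t0 m0[of k x] by auto
      \<comment> \<open>The new term \<open>|s|^2 * c / m^2\<close> is paid for by the drop of the
        Bellman function when \<open>c\<close> is added to \<open>t\<close>. That drop is
        \<open>|s|^2 * c / (t * (t + c))\<close>, and both \<open>t\<close> and \<open>t + c\<close>
        are at most \<open>2 * B * m\<close>; this is the origin of the factor 4.\<close>
      have "t * (t + c) \<le> (2 * B * m k x) * (2 * B * m k x)"
        using tm t0 c0 by (intro mult_mono) auto
      then have "4 * B\<^sup>2 * c / (4 * B\<^sup>2 * (m k x)\<^sup>2) \<le> 4 * B\<^sup>2 * c / (t * (t + c))"
        using pos c0 B by (intro divide_left_mono) (auto simp: power2_eq_square mult_ac)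
      then have "c / (m k x)\<^sup>2 \<le> 4 * B\<^sup>2 * (c / (t * (t + c)))"
        using B by simp
      also have "c / (t * (t + c)) = 1 / t - 1 / (t + c)"
        using pos c0 by (simp add: divide_simps)
      finally have "c / (m k x)\<^sup>2 + 4 * B\<^sup>2 / (t + c) \<le> 4 * B\<^sup>2 / t"
        by (simp add: algebra_simps)
      from mult_left_mono[OF this, of "(cmod (s k x))\<^sup>2"]
      have "?l \<le> 4 * B\<^sup>2 * ((cmod (s k x))\<^sup>2 / t)"
        by (simp add: algebra_simps power_divide)
      also have "\<dots> \<le> 4 * B\<^sup>2 * ?S"
        using convex pos by (intro mult_left_mono) (auto simp: pos_divide_le_eq mult.commute)
      finally show ?thesis .
    qed
    then show ?case
      using IH unfolding t L_split by linarith
  qed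
  have main: "(\<Sum>k<n. \<Sum>x\<in>cell 0 z. (cmod (avg u k f x))\<^sup>2 * \<beta> k x) \<le> 4 * B * F 0 z"
    if z: "z \<in> X" for z
  proof (cases "B = 0")
    \<comment> \<open>For \<open>B = 0\<close> the Bellman function degenerates, but then the
      Carleson condition forces every \<open>\<beta> i\<close> with \<open>i < n\<close> to vanish
      on the cell.\<close>
    case True
    have "(\<Sum>i\<in>{0..<n}. \<Sum>y\<in>cell 0 z. \<beta> i y) \<le> 0"
      using carleson[OF z, of 0] True by simp
    moreover have nn: "(\<Sum>y\<in>cell 0 z. \<beta> i y) \<ge> 0" for i
      by (intro sum_nonneg \<beta>) (rule in_cellD)
    ultimately have "(\<Sum>y\<in>cell 0 z. \<beta> i y) = 0" if "i < n" for i
      using that sum_nonneg_eq_0_iff[of "{0..<n}" "\<lambda>i. \<Sum>y\<in>cell 0 z. \<beta> i y"]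
        sum_nonneg[of "{0..<n}" "\<lambda>i. \<Sum>y\<in>cell 0 z. \<beta> i y"] by fastforce
    then have "\<beta> i y = 0" if "i < n" "y \<in> cell 0 z" for i y
      using that sum_nonneg_eq_0_iff[of "cell 0 z" "\<beta> i"] \<beta> in_cellD[of _ 0 z]
      by (metis finite_cell)
    then show ?thesis using True by simp
  next
    case False
    have "(cmod (s 0 z))\<^sup>2 / (B * m 0 z + M 0 z) \<ge> 0"
      using B m0 M0 by (simp add: add_nonneg_nonneg)
    then have "4 * B\<^sup>2 * ((cmod (s 0 z))\<^sup>2 / (B * m 0 z + M 0 z)) \<ge> 0"
      by (intro mult_nonneg_nonneg) auto
    with key[of 0 z] False B z show ?thesis
      by (simp add: L_def lessThan_atLeast0)
  qed
  have "(\<Sum>k<n. \<Sum>x\<in>X. (cmod (avg u k f x))\<^sup>2 * \<beta> k x) =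
      (\<Sum>q\<in>\<pi> 0 ` X. \<Sum>k<n. \<Sum>x | x \<in> X \<and> \<pi> 0 x = q. (cmod (avg u k f x))\<^sup>2 * \<beta> k x)"
    unfolding sum_cells[of _ 0] by (rule sum.swap)
  also have "\<dots> \<le> (\<Sum>q\<in>\<pi> 0 ` X. 4 * B * (\<Sum>x | x \<in> X \<and> \<pi> 0 x = q. (cmod (f x))\<^sup>2 * u x))"
    using main by (intro sum_mono) (auto simp: cell_def F_def)
  also have "\<dots> = 4 * B * (wnorm u f)\<^sup>2"
  proof -
    have "(wnorm u f)\<^sup>2 = (\<Sum>x\<in>X. (cmod (f x))\<^sup>2 * u x)"
      using u by (rule wnorm_sq)
    then show ?thesis
      unfolding sum_cells[of _ 0] by (simp only: sum_distrib_left)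
  qed
  finally show ?thesis .
qed

section \<open>Linearity and locality of averages and differences\<close>

lemma avg_cong:
  "(\<And>y. y \<in> cell k x \<Longrightarrow> f y = g y) \<Longrightarrow> avg u k f x = avg u k g x"
  by (simp add: avg_def cong: sum.cong)

lemma avg_diff: "avg u k (\<lambda>y. f y - g y) x = avg u k f x - avg u k g x"
  by (simp add: avg_def left_diff_distrib sum_subtractf diff_divide_distrib)

lemma avg_cmult: "avg u k (\<lambda>y. c * f y) x = c * avg u k f x"
  by (simp add: avg_def sum_distrib_left mult.assoc)

lemma avg_const:
  assumes u: "\<And>x. x \<in> X \<Longrightarrow> u x \<ge> 0" and x: "x \<in> X" "u x \<noteq> 0"
    and f: "\<And>y. y \<in> cell k x \<Longrightarrow> f y = c"
  shows "avg u k f x = c"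
proof -
  have "(\<Sum>y\<in>cell k x. u y) \<noteq> 0"
    using eq_0_if_sum_cell_eq_0[of u k x x, OF u] x self_in_cell by blast
  then have "of_real (\<Sum>y\<in>cell k x. u y) \<noteq> (0::complex)"
    by (simp only: of_real_eq_0_iff not_False_eq_True)
  moreover have "(\<Sum>y\<in>cell k x. f y * u y) = c * of_real (\<Sum>y\<in>cell k x. u y)"
    using f by (simp add: sum_distrib_left)
  ultimately show ?thesis
    unfolding avg_def by (metis nonzero_mult_div_cancel_right)
qed

lemma cell_mono:
  assumes "j \<le> k" "x \<in> X"
  shows "cell k x \<subseteq> cell j x"
  using refine_le[OF assms(1) _ assms(2)] by (auto simp: cell_def)

lemma mdiff_diff: "mdiff u k (\<lambda>y. f y - g y) x = mdiff u k f x - mdiff u k g x"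
  by (simp add: mdiff_def avg_diff)

lemma mdiff_cmult: "mdiff u k (\<lambda>y. c * f y) x = c * mdiff u k f x"
  by (simp add: mdiff_def avg_cmult right_diff_distrib)

lemma mdiff_cong:
  assumes "x \<in> X" "\<And>y. y \<in> cell (k - 1) x \<Longrightarrow> f y = g y"
  shows "mdiff u k f x = mdiff u k g x"
proof -
  have "avg u k f x = avg u k g x"
    using assms cell_mono[of "k - 1" k x] by (intro avg_cong) auto
  moreover have "avg u (k - 1) f x = avg u (k - 1) g x"
    using assms by (intro avg_cong) auto
  ultimately show ?thesis by (simp add: mdiff_def)
qed

lemma mdiff_eq_0:
  assumes u: "\<And>x. x \<in> X \<Longrightarrow> u x \<ge> 0" and x: "x \<in> X" "u x \<noteq> 0"
    and f: "\<And>y. y \<in> cell k x \<Longrightarrow> f y = c"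
  shows "mdiff u (Suc k) f x = 0"
proof -
  have "avg u (Suc k) f x = c"
    using f cell_mono[of k "Suc k" x] x by (intro avg_const u) auto
  moreover have "avg u k f x = c"
    using f x by (intro avg_const u) auto
  ultimately show ?thesis by (simp add: mdiff_def)
qed

end

subsection \<open>Shifts on a finite tree\<close>

text \<open>The shift after discretization: \<open>K p\<close> is the block of the cubes of level
  \<open>p\<close> divided by their volume \<open>w p\<close>, \<open>u\<close> and \<open>v\<close>
  are the masses of the leaves, \<open>A\<close> bounds the \<open>A\<^sub>2\<close> products and
  \<open>B\<close> the testing sums. A Haar function of a cube at most \<open>r\<close> levels
  further down is constant on the children of that cube, whence \<open>p + r + 1\<close> in
  \<open>K_left\<close> and \<open>K_right\<close>.\<close>

locale shift_model = partition_tower X \<pi>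
  for X :: "'a set" and \<pi> :: "nat \<Rightarrow> 'a \<Rightarrow> 'b" +
  fixes N r :: nat and K :: "nat \<Rightarrow> 'a \<Rightarrow> 'a \<Rightarrow> complex" and w :: "nat \<Rightarrow> real"
    and u v :: "'a \<Rightarrow> real" and A B :: real
  assumes u_nonneg: "x \<in> X \<Longrightarrow> u x \<ge> 0" and v_nonneg: "x \<in> X \<Longrightarrow> v x \<ge> 0"
    and inj: "inj_on (\<pi> N) X"
    and K_supp: "\<lbrakk>x \<in> X; y \<in> X; \<pi> p x \<noteq> \<pi> p y\<rbrakk> \<Longrightarrow> K p x y = 0"
    and K_bound: "\<lbrakk>x \<in> X; y \<in> X; p \<le> N\<rbrakk> \<Longrightarrow> cmod (K p x y) \<le> 1 / w p"
    and K_left: "\<lbrakk>x \<in> X; x' \<in> X; y \<in> X; p \<le> N; \<pi> (p + r + 1) x = \<pi> (p + r + 1) x'\<rbrakk>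
      \<Longrightarrow> K p x y = K p x' y"
    and K_right: "\<lbrakk>x \<in> X; y \<in> X; y' \<in> X; p \<le> N; \<pi> (p + r + 1) y = \<pi> (p + r + 1) y'\<rbrakk>
      \<Longrightarrow> K p x y = K p x y'"
    and w_pos: "p \<le> N \<Longrightarrow> w p > 0"
    and w_half: "p < N \<Longrightarrow> w (Suc p) \<le> w p / 2"
    and A_nonneg: "A \<ge> 0" and B_nonneg: "B \<ge> 0"
    and A2: "\<lbrakk>x \<in> X; p \<le> N\<rbrakk> \<Longrightarrow>
      (\<Sum>y\<in>cell p x. u y) * (\<Sum>y\<in>cell p x. v y) \<le> A * (w p)\<^sup>2"
    and test: "\<lbrakk>x \<in> X; k \<le> N\<rbrakk> \<Longrightarrow>
      (\<Sum>z\<in>cell k x. (cmod (\<Sum>y\<in>cell k x. (\<Sum>p\<le>N. K p z y) * u y))\<^sup>2 * v z)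
        \<le> B * (\<Sum>y\<in>cell k x. u y)"
    and test_adj: "\<lbrakk>x \<in> X; k \<le> N\<rbrakk> \<Longrightarrow>
      (\<Sum>z\<in>cell k x. (cmod (\<Sum>y\<in>cell k x. (\<Sum>p\<le>N. K p y z) * v y))\<^sup>2 * u z)
        \<le> B * (\<Sum>y\<in>cell k x. v y)"
begin

text \<open>Bilinear rather than sesquilinear: exchanging the two functions then just transposes
  \<open>K\<close>, without conjugates.\<close>

definition form :: "nat \<Rightarrow> ('a \<Rightarrow> complex) \<Rightarrow> ('a \<Rightarrow> complex) \<Rightarrow> complex" where
  "form p f g = (\<Sum>x\<in>X. \<Sum>y\<in>X. K p x y * (f y * u y) * (g x * v x))"

definition ker :: "'a \<Rightarrow> 'a \<Rightarrow> complex" where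
  "ker x y = (\<Sum>p\<le>N. K p x y)"

definition op :: "('a \<Rightarrow> complex) \<Rightarrow> 'a \<Rightarrow> complex" where
  "op f x = (\<Sum>y\<in>X. ker x y * (f y * u y))"

text \<open>The assumptions are symmetric in the two weights, so each estimate with \<open>f\<close>
  on the coarser side yields the one with \<open>g\<close> on the coarser side.\<close>

lemma shift_model_swap: "shift_model X \<pi> N r (\<lambda>p x y. K p y x) w v u A B"
proof
  fix x y p assume "x \<in> X" "y \<in> X" "\<pi> p x \<noteq> \<pi> p y"
  then show "K p y x = 0" by (intro K_supp) auto
next
  fix x x' y p assume *: "x \<in> X" "x' \<in> X" "y \<in> X" "p \<le> N" "\<pi> (p + r + 1) x = \<pi> (p + r + 1) x'"
  then show "K p y x = K p y x'" by (intro K_right) auto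
next
  fix x y y' p assume *: "x \<in> X" "y \<in> X" "y' \<in> X" "p \<le> N" "\<pi> (p + r + 1) y = \<pi> (p + r + 1) y'"
  then show "K p y x = K p y' x" by (intro K_left) auto
next
  fix x p assume "x \<in> X" "p \<le> N"
  with A2[of x p] show "(\<Sum>y\<in>cell p x. v y) * (\<Sum>y\<in>cell p x. u y) \<le> A * (w p)\<^sup>2"
    by (simp only: mult.commute)
qed (assumption | rule u_nonneg v_nonneg inj w_pos w_half A_nonneg B_nonneg K_bound test test_adj)+

lemma sum_form: "(\<Sum>p\<le>N. form p f g) = (\<Sum>x\<in>X. op f x * g x * v x)"
proof -
  have "(\<Sum>p\<le>N. form p f g) = (\<Sum>x\<in>X. \<Sum>p\<le>N. \<Sum>y\<in>X. K p x y * (f y * u y) * (g x * v x))"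
    unfolding form_def by (rule sum.swap)
  also have "\<dots> = (\<Sum>x\<in>X. \<Sum>y\<in>X. \<Sum>p\<le>N. K p x y * (f y * u y) * (g x * v x))"
    by (intro sum.cong refl sum.swap)
  also have "\<dots> = (\<Sum>x\<in>X. op f x * g x * v x)"
    unfolding op_def ker_def by (simp only: sum_distrib_right mult.assoc)
  finally show ?thesis .
qed

lemma op_diff: "op (\<lambda>y. f y - g y) x = op f x - op g x"
  by (simp add: op_def algebra_simps sum_subtractf)

lemma op_cmult: "op (\<lambda>y. c * f y) x = c * op f x"
  by (simp add: op_def sum_distrib_left mult_ac)

text \<open>The kernel seen from a cell of level \<open>k + r\<close> does not distinguish the points of that cell,
  as long as the argument of the operator lives outside of the ancestor cell of level \<open>k\<close>.\<close>

lemma mdiff_op_local: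
  assumes x: "x \<in> X" "v x \<noteq> 0" and h: "\<And>y. y \<in> cell k x \<Longrightarrow> h y = h' y"
  shows "mdiff v (k + r + 1) (op h) x = mdiff v (k + r + 1) (op h') x"
proof -
  define e where "e y = h y - h' y" for y
  have "op e z = op e x" if z: "z \<in> cell (k + r) x" for z
    unfolding op_def
  proof (rule sum.cong[OF refl])
    fix y assume y: "y \<in> X"
    have zX: "z \<in> X" and zx: "\<pi> (k + r) z = \<pi> (k + r) x"
      using z by (auto simp: cell_def)
    show "ker z y * (e y * u y) = ker x y * (e y * u y)"
    proof (cases "\<pi> k y = \<pi> k x")
      case True
      then have "e y = 0"
        using h y by (simp add: e_def cell_def)
      then show ?thesis by simp
    next
      case False
      have "K p z y = K p x y" if "p \<le> N" for p
      \<comment> \<open>A large block cannot tell \<open>z\<close> from \<open>x\<close>: they share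
        a cell of level \<open>k + r\<close>, and \<open>p + r + 1\<close> is at most that. A small
        block vanishes, since \<open>y\<close> lies outside of the cell of level \<open>k\<close>
        that contains both.\<close>
      proof (cases "p < k")
        case True
        then have "\<pi> (p + r + 1) z = \<pi> (p + r + 1) x"
          using refine_le[of "p + r + 1" "k + r" z x] zX x zx by simp
        then show ?thesis
          using zX x y that by (intro K_left) auto
      next
        case p: False
        have "\<pi> k z = \<pi> k x"
          using refine_le[of k "k + r" z x] zX x zx by simp
        then have "\<pi> p z \<noteq> \<pi> p y" "\<pi> p x \<noteq> \<pi> p y"
          using p False zX x y refine_le[of k p z y] refine_le[of k p x y] by auto
        then show ?thesis
          using zX x y by (simp add: K_supp)
      qed
      then have "ker z y = ker x y" by (simp add: ker_def)
      then show ?thesis by simp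
    qed
  qed
  then have "mdiff v (Suc (k + r)) (op e) x = 0"
    using x by (intro mdiff_eq_0 v_nonneg) auto
  then have "mdiff v (k + r + 1) (\<lambda>z. op h z - op h' z) x = 0"
    unfolding e_def op_diff by simp
  then show ?thesis
    unfolding mdiff_diff by simp
qed

text \<open>By locality \<open>f\<close> enters at each point only through its average, so this is a
  paraproduct with symbol \<open>b\<close>. Its Carleson condition is the testing condition: below
  one cell all \<open>b i\<close> are differences of a single function, and Bessel's inequality
  bounds them by one testing sum. The constant is the square root of the \<open>4 * B\<close> of the
  embedding theorem.\<close>

lemma paraproduct_bound:
  assumes n: "n + r \<le> N"
  shows "cmod (\<Sum>k<n. \<Sum>p\<le>N. form p (avg u k f) (mdiff v (k + r + 1) g))
    \<le> 2 * sqrt B * (wnorm u f * wnorm v g)"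
proof -
  define b where "b k x = mdiff v (k + r + 1) (op (indicator (cell k x))) x" for k x
  have b: "mdiff v (k + r + 1) (op (avg u k f)) x * v x = avg u k f x * b k x * v x"
    if x: "x \<in> X" for k x
  proof (cases "v x = 0")
    case False
    have "mdiff v (k + r + 1) (op (avg u k f)) x =
        mdiff v (k + r + 1) (op (\<lambda>y. avg u k f x * indicator (cell k x) y)) x"
      using x False by (intro mdiff_op_local) (auto simp: avg_def dest: cell_eq)
    also have "\<dots> = avg u k f x * b k x"
      unfolding b_def op_cmult mdiff_cmult ..
    finally show ?thesis by simp
  qed simp
  have carleson: "(\<Sum>i\<in>{k..<n}. \<Sum>y\<in>cell k x. (cmod (b i y))\<^sup>2 * v y) \<le> B * (\<Sum>y\<in>cell k x. u y)"
    if x: "x \<in> X" and k: "k \<le> n" for k x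
  proof -
    \<comment> \<open>Cutting off the image of the indicator of the cell outside of the cell changes
      no difference of level above \<open>k + r\<close> inside it, and the squared norm of what
      remains is the testing sum.\<close>
    define G where "G z = indicator (cell k x) z * op (indicator (cell k x)) z" for z
    have eq: "b i y * v y = mdiff v (i + r + 1) G y * v y"
      if i: "k \<le> i" and y: "y \<in> cell k x" for i y
    proof (cases "v y = 0")
      case False
      have "y \<in> X" using y by (rule in_cellD)
      have sub: "cell j y \<subseteq> cell k x" if "k \<le> j" for j
        using cell_mono[of k j y] that \<open>y \<in> X\<close> cell_eq[OF y] by simp
      have "b i y = mdiff v (i + r + 1) (op (indicator (cell k x))) y"
        unfolding b_def using \<open>y \<in> X\<close> False sub[of i] i
        by (intro mdiff_op_local) (auto simp: indicator_def)
      also have "\<dots> = mdiff v (i + r + 1) G y"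
        using \<open>y \<in> X\<close> sub[of "i + r"] i
        by (intro mdiff_cong) (auto simp: G_def indicator_def)
      finally show ?thesis by simp
    qed simp
    have "(\<Sum>i\<in>{k..<n}. \<Sum>y\<in>cell k x. (cmod (b i y))\<^sup>2 * v y) \<le>
        (\<Sum>i\<in>{k..<n}. (wnorm v (mdiff v (i + r + 1) G))\<^sup>2)"
    proof (rule sum_mono)
      fix i assume i: "i \<in> {k..<n}"
      have "(\<Sum>y\<in>cell k x. (cmod (b i y))\<^sup>2 * v y) =
          (\<Sum>y\<in>cell k x. (cmod (mdiff v (i + r + 1) G y))\<^sup>2 * v y)"
      proof (rule sum.cong[OF refl])
        fix y assume "y \<in> cell k x"
        then show "(cmod (b i y))\<^sup>2 * v y = (cmod (mdiff v (i + r + 1) G y))\<^sup>2 * v y"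
          using eq[of i y] i by (cases "v y = 0") simp_all
      qed
      also have "\<dots> \<le> (\<Sum>y\<in>X. (cmod (mdiff v (i + r + 1) G y))\<^sup>2 * v y)"
        using finite_X v_nonneg by (intro sum_mono2) (auto dest: in_cellD)
      also have "\<dots> = (wnorm v (mdiff v (i + r + 1) G))\<^sup>2"
        using v_nonneg by (rule wnorm_sq[symmetric])
      finally show "(\<Sum>y\<in>cell k x. (cmod (b i y))\<^sup>2 * v y) \<le> (wnorm v (mdiff v (i + r + 1) G))\<^sup>2" .
    qed
    also have "\<dots> = (\<Sum>l\<in>(\<lambda>i. i + r + 1) ` {k..<n}. (wnorm v (mdiff v l G))\<^sup>2)"
      by (subst sum.reindex) (auto simp: inj_on_def)
    also have "\<dots> \<le> (\<Sum>l\<le>n + r. (wnorm v (mdiff v l G))\<^sup>2)"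
      by (intro sum_mono2) auto
    also have "\<dots> \<le> (wnorm v G)\<^sup>2"
      using v_nonneg by (rule sum_wnorm_mdiff)
    also have "\<dots> = (\<Sum>z\<in>X. (cmod (G z))\<^sup>2 * v z)"
      using v_nonneg by (rule wnorm_sq)
    also have "\<dots> = (\<Sum>z\<in>cell k x. (cmod (G z))\<^sup>2 * v z)"
      using finite_X by (intro sum.mono_neutral_right) (auto simp: G_def dest: in_cellD)
    also have "\<dots> = (\<Sum>z\<in>cell k x. (cmod (\<Sum>y\<in>cell k x. (\<Sum>p\<le>N. K p z y) * u y))\<^sup>2 * v z)"
    proof (rule sum.cong[OF refl])
      fix z assume "z \<in> cell k x"
      then have "G z = (\<Sum>y\<in>X. ker z y * ((indicator (cell k x) y :: complex) * u y))"
        by (simp add: G_def op_def)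
      also have "\<dots> = (\<Sum>y\<in>cell k x. (\<Sum>p\<le>N. K p z y) * u y)"
        unfolding ker_def using finite_X
        by (intro sum.mono_neutral_cong_right) (auto simp: indicator_def dest: in_cellD)
      finally show "(cmod (G z))\<^sup>2 * v z =
          (cmod (\<Sum>y\<in>cell k x. (\<Sum>p\<le>N. K p z y) * u y))\<^sup>2 * v z" by simp
    qed
    also have "\<dots> \<le> B * (\<Sum>y\<in>cell k x. u y)"
      using x k n by (intro test) auto
    finally show ?thesis .
  qed
  have "(\<Sum>k<n. \<Sum>p\<le>N. form p (avg u k f) (mdiff v (k + r + 1) g)) =
      (\<Sum>k<n. \<Sum>x\<in>X. avg u k f x * b k x * mdiff v (k + r + 1) g x * v x)"
  proof (rule sum.cong[OF refl])
    fix k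
    have "(\<Sum>p\<le>N. form p (avg u k f) (mdiff v (k + r + 1) g)) =
       (\<Sum>x\<in>X. mdiff v (k + r + 1) (op (avg u k f)) x * mdiff v (k + r + 1) g x * v x)"
      unfolding sum_form using v_nonneg by (rule sum_mdiff_mult)
    also have "\<dots> = (\<Sum>x\<in>X. avg u k f x * b k x * mdiff v (k + r + 1) g x * v x)"
    proof (rule sum.cong[OF refl])
      fix x assume "x \<in> X"
      from b[OF this, of k]
      show "mdiff v (k + r + 1) (op (avg u k f)) x * mdiff v (k + r + 1) g x * v x =
          avg u k f x * b k x * mdiff v (k + r + 1) g x * v x"
        by (metis mult.assoc mult.commute)
    qed
    finally show "(\<Sum>p\<le>N. form p (avg u k f) (mdiff v (k + r + 1) g)) =
      (\<Sum>x\<in>X. avg u k f x * b k x * mdiff v (k + r + 1) g x * v x)" .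
  qed
  also have "cmod \<dots> \<le> (\<Sum>k<n. \<Sum>x\<in>X. cmod (avg u k f x * b k x * mdiff v (k + r + 1) g x * v x))"
    by (intro sum_norm_le norm_sum)
  \<comment> \<open>\<open>v x\<close> is split into two square roots for Cauchy--Schwarz over pairs
    of a level and a point: the first factor is the Carleson sum, the second a Bessel sum.\<close>
  also have "\<dots> = (\<Sum>(k, x)\<in>{..<n} \<times> X. \<bar>cmod (avg u k f x) * cmod (b k x) * sqrt (v x)\<bar> *
      \<bar>cmod (mdiff v (k + r + 1) g x) * sqrt (v x)\<bar>)"
    unfolding sum.cartesian_product using v_nonneg
    by (intro sum.cong) (auto simp: norm_mult abs_mult)
  also have "\<dots> \<le>
      L2_set (\<lambda>(k, x). cmod (avg u k f x) * cmod (b k x) * sqrt (v x)) ({..<n} \<times> X) *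
      L2_set (\<lambda>(k, x). cmod (mdiff v (k + r + 1) g x) * sqrt (v x)) ({..<n} \<times> X)"
    using L2_set_mult_ineq[of "\<lambda>(k, x). cmod (avg u k f x) * cmod (b k x) * sqrt (v x)"
      "\<lambda>(k, x). cmod (mdiff v (k + r + 1) g x) * sqrt (v x)"]
    by (simp add: case_prod_unfold)
  also have "\<dots> \<le> (2 * sqrt B * wnorm u f) * wnorm v g"
  proof (intro mult_mono)
    have "(\<Sum>k<n. \<Sum>x\<in>X. (cmod (avg u k f x))\<^sup>2 * ((cmod (b k x))\<^sup>2 * v x)) \<le> 4 * B * (wnorm u f)\<^sup>2"
      using u_nonneg v_nonneg B_nonneg carleson by (intro carleson_embedding) auto
    moreover have "(\<Sum>z\<in>{..<n} \<times> X. (case z of (k, x) \<Rightarrow> cmod (avg u k f x) * cmod (b k x) * sqrt (v x))\<^sup>2)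
      = (\<Sum>k<n. \<Sum>x\<in>X. (cmod (avg u k f x))\<^sup>2 * ((cmod (b k x))\<^sup>2 * v x))"
      unfolding sum.cartesian_product using v_nonneg
      by (intro sum.cong) (auto simp: power_mult_distrib)
    ultimately show "L2_set (\<lambda>(k, x). cmod (avg u k f x) * cmod (b k x) * sqrt (v x)) ({..<n} \<times> X)
        \<le> 2 * sqrt B * wnorm u f"
      unfolding L2_set_def using B_nonneg
      by (intro real_le_lsqrt) (auto simp: power_mult_distrib)
    have "(\<Sum>z\<in>{..<n} \<times> X. (case z of (k, x) \<Rightarrow> cmod (mdiff v (k + r + 1) g x) * sqrt (v x))\<^sup>2)
      = (\<Sum>k<n. \<Sum>x\<in>X. (cmod (mdiff v (k + r + 1) g x))\<^sup>2 * v x)"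
      unfolding sum.cartesian_product using v_nonneg
      by (intro sum.cong) (auto simp: power_mult_distrib)
    also have "\<dots> = (\<Sum>k<n. (wnorm v (mdiff v (k + r + 1) g))\<^sup>2)"
      using v_nonneg by (simp add: wnorm_sq)
    also have "\<dots> = (\<Sum>l\<in>(\<lambda>i. i + r + 1) ` {..<n}. (wnorm v (mdiff v l g))\<^sup>2)"
      by (subst sum.reindex) (auto simp: inj_on_def)
    also have "\<dots> \<le> (\<Sum>l\<le>n + r. (wnorm v (mdiff v l g))\<^sup>2)"
      by (intro sum_mono2) auto
    also have "\<dots> \<le> (wnorm v g)\<^sup>2"
      using v_nonneg by (rule sum_wnorm_mdiff)
    finally show "L2_set (\<lambda>(k, x). cmod (mdiff v (k + r + 1) g x) * sqrt (v x)) ({..<n} \<times> X)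
        \<le> wnorm v g"
      unfolding L2_set_def by (intro real_le_lsqrt) auto
  qed (use B_nonneg in auto)
  finally show ?thesis by (simp add: mult.assoc)
qed


text \<open>Blocks of level at least \<open>k\<close> stay within cells of level \<open>k\<close>,
  where \<open>F\<close> is constant. So their sum acts on \<open>F\<close> as multiplication by
  \<open>H\<close>, its value on the indicator of the cell, and it suffices to bound the norm of
  \<open>H\<close> on each cell; \<open>G\<close> enters by Cauchy--Schwarz.\<close>

lemma near_bound:
  assumes k: "k \<le> N" and F: "level_const k F"
  shows "cmod (\<Sum>p\<in>{k..N}. form p F G) \<le> (sqrt A + sqrt B) * (wnorm u F * wnorm v G)"
proof -
  define c where "c = sqrt A + sqrt B"
  have c0: "c \<ge> 0"
    using A_nonneg B_nonneg by (simp add: c_def)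
  define H where "H x = (\<Sum>p\<in>{k..N}. \<Sum>y\<in>cell k x. K p x y * u y)" for x
  have H: "(\<Sum>z\<in>cell k x. (cmod (H z))\<^sup>2 * v z) \<le> c\<^sup>2 * (\<Sum>y\<in>cell k x. u y)"
    if x: "x \<in> X" for x
  proof -
    define U V where "U = (\<Sum>y\<in>cell k x. u y)" and "V = (\<Sum>y\<in>cell k x. v y)"
    have U0: "U \<ge> 0"
      unfolding U_def by (intro sum_nonneg u_nonneg) (rule in_cellD)
    \<comment> \<open>The testing condition is about the full kernel, that is \<open>S\<close>;
      \<open>R\<close> collects the blocks of cubes larger than the cell.\<close>
    define S where "S z = (\<Sum>y\<in>cell k x. (\<Sum>p\<le>N. K p z y) * u y)" for z
    define R where "R z = (\<Sum>p<k. \<Sum>y\<in>cell k x. K p z y * u y)" for z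
    have HSR: "H z = S z + - R z" if "z \<in> cell k x" for z
    proof -
      have "S z = (\<Sum>p\<in>{..<k} \<union> {k..N}. \<Sum>y\<in>cell k x. K p z y * u y)"
        unfolding S_def sum_distrib_right using k
        by (subst sum.swap) (intro sum.cong, auto)
      also have "\<dots> = R z + H z"
        unfolding R_def H_def cell_eq[OF that] by (rule sum.union_disjoint) auto
      finally show ?thesis by simp
    qed
    have R: "cmod (R z) \<le> U / w k" if z: "z \<in> cell k x" for z
    proof -
      have "cmod (R z) \<le> (\<Sum>p<k. \<Sum>y\<in>cell k x. cmod (K p z y * u y))"
        unfolding R_def by (intro sum_norm_le norm_sum)
      also have "\<dots> \<le> (\<Sum>p<k. \<Sum>y\<in>cell k x. 1 / w p * u y)"
      proof (intro sum_mono)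
        fix p y assume "p \<in> {..<k}" "y \<in> cell k x"
        then show "cmod (K p z y * u y) \<le> 1 / w p * u y"
          using K_bound[of z y p] in_cellD[OF z] in_cellD[of y k x] k u_nonneg[of y] w_pos[of p]
          unfolding norm_mult by (intro mult_mono) auto
      qed
      also have "\<dots> = (\<Sum>p<k. 1 / w p) * U"
        unfolding U_def sum_product ..
      also have "\<dots> \<le> 1 / w k * U"
        using k U0 w_pos w_half by (intro mult_right_mono sum_le_sum_div_of_halving) auto
      finally show ?thesis by simp
    qed
    have "L2_set (\<lambda>z. cmod (H z) * sqrt (v z)) (cell k x) \<le>
        L2_set (\<lambda>z. cmod (S z) * sqrt (v z) + U / w k * sqrt (v z)) (cell k x)"
    proof (rule L2_set_mono)
      fix z assume z: "z \<in> cell k x"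
      have "cmod (H z) \<le> cmod (S z) + U / w k"
        using HSR[OF z] R[OF z] norm_triangle_ineq[of "S z" "- R z"] by simp
      from mult_right_mono[OF this, of "sqrt (v z)"]
      show "cmod (H z) * sqrt (v z) \<le> cmod (S z) * sqrt (v z) + U / w k * sqrt (v z)"
        using v_nonneg[OF in_cellD[OF z]] by (simp add: algebra_simps)
    qed (use v_nonneg in_cellD in auto)
    also have "\<dots> \<le> L2_set (\<lambda>z. cmod (S z) * sqrt (v z)) (cell k x) +
        L2_set (\<lambda>z. U / w k * sqrt (v z)) (cell k x)"
      by (rule L2_set_triangle_ineq)
    also have "\<dots> \<le> sqrt (B * U) + sqrt (A * U)"
    proof (intro add_mono)
      have "(\<Sum>z\<in>cell k x. (cmod (S z) * sqrt (v z))\<^sup>2) = (\<Sum>z\<in>cell k x. (cmod (S z))\<^sup>2 * v z)"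
        using v_nonneg in_cellD by (intro sum.cong) (auto simp: power_mult_distrib)
      also have "\<dots> \<le> B * U"
        unfolding S_def U_def using x k by (rule test)
      finally show "L2_set (\<lambda>z. cmod (S z) * sqrt (v z)) (cell k x) \<le> sqrt (B * U)"
        unfolding L2_set_def by (rule real_sqrt_le_mono)
      have "(\<Sum>z\<in>cell k x. (U / w k * sqrt (v z))\<^sup>2) = (\<Sum>z\<in>cell k x. (U / w k)\<^sup>2 * v z)"
        using v_nonneg in_cellD by (intro sum.cong) (auto simp: power_mult_distrib power_divide)
      also have "\<dots> = (U / w k)\<^sup>2 * V"
        by (simp add: V_def sum_distrib_left)
      \<comment> \<open>\<open>U * V / (w k)^2\<close> is a product of averages as in the
        \<open>A\<^sub>2\<close> condition; the remaining factor \<open>U\<close> is the mass wanted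
        on the right.\<close>
      also have "\<dots> = U / (w k)\<^sup>2 * (U * V)"
        by (simp add: power2_eq_square)
      also have "\<dots> \<le> U / (w k)\<^sup>2 * (A * (w k)\<^sup>2)"
        unfolding U_def V_def using x k U0[unfolded U_def] by (intro mult_left_mono A2) auto
      also have "\<dots> = A * U"
        using w_pos[OF k] by simp
      finally show "L2_set (\<lambda>z. U / w k * sqrt (v z)) (cell k x) \<le> sqrt (A * U)"
        unfolding L2_set_def by (rule real_sqrt_le_mono)
    qed
    also have "\<dots> = c * sqrt U"
      by (simp add: c_def real_sqrt_mult algebra_simps)
    finally have "(L2_set (\<lambda>z. cmod (H z) * sqrt (v z)) (cell k x))\<^sup>2 \<le> (c * sqrt U)\<^sup>2"
      by (intro power_mono) auto
    moreover have "(L2_set (\<lambda>z. cmod (H z) * sqrt (v z)) (cell k x))\<^sup>2 =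
        (\<Sum>z\<in>cell k x. (cmod (H z))\<^sup>2 * v z)"
      using v_nonneg in_cellD unfolding L2_set_def
      by (simp add: sum_nonneg power_mult_distrib cong: sum.cong)
    ultimately show ?thesis
      using U0 by (simp add: power_mult_distrib U_def[symmetric])
  qed
  have "(\<Sum>p\<in>{k..N}. form p F G) = (\<Sum>x\<in>X. F x * H x * G x * v x)"
  proof -
    have "(\<Sum>p\<in>{k..N}. form p F G) =
        (\<Sum>x\<in>X. \<Sum>p\<in>{k..N}. \<Sum>y\<in>X. K p x y * (F y * u y) * (G x * v x))"
      unfolding form_def by (rule sum.swap)
    also have "\<dots> = (\<Sum>x\<in>X. \<Sum>p\<in>{k..N}. \<Sum>y\<in>cell k x. F x * (K p x y * u y) * (G x * v x))"
    proof (intro sum.cong[OF refl])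
      fix x p assume x: "x \<in> X" and p: "p \<in> {k..N}"
      show "(\<Sum>y\<in>X. K p x y * (F y * u y) * (G x * v x)) =
          (\<Sum>y\<in>cell k x. F x * (K p x y * u y) * (G x * v x))"
      proof (rule sum.mono_neutral_cong_right)
        show "\<forall>y\<in>X - cell k x. K p x y * (F y * u y) * (G x * v x) = 0"
        proof
          fix y assume y: "y \<in> X - cell k x"
          then have "\<pi> p x \<noteq> \<pi> p y"
            using x p refine_le[of k p x y] by (auto simp: cell_def)
          then show "K p x y * (F y * u y) * (G x * v x) = 0"
            using x y by (simp add: K_supp)
        qed
      next
        fix y assume "y \<in> cell k x"
        then have "F y = F x"
          using x by (intro level_constD[OF F]) (auto simp: cell_def)
        then show "K p x y * (F y * u y) * (G x * v x) = F x * (K p x y * u y) * (G x * v x)"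
          by (simp only: mult_ac)
      qed (use finite_X in_cellD in auto)
    qed
    also have "\<dots> = (\<Sum>x\<in>X. F x * H x * G x * v x)"
      unfolding H_def by (simp only: sum_distrib_left sum_distrib_right mult.assoc)
    finally show ?thesis .
  qed
  also have "cmod \<dots> \<le> (\<Sum>x\<in>X. cmod (F x * H x) * cmod (G x) * v x)"
    using v_nonneg by (intro sum_norm_le) (simp add: norm_mult)
  also have "\<dots> \<le> wnorm v (\<lambda>x. F x * H x) * wnorm v G"
    using v_nonneg by (rule sum_wnorm_le)
  also have "\<dots> \<le> (c * wnorm u F) * wnorm v G"
  proof (intro mult_right_mono)
    have "(wnorm v (\<lambda>x. F x * H x))\<^sup>2 = (\<Sum>x\<in>X. (cmod (F x))\<^sup>2 * ((cmod (H x))\<^sup>2 * v x))"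
      using v_nonneg by (simp add: wnorm_sq norm_mult power_mult_distrib mult.assoc)
    also have "\<dots> \<le> (\<Sum>x\<in>X. (cmod (F x))\<^sup>2 * (c\<^sup>2 * u x))"
      unfolding sum_cells[of _ k]
    proof (rule sum_mono)
      fix q assume "q \<in> \<pi> k ` X"
      then obtain z where z: "z \<in> X" and q: "{x \<in> X. \<pi> k x = q} = cell k z"
        by (auto simp: cell_def)
      have "(\<Sum>x\<in>cell k z. (cmod (F x))\<^sup>2 * h x) = (cmod (F z))\<^sup>2 * (\<Sum>x\<in>cell k z. h x)" for h
        unfolding sum_distrib_left
      proof (rule sum.cong[OF refl])
        fix x assume "x \<in> cell k z"
        then have "F x = F z"
          using z by (intro level_constD[OF F]) (auto simp: cell_def)
        then show "(cmod (F x))\<^sup>2 * h x = (cmod (F z))\<^sup>2 * h x" by simp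
      qed
      then show "(\<Sum>x | x \<in> X \<and> \<pi> k x = q. (cmod (F x))\<^sup>2 * ((cmod (H x))\<^sup>2 * v x))
        \<le> (\<Sum>x | x \<in> X \<and> \<pi> k x = q. (cmod (F x))\<^sup>2 * (c\<^sup>2 * u x))"
        unfolding q using H[OF z] by (simp add: mult_left_mono flip: sum_distrib_left)
    qed
    also have "\<dots> = (c * wnorm u F)\<^sup>2"
      using u_nonneg by (simp add: wnorm_sq power_mult_distrib sum_distrib_left mult_ac)
    finally show "wnorm v (\<lambda>x. F x * H x) \<le> c * wnorm u F"
      using c0 by (auto intro: power2_le_imp_le)
  qed auto
  finally show ?thesis by (simp add: c_def mult.assoc)
qed

text \<open>\<open>K p x\<close> is constant on cells of level \<open>p + r + 1\<close>, which is at
  most \<open>k - 1\<close>, and a difference of level \<open>k\<close> is orthogonal to functions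
  of level \<open>k - 1\<close>.\<close>

lemma form_mdiff_eq_0:
  assumes "p \<le> N" "p + r + 1 < k"
  shows "form p (mdiff u k f) G = 0"
proof -
  obtain j where j: "k = Suc j" "p + r + 1 \<le> j"
    using assms by (cases k) auto
  have "(\<Sum>y\<in>X. mdiff u (Suc j) f y * K p x y * u y) = 0" if x: "x \<in> X" for x
  proof (intro sum_mdiff_Suc u_nonneg)
    have "level_const (p + r + 1) (K p x)"
      unfolding level_const_def using x assms K_right by blast
    then show "level_const j (K p x)"
      using j(2) by (rule level_const_mono)
  qed
  then have "(\<Sum>y\<in>X. K p x y * (mdiff u k f y * u y) * (G x * v x)) = 0" if "x \<in> X" for x
    using that unfolding j sum_distrib_right[symmetric] by (simp add: mult_ac)
  then show ?thesis by (simp add: form_def)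
qed

text \<open>Cauchy--Schwarz on pairs of points of the same cell \<open>Q\<close>, with the factor \<open>v Q\<close> distributed
  so that the second square sum produces the product \<open>u Q * v Q\<close>.\<close>

lemma form_bound:
  assumes p: "p \<le> N"
  shows "cmod (form p F G) \<le> sqrt A * (wnorm u F * wnorm v G)"
proof -
  define U V where "U x = (\<Sum>y\<in>cell p x. u y)" and "V x = (\<Sum>y\<in>cell p x. v y)" for x
  have V0: "V x \<ge> 0" and U0: "U x \<ge> 0" for x
    unfolding U_def V_def by (auto intro!: sum_nonneg u_nonneg v_nonneg dest: in_cellD)
  have Vv: "v x = 0" if "x \<in> X" "V x = 0" for x
    using that eq_0_if_sum_cell_eq_0[of v p x x, OF v_nonneg] self_in_cell by (auto simp: V_def)
  have wp: "w p > 0" using p by (rule w_pos)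
  define T where "T = (SIGMA x:X. cell p x)"
  define a where "a = (\<lambda>(x, y). cmod (F y) * sqrt (u y) * sqrt (v x) / sqrt (V x))"
  define b where "b = (\<lambda>(x, y). cmod (G x) * sqrt (v x) * sqrt (u y) * sqrt (V x) / w p)"
  have "form p F G = (\<Sum>x\<in>X. \<Sum>y\<in>cell p x. K p x y * (F y * u y) * (G x * v x))"
    unfolding form_def
  proof (intro sum.cong[OF refl] sum.mono_neutral_right)
    fix x assume "x \<in> X"
    then show "\<forall>y\<in>X - cell p x. K p x y * (F y * u y) * (G x * v x) = 0"
      by (force simp: cell_def intro: K_supp)
  qed (use finite_X in_cellD in auto)
  also have "\<dots> = (\<Sum>(x, y)\<in>T. K p x y * (F y * u y) * (G x * v x))"
    unfolding T_def using finite_X by (intro sum.Sigma) auto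
  also have "cmod \<dots> \<le> (\<Sum>z\<in>T. \<bar>a z\<bar> * \<bar>b z\<bar>)"
  proof (intro sum_norm_le)
    fix z assume "z \<in> T"
    then obtain x y where z: "z = (x, y)" and x: "x \<in> X" and y: "y \<in> cell p x"
      by (auto simp: T_def)
    have yX: "y \<in> X" using y by (rule in_cellD)
    have "cmod (K p x y * (F y * u y) * (G x * v x)) =
        cmod (K p x y) * (cmod (F y) * u y * (cmod (G x) * v x))"
      using u_nonneg[OF yX] v_nonneg[OF x] by (simp add: norm_mult)
    also have "\<dots> \<le> 1 / w p * (cmod (F y) * u y * (cmod (G x) * v x))"
      using u_nonneg[OF yX] v_nonneg[OF x] x yX p by (intro mult_right_mono K_bound) auto
    also have "\<dots> = a z * b z"
    proof (cases "V x = 0")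
      case True
      then show ?thesis using Vv[OF x] by (simp add: z a_def)
    next
      case False
      have "a z * b z = cmod (F y) * (sqrt (u y) * sqrt (u y)) * (cmod (G x) *
          (sqrt (v x) * sqrt (v x))) * (sqrt (V x) / sqrt (V x)) / w p"
        unfolding z a_def b_def prod.case by (simp only: divide_inverse mult_ac)
      moreover have "sqrt (u y) * sqrt (u y) = u y" "sqrt (v x) * sqrt (v x) = v x"
        using u_nonneg[OF yX] v_nonneg[OF x] by auto
      ultimately have "a z * b z = cmod (F y) * u y * (cmod (G x) * v x) * (sqrt (V x) / sqrt (V x)) / w p"
        by (simp only:)
      then show ?thesis
        using False by simp
    qed
    also have "\<dots> \<le> \<bar>a z\<bar> * \<bar>b z\<bar>"
      by (metis abs_ge_self abs_mult)
    finally show "cmod (case z of (x, y) \<Rightarrow> K p x y * (F y * u y) * (G x * v x)) \<le> \<bar>a z\<bar> * \<bar>b z\<bar>"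
      by (simp add: z)
  qed
  also have "\<dots> \<le> L2_set a T * L2_set b T"
    by (rule L2_set_mult_ineq)
  also have "\<dots> \<le> wnorm u F * (sqrt A * wnorm v G)"
  proof (intro mult_mono)
    have "(\<Sum>z\<in>T. (a z)\<^sup>2) = (\<Sum>x\<in>X. \<Sum>y\<in>cell p x. (cmod (F y))\<^sup>2 * u y * (v x / V x))"
      unfolding T_def using finite_X
      by (subst sum.Sigma) (auto intro!: sum.cong dest!: in_cellD
          simp: a_def power_mult_distrib power_divide u_nonneg v_nonneg V0)
    also have "\<dots> = (\<Sum>x\<in>X. \<Sum>y\<in>X. if \<pi> p y = \<pi> p x then (cmod (F y))\<^sup>2 * u y * (v x / V x) else 0)"
      unfolding cell_def sum.inter_filter[OF finite_X] ..
    \<comment> \<open>After the exchange \<open>v x / V x\<close> is summed over the cell of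
      \<open>y\<close>, which gives 1, or 0 if that cell has no mass for \<open>v\<close>.\<close>
    also have "\<dots> = (\<Sum>y\<in>X. \<Sum>x\<in>X. if \<pi> p y = \<pi> p x then (cmod (F y))\<^sup>2 * u y * (v x / V x) else 0)"
      by (rule sum.swap)
    also have "\<dots> = (\<Sum>y\<in>X. \<Sum>x\<in>cell p y. (cmod (F y))\<^sup>2 * u y * (v x / V x))"
      unfolding cell_def sum.inter_filter[OF finite_X] by (intro sum.cong refl) auto
    also have "\<dots> = (\<Sum>y\<in>X. \<Sum>x\<in>cell p y. (cmod (F y))\<^sup>2 * u y * (v x / V y))"
      by (intro sum.cong refl) (auto simp: V_def dest: cell_eq)
    also have "\<dots> = (\<Sum>y\<in>X. (cmod (F y))\<^sup>2 * u y * (V y / V y))"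
      unfolding sum_distrib_left[symmetric] sum_divide_distrib[symmetric] V_def ..
    also have "\<dots> \<le> (\<Sum>y\<in>X. (cmod (F y))\<^sup>2 * u y)"
      using u_nonneg by (intro sum_mono) auto
    also have "\<dots> = (wnorm u F)\<^sup>2"
      using u_nonneg by (rule wnorm_sq[symmetric])
    finally show "L2_set a T \<le> wnorm u F"
      unfolding L2_set_def by (intro real_le_lsqrt) auto
    have "(\<Sum>z\<in>T. (b z)\<^sup>2) = (\<Sum>x\<in>X. \<Sum>y\<in>cell p x. (cmod (G x))\<^sup>2 * v x * V x / (w p)\<^sup>2 * u y)"
      unfolding T_def using finite_X
      by (subst sum.Sigma) (auto intro!: sum.cong dest!: in_cellD
          simp: b_def power_mult_distrib power_divide u_nonneg v_nonneg V0)
    also have "\<dots> = (\<Sum>x\<in>X. (cmod (G x))\<^sup>2 * v x / (w p)\<^sup>2 * (U x * V x))"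
      unfolding sum_distrib_left[symmetric] U_def by (simp add: mult_ac)
    also have "\<dots> \<le> (\<Sum>x\<in>X. (cmod (G x))\<^sup>2 * v x / (w p)\<^sup>2 * (A * (w p)\<^sup>2))"
      unfolding U_def V_def using v_nonneg p by (intro sum_mono mult_left_mono A2) auto
    also have "\<dots> = A * (wnorm v G)\<^sup>2"
      using wp v_nonneg by (simp add: wnorm_sq sum_distrib_left mult_ac)
    also have "\<dots> = (sqrt A * wnorm v G)\<^sup>2"
      using A_nonneg by (simp add: power_mult_distrib)
    finally show "L2_set b T \<le> sqrt A * wnorm v G"
      unfolding L2_set_def using A_nonneg by (intro real_le_lsqrt) auto
  qed auto
  finally show ?thesis by (simp add: mult_ac)
qed


section \<open>Expansion of the form and summation over the regions\<close>

lemma form_cong: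
  fixes f f' g g' :: "'a \<Rightarrow> complex"
  assumes "\<And>x. x \<in> X \<Longrightarrow> f x * u x = f' x * u x" "\<And>x. x \<in> X \<Longrightarrow> g x * v x = g' x * v x"
  shows "form p f g = form p f' g'"
  unfolding form_def using assms by (intro sum.cong refl) (simp only:)

lemma form_sum_left: "form p (\<lambda>x. \<Sum>i\<in>I. f i x) g = (\<Sum>i\<in>I. form p (f i) g)"
proof -
  have "form p (\<lambda>x. \<Sum>i\<in>I. f i x) g =
      (\<Sum>x\<in>X. \<Sum>y\<in>X. \<Sum>i\<in>I. K p x y * (f i y * u y) * (g x * v x))"
    unfolding form_def by (simp only: sum_distrib_left sum_distrib_right)
  also have "\<dots> = (\<Sum>x\<in>X. \<Sum>i\<in>I. \<Sum>y\<in>X. K p x y * (f i y * u y) * (g x * v x))"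
    by (intro sum.cong[OF refl] sum.swap)
  also have "\<dots> = (\<Sum>i\<in>I. form p (f i) g)"
    unfolding form_def by (rule sum.swap)
  finally show ?thesis .
qed

text \<open>For \<open>l = j + r + 1\<close> the admissible \<open>k\<close> are exactly
  \<open>k \<le> j\<close>, and their differences telescope to \<open>avg u j f\<close>. No
  restriction on \<open>p\<close> is imposed, so the full kernel appears, as the paraproduct
  needs.\<close>

lemma far_below_bound:
  "cmod (\<Sum>k\<le>N. \<Sum>l\<le>N. \<Sum>p\<le>N. if k + r < l then form p (mdiff u k f) (mdiff v l g) else 0)
    \<le> 2 * sqrt B * (wnorm u f * wnorm v g)"
proof (cases "N < r")
  case True
  then have "(\<Sum>k\<le>N. \<Sum>l\<le>N. \<Sum>p\<le>N. if k + r < l then form p (mdiff u k f) (mdiff v l g) else 0) = 0"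
    by (intro sum.neutral ballI) auto
  then show ?thesis using B_nonneg by simp
next
  case False
  have "(\<Sum>k\<le>N. \<Sum>l\<le>N. \<Sum>p\<le>N. if k + r < l then form p (mdiff u k f) (mdiff v l g) else 0) =
      (\<Sum>l\<le>N. \<Sum>k\<le>N. \<Sum>p\<le>N. if k + r < l then form p (mdiff u k f) (mdiff v l g) else 0)"
    by (rule sum.swap)
  also have "\<dots> = (\<Sum>l\<in>(\<lambda>k. k + r + 1) ` {..<N - r}. \<Sum>k\<le>N. \<Sum>p\<le>N.
      if k + r < l then form p (mdiff u k f) (mdiff v l g) else 0)"
  proof (rule sum.mono_neutral_right)
    show "\<forall>l\<in>{..N} - (\<lambda>k. k + r + 1) ` {..<N - r}. (\<Sum>k\<le>N. \<Sum>p\<le>N.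
      if k + r < l then form p (mdiff u k f) (mdiff v l g) else 0) = 0"
    proof (intro ballI sum.neutral)
      fix l k p assume l: "l \<in> {..N} - (\<lambda>k. k + r + 1) ` {..<N - r}"
      have "\<not> k + r < l"
      proof
        assume "k + r < l"
        then have "l = (l - r - 1) + r + 1" "l - r - 1 < N - r" using l by auto
        with l show False by blast
      qed
      then show "(if k + r < l then form p (mdiff u k f) (mdiff v l g) else 0) = 0" by simp
    qed
  qed auto
  also have "\<dots> = (\<Sum>j<N - r. \<Sum>k\<le>N. \<Sum>p\<le>N.
      if k + r < j + r + 1 then form p (mdiff u k f) (mdiff v (j + r + 1) g) else 0)"
  proof (subst sum.reindex)
    show "inj_on (\<lambda>k. k + r + 1) {..<N - r}" by (simp add: inj_on_def)
  qed (simp only: o_def)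
  also have "\<dots> = (\<Sum>j<N - r. \<Sum>p\<le>N. form p (avg u j f) (mdiff v (j + r + 1) g))"
  proof (rule sum.cong[OF refl])
    fix j assume j: "j \<in> {..<N - r}"
    have "(\<Sum>k\<le>N. \<Sum>p\<le>N. if k + r < j + r + 1 then form p (mdiff u k f) (mdiff v (j + r + 1) g) else 0)
      = (\<Sum>k\<le>j. \<Sum>p\<le>N. form p (mdiff u k f) (mdiff v (j + r + 1) g))"
      using j by (intro sum.mono_neutral_cong_right) auto
    also have "\<dots> = (\<Sum>p\<le>N. \<Sum>k\<le>j. form p (mdiff u k f) (mdiff v (j + r + 1) g))"
      by (rule sum.swap)
    also have "\<dots> = (\<Sum>p\<le>N. form p (avg u j f) (mdiff v (j + r + 1) g))"
      unfolding form_sum_left[symmetric] sum_mdiff ..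
    finally show "(\<Sum>k\<le>N. \<Sum>p\<le>N. if k + r < j + r + 1 then form p (mdiff u k f) (mdiff v (j + r + 1) g) else 0)
      = (\<Sum>p\<le>N. form p (avg u j f) (mdiff v (j + r + 1) g))" .
  qed
  finally show ?thesis
    using paraproduct_bound[of "N - r" f g] False by simp
qed

text \<open>If no level occurs more than \<open>R\<close> times, Cauchy--Schwarz loses only
  \<open>R\<close>, and Bessel's inequality handles both families of differences.\<close>

lemma sum_mdiff_norms_le:
  assumes "finite T" "\<And>t. t \<in> T \<Longrightarrow> \<kappa> t \<le> N \<and> \<tau> t \<le> N"
    and "\<And>k. k \<le> N \<Longrightarrow> card {t \<in> T. \<kappa> t = k} \<le> R" "\<And>k. k \<le> N \<Longrightarrow> card {t \<in> T. \<tau> t = k} \<le> R"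
  shows "(\<Sum>t\<in>T. wnorm u (mdiff u (\<kappa> t) f) * wnorm v (mdiff v (\<tau> t) g))
    \<le> real R * (wnorm u f * wnorm v g)"
proof -
  have "(\<Sum>t\<in>T. wnorm u (mdiff u (\<kappa> t) f) * wnorm v (mdiff v (\<tau> t) g)) =
      (\<Sum>t\<in>T. \<bar>wnorm u (mdiff u (\<kappa> t) f)\<bar> * \<bar>wnorm v (mdiff v (\<tau> t) g)\<bar>)"
    by simp
  also have "\<dots> \<le> real R * (L2_set (\<lambda>k. wnorm u (mdiff u k f)) {..N} *
      L2_set (\<lambda>k. wnorm v (mdiff v k g)) {..N})"
    using assms by (intro sum_mult_le_card) auto
  also have "\<dots> \<le> real R * (wnorm u f * wnorm v g)"
    using u_nonneg v_nonneg by (intro mult_left_mono mult_mono L2_set_wnorm_mdiff) auto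
  finally show ?thesis .
qed

text \<open>\<open>P\<close> is left open so that the diagonal \<open>k = l\<close> is counted once:
  it is included here and excluded in the transposed use. Each level has at most
  \<open>r + 1\<close> partners, one for each value of \<open>l - k\<close>.\<close>

lemma near_above_bound:
  assumes P: "\<And>k l. P k l \<Longrightarrow> k \<le> l \<and> l \<le> k + r"
  shows "cmod (\<Sum>k\<le>N. \<Sum>l\<le>N. \<Sum>p\<le>N.
      if P k l \<and> k \<le> p then form p (mdiff u k f) (mdiff v l g) else 0)
    \<le> real (r + 1) * (sqrt A + sqrt B) * (wnorm u f * wnorm v g)"
proof -
  define T where "T = {(k, l). k \<le> N \<and> l \<le> N \<and> P k l}"
  have finT: "finite T"
    by (rule finite_subset[of _ "{..N} \<times> {..N}"]) (auto simp: T_def)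
  have "cmod (\<Sum>k\<le>N. \<Sum>l\<le>N. \<Sum>p\<le>N.
      if P k l \<and> k \<le> p then form p (mdiff u k f) (mdiff v l g) else 0) =
      cmod (\<Sum>(k, l)\<in>{..N} \<times> {..N}. \<Sum>p\<le>N.
      if P k l \<and> k \<le> p then form p (mdiff u k f) (mdiff v l g) else 0)"
    by (subst sum.cartesian_product) (rule refl)
  also have "(\<Sum>(k, l)\<in>{..N} \<times> {..N}. \<Sum>p\<le>N.
      if P k l \<and> k \<le> p then form p (mdiff u k f) (mdiff v l g) else 0) =
      (\<Sum>t\<in>T. \<Sum>p\<in>{fst t..N}. form p (mdiff u (fst t) f) (mdiff v (snd t) g))"
  proof (rule sum.mono_neutral_cong_right)
    fix t assume "t \<in> T"
    then obtain k l where t: "t = (k, l)" "P k l" by (auto simp: T_def)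
    have "(\<Sum>p\<le>N. if P k l \<and> k \<le> p then form p (mdiff u k f) (mdiff v l g) else 0) =
        (\<Sum>p\<in>{k..N}. form p (mdiff u k f) (mdiff v l g))"
      using t by (intro sum.mono_neutral_cong_right) auto
    then show "(case t of (k, l) \<Rightarrow> \<Sum>p\<le>N. if P k l \<and> k \<le> p then form p (mdiff u k f) (mdiff v l g) else 0)
      = (\<Sum>p\<in>{fst t..N}. form p (mdiff u (fst t) f) (mdiff v (snd t) g))"
      by (simp add: t)
  next
    show "\<forall>t\<in>{..N} \<times> {..N} - T. (case t of (k, l) \<Rightarrow> \<Sum>p\<le>N.
        if P k l \<and> k \<le> p then form p (mdiff u k f) (mdiff v l g) else 0) = 0"
    proof
      fix t assume "t \<in> {..N} \<times> {..N} - T"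
      then obtain k l where "t = (k, l)" "\<not> P k l" by (auto simp: T_def)
      then show "(case t of (k, l) \<Rightarrow> \<Sum>p\<le>N.
        if P k l \<and> k \<le> p then form p (mdiff u k f) (mdiff v l g) else 0) = 0" by simp
    qed
  qed (auto simp: T_def)
  also have "cmod \<dots> \<le> (\<Sum>t\<in>T. (sqrt A + sqrt B) *
      (wnorm u (mdiff u (fst t) f) * wnorm v (mdiff v (snd t) g)))"
    by (intro sum_norm_le near_bound level_const_mdiff) (auto simp: T_def)
  also have "\<dots> = (sqrt A + sqrt B) *
      (\<Sum>t\<in>T. wnorm u (mdiff u (fst t) f) * wnorm v (mdiff v (snd t) g))"
    by (simp only: sum_distrib_left)
  also have "\<dots> \<le> (sqrt A + sqrt B) * (real (r + 1) * (wnorm u f * wnorm v g))"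
  proof (intro mult_left_mono sum_mdiff_norms_le finT)
    fix k
    have "{t \<in> T. fst t = k} \<subseteq> (\<lambda>i. (k, k + i)) ` {..r}"
    proof
      fix t assume t: "t \<in> {t \<in> T. fst t = k}"
      then have "t = (k, k + (snd t - k))" "snd t - k \<le> r"
        using P[of k "snd t"] by (auto simp: T_def prod_eq_iff)
      then show "t \<in> (\<lambda>i. (k, k + i)) ` {..r}" by blast
    qed
    then show "card {t \<in> T. fst t = k} \<le> r + 1"
      using surj_card_le[of "{..r}"] by fastforce
    have "{t \<in> T. snd t = k} \<subseteq> (\<lambda>i. (k - i, k)) ` {..r}"
    proof
      fix t assume t: "t \<in> {t \<in> T. snd t = k}"
      then have "t = (k - (k - fst t), k)" "k - fst t \<le> r"
        using P[of "fst t" k] by (auto simp: T_def prod_eq_iff)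
      then show "t \<in> (\<lambda>i. (k - i, k)) ` {..r}" by blast
    qed
    then show "card {t \<in> T. snd t = k} \<le> r + 1"
      using surj_card_le[of "{..r}"] by fastforce
  qed (use A_nonneg B_nonneg in \<open>auto simp: T_def\<close>)
  finally show ?thesis by (simp only: mult_ac)
qed

text \<open>For given \<open>k\<close>, or given \<open>l\<close>, a triple is determined by the
  offsets \<open>k - p - 1\<close> and \<open>l - p - 1\<close> in \<open>{..r}\<close>. So a level
  occurs in at most \<open>(r + 1)^2\<close> triples, each of which costs
  \<open>sqrt A\<close>.\<close>

lemma coarse_bound:
  "cmod (\<Sum>k\<le>N. \<Sum>l\<le>N. \<Sum>p\<le>N. if p < k \<and> k \<le> p + r + 1 \<and> p < l \<and> l \<le> p + r + 1
      then form p (mdiff u k f) (mdiff v l g) else 0)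
    \<le> (real (r + 1))\<^sup>2 * sqrt A * (wnorm u f * wnorm v g)"
proof -
  define T where "T = {(k, l, p). k \<le> N \<and> l \<le> N \<and> p \<le> N \<and> p < k \<and> k \<le> p + r + 1 \<and> p < l \<and> l \<le> p + r + 1}"
  have finT: "finite T"
    by (rule finite_subset[of _ "{..N} \<times> {..N} \<times> {..N}"]) (auto simp: T_def)
  have "cmod (\<Sum>k\<le>N. \<Sum>l\<le>N. \<Sum>p\<le>N. if p < k \<and> k \<le> p + r + 1 \<and> p < l \<and> l \<le> p + r + 1
      then form p (mdiff u k f) (mdiff v l g) else 0) =
      cmod (\<Sum>(k, l, p)\<in>{..N} \<times> {..N} \<times> {..N}. if p < k \<and> k \<le> p + r + 1 \<and> p < l \<and> l \<le> p + r + 1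
      then form p (mdiff u k f) (mdiff v l g) else 0)"
    by (simp only: sum.cartesian_product)
  also have "(\<Sum>(k, l, p)\<in>{..N} \<times> {..N} \<times> {..N}. if p < k \<and> k \<le> p + r + 1 \<and> p < l \<and> l \<le> p + r + 1
      then form p (mdiff u k f) (mdiff v l g) else 0) =
      (\<Sum>(k, l, p)\<in>T. form p (mdiff u k f) (mdiff v l g))"
    by (rule sum.mono_neutral_cong_right) (auto simp: T_def split: if_splits)
  also have "cmod \<dots> \<le> (\<Sum>(k, l, p)\<in>T. sqrt A * (wnorm u (mdiff u k f) * wnorm v (mdiff v l g)))"
  proof (rule sum_norm_le)
    fix t assume "t \<in> T"
    then show "cmod (case t of (k, l, p) \<Rightarrow> form p (mdiff u k f) (mdiff v l g)) \<le>
        (case t of (k, l, p) \<Rightarrow> sqrt A * (wnorm u (mdiff u k f) * wnorm v (mdiff v l g)))"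
      by (cases t) (auto simp: T_def intro: form_bound)
  qed
  also have "\<dots> = sqrt A *
      (\<Sum>t\<in>T. wnorm u (mdiff u (fst t) f) * wnorm v (mdiff v (fst (snd t)) g))"
    by (simp only: sum_distrib_left case_prod_unfold)
  also have "\<dots> \<le> sqrt A * (real ((r + 1) * (r + 1)) * (wnorm u f * wnorm v g))"
  proof (intro mult_left_mono sum_mdiff_norms_le finT)
    have card: "card S \<le> (r + 1) * (r + 1)"
      if "inj_on h S" "h ` S \<subseteq> {..r} \<times> {..r}" for S and h :: "nat \<times> nat \<times> nat \<Rightarrow> nat \<times> nat"
      using card_inj_on_le[OF that] by (simp add: card_cartesian_product)
    fix k
    show "card {t \<in> T. fst t = k} \<le> (r + 1) * (r + 1)"
      by (rule card[of "\<lambda>(k, l, p). (k - p - 1, l - p - 1)"]) (auto simp: inj_on_def T_def)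
    show "card {t \<in> T. fst (snd t) = k} \<le> (r + 1) * (r + 1)"
      by (rule card[of "\<lambda>(k, l, p). (k - p - 1, l - p - 1)"]) (auto simp: inj_on_def T_def)
  qed (use A_nonneg in \<open>auto simp: T_def\<close>)
  finally show ?thesis by (simp only: power2_eq_square of_nat_mult mult_ac)
qed

lemma form_total_bound:
  "cmod (\<Sum>p\<le>N. form p f g) \<le>
    (4 * sqrt B + 2 * real (r + 1) * (sqrt A + sqrt B) + (real (r + 1))\<^sup>2 * sqrt A)
      * (wnorm u f * wnorm v g)"
proof -
  interpret swap: shift_model X \<pi> N r "\<lambda>p x y. K p y x" w v u A B
    by (rule shift_model_swap)
  have swap_form: "swap.form p g f = form p f g" for p f g
    unfolding swap.form_def form_def by (subst sum.swap) (simp only: mult_ac)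
  define t where "t k l p = form p (mdiff u k f) (mdiff v l g)" for k l p
  define t1 where "t1 k l p = (if k + r < l then t k l p else 0)" for k l p
  define t2 where "t2 k l p = (if l + r < k then t k l p else 0)" for k l p
  define t3 where "t3 k l p = (if (k \<le> l \<and> l \<le> k + r) \<and> k \<le> p then t k l p else 0)" for k l p
  define t4 where "t4 k l p = (if (l < k \<and> k \<le> l + r) \<and> l \<le> p then t k l p else 0)" for k l p
  define t5 where "t5 k l p = (if p < k \<and> k \<le> p + r + 1 \<and> p < l \<and> l \<le> p + r + 1
    then t k l p else 0)" for k l p
  have expand: "(\<Sum>p\<le>N. form p f g) = (\<Sum>k\<le>N. \<Sum>l\<le>N. \<Sum>p\<le>N. t k l p)"
  proof -
    \<comment> \<open>The expansion may fail at leaves of weight 0, but \<open>form\<close> sees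
      only products with the weights.\<close>
    have f: "f x * u x = (\<Sum>k\<le>N. mdiff u k f x) * u x" if "x \<in> X" for x
      unfolding sum_mdiff using avg_inj[OF inj that] by (simp only:)
    have g: "g x * v x = (\<Sum>k\<le>N. mdiff v k g x) * v x" if "x \<in> X" for x
      unfolding sum_mdiff using avg_inj[OF inj that] by (simp only:)
    have "(\<Sum>p\<le>N. form p f g) =
        (\<Sum>p\<le>N. form p (\<lambda>x. \<Sum>k\<le>N. mdiff u k f x) (\<lambda>x. \<Sum>l\<le>N. mdiff v l g x))"
      by (intro sum.cong[OF refl] form_cong f g)
    also have "\<dots> = (\<Sum>p\<le>N. \<Sum>k\<le>N. \<Sum>l\<le>N. t k l p)"
      unfolding form_sum_left swap_form[symmetric] swap.form_sum_left t_def ..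
    also have "\<dots> = (\<Sum>k\<le>N. \<Sum>p\<le>N. \<Sum>l\<le>N. t k l p)"
      by (rule sum.swap)
    also have "\<dots> = (\<Sum>k\<le>N. \<Sum>l\<le>N. \<Sum>p\<le>N. t k l p)"
      by (intro sum.cong[OF refl] sum.swap)
    finally show ?thesis .
  qed
  \<comment> \<open>The regions are disjoint, and a triple outside all of them has
    \<open>p + r + 1 < k\<close> or \<open>p + r + 1 < l\<close>, where the term vanishes. In
    \<open>t5\<close> both levels lie in a window of \<open>r + 1\<close> values, so they differ by
    at most \<open>r\<close> and the region does not meet \<open>t1\<close> or
    \<open>t2\<close>.\<close>
  have split: "t k l p = t1 k l p + t2 k l p + t3 k l p + t4 k l p + t5 k l p" if "p \<le> N" for k l p
  proof -
    have "t k l p = 0" if "p + r + 1 < k \<or> p + r + 1 < l"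
      using that form_mdiff_eq_0[OF \<open>p \<le> N\<close>, of k f "mdiff v l g"]
        swap.form_mdiff_eq_0[OF \<open>p \<le> N\<close>, of l g "mdiff u k f"]
      by (auto simp: t_def swap_form)
    then show ?thesis
      unfolding t1_def t2_def t3_def t4_def t5_def by auto
  qed
  have "(\<Sum>p\<le>N. form p f g) = (\<Sum>k\<le>N. \<Sum>l\<le>N. \<Sum>p\<le>N. t1 k l p)
      + (\<Sum>k\<le>N. \<Sum>l\<le>N. \<Sum>p\<le>N. t2 k l p) + (\<Sum>k\<le>N. \<Sum>l\<le>N. \<Sum>p\<le>N. t3 k l p)
      + (\<Sum>k\<le>N. \<Sum>l\<le>N. \<Sum>p\<le>N. t4 k l p) + (\<Sum>k\<le>N. \<Sum>l\<le>N. \<Sum>p\<le>N. t5 k l p)"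
    unfolding expand sum.distrib[symmetric] by (intro sum.cong[OF refl] split) simp
  moreover have "cmod (\<Sum>k\<le>N. \<Sum>l\<le>N. \<Sum>p\<le>N. t1 k l p) \<le> 2 * sqrt B * (wnorm u f * wnorm v g)"
    unfolding t1_def t_def by (rule far_below_bound)
  moreover have "cmod (\<Sum>k\<le>N. \<Sum>l\<le>N. \<Sum>p\<le>N. t2 k l p) \<le> 2 * sqrt B * (wnorm u f * wnorm v g)"
    using swap.far_below_bound[of g f] unfolding t2_def t_def swap_form
    by (subst sum.swap) (simp add: mult_ac)
  moreover have "cmod (\<Sum>k\<le>N. \<Sum>l\<le>N. \<Sum>p\<le>N. t3 k l p) \<le>
      real (r + 1) * (sqrt A + sqrt B) * (wnorm u f * wnorm v g)"
    unfolding t3_def t_def by (rule near_above_bound)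
  moreover have "cmod (\<Sum>k\<le>N. \<Sum>l\<le>N. \<Sum>p\<le>N. t4 k l p) \<le>
      real (r + 1) * (sqrt A + sqrt B) * (wnorm u f * wnorm v g)"
    using swap.near_above_bound[of "\<lambda>l k. l < k \<and> k \<le> l + r" g f] unfolding t4_def t_def swap_form
    by (subst sum.swap) (simp add: mult_ac)
  moreover have "cmod (\<Sum>k\<le>N. \<Sum>l\<le>N. \<Sum>p\<le>N. t5 k l p) \<le>
      (real (r + 1))\<^sup>2 * sqrt A * (wnorm u f * wnorm v g)"
    unfolding t5_def t_def by (rule coarse_bound)
  moreover have "(4 * sqrt B + 2 * real (r + 1) * (sqrt A + sqrt B) + (real (r + 1))\<^sup>2 * sqrt A)
      * (wnorm u f * wnorm v g) = 2 * sqrt B * (wnorm u f * wnorm v g)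
      + 2 * sqrt B * (wnorm u f * wnorm v g)
      + real (r + 1) * (sqrt A + sqrt B) * (wnorm u f * wnorm v g)
      + real (r + 1) * (sqrt A + sqrt B) * (wnorm u f * wnorm v g)
      + (real (r + 1))\<^sup>2 * sqrt A * (wnorm u f * wnorm v g)"
    by (simp only: distrib_right mult_2)
  ultimately show ?thesis
    by (smt (verit) norm_triangle_ineq)
qed

text \<open>Duality with \<open>g\<close> the conjugate of \<open>op f\<close>: the form becomes the
  squared norm of \<open>op f\<close>, and one factor cancels.\<close>

lemma op_bound:
  "wnorm v (op f) \<le>
    (4 * sqrt B + 2 * real (r + 1) * (sqrt A + sqrt B) + (real (r + 1))\<^sup>2 * sqrt A) * wnorm u f"
  (is "_ \<le> ?C * _")
proof -
  define g where "g x = cnj (op f x)" for x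
  have "(\<Sum>p\<le>N. form p f g) = (\<Sum>x\<in>X. op f x * g x * v x)"
    by (rule sum_form)
  also have "\<dots> = of_real (\<Sum>x\<in>X. (cmod (op f x))\<^sup>2 * v x)"
    by (simp only: g_def complex_norm_square of_real_sum of_real_mult)
  also have "(\<Sum>x\<in>X. (cmod (op f x))\<^sup>2 * v x) = (wnorm v (op f))\<^sup>2"
    using v_nonneg by (rule wnorm_sq[symmetric])
  finally have "cmod (\<Sum>p\<le>N. form p f g) = (wnorm v (op f))\<^sup>2"
    by (simp add: norm_power)
  moreover have "wnorm v g = wnorm v (op f)"
    by (simp add: wnorm_def g_def)
  ultimately have "wnorm v (op f) * wnorm v (op f) \<le> (?C * wnorm u f) * wnorm v (op f)"
    using form_total_bound[of f g] by (simp add: power2_eq_square mult_ac)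
  moreover have "?C * wnorm u f \<ge> 0"
    using A_nonneg B_nonneg by (intro mult_nonneg_nonneg add_nonneg_nonneg) auto
  ultimately show ?thesis
    using mult_right_le_imp_le[of "wnorm v (op f)" "wnorm v (op f)" "?C * wnorm u f"]
      wnorm_nonneg[of v "op f"] by (cases "wnorm v (op f) = 0") auto
qed

end

subsection \<open>Dyadic lattices\<close>

lemma two_powi_inject: "(2::real) powi k = 2 powi l \<Longrightarrow> k = l"
  using power_int_strict_increasing[of k l "2::real"] power_int_strict_increasing[of l k "2::real"]
  by (cases k l rule: linorder_cases) auto

lemma cube_nonempty: "l > 0 \<Longrightarrow> cube d a l \<noteq> {}"
  by (auto simp: cube_def PiE_eq_empty_iff)

lemma side_length_cube:
  assumes d: "d \<ge> 1" and l: "l > 0"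
  shows "side_length d (cube d a l) = l"
proof -
  have "l' = l" if "l' > 0" "cube d a l = cube d a' l'" for l' a'
  proof -
    have "{a 0..<a 0 + l} = {a' 0..<a' 0 + l'}"
      using that l d unfolding cube_def by (subst (asm) PiE_eq_iff_not_empty) auto
    then show ?thesis using l that by (auto simp: atLeastLessThan_eq_iff)
  qed
  with l show ?thesis
    unfolding side_length_def by (intro the_equality) auto
qed

lemma cube_in_cubes: "l > 0 \<Longrightarrow> cube d a l \<in> cubes d"
  by (auto simp: cubes_def)

lemma space_lebesgue_Rd: "space (lebesgue_Rd d) = Rd d"
  by (simp add: lebesgue_Rd_def space_PiM Rd_def)

lemma PiE_in_sets:
  assumes "\<And>i. i < d \<Longrightarrow> S i \<in> sets borel"
  shows "(\<Pi>\<^sub>E i\<in>{..<d}. S i) \<in> sets (lebesgue_Rd d)"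
  unfolding lebesgue_Rd_def using assms by (intro sets_PiM_I_finite) auto

lemma cube_in_sets: "cube d a l \<in> sets (lebesgue_Rd d)"
  unfolding cube_def by (intro PiE_in_sets) auto

lemma volume_cube:
  assumes "l \<ge> 0"
  shows "volume d (cube d a l) = l ^ d"
proof -
  interpret product_sigma_finite "\<lambda>_::nat. lborel :: real measure" ..
  have "emeasure (lebesgue_Rd d) (cube d a l) = (\<Prod>i<d. emeasure lborel {a i..<a i + l})"
    unfolding lebesgue_Rd_def cube_def by (subst emeasure_PiM) auto
  also have "\<dots> = ennreal l ^ d"
    using assms by simp
  finally show ?thesis
    unfolding volume_def measure_def using assms by (simp add: ennreal_power)
qed

lemma radon_measure_cube_finite:
  assumes "radon_measure d \<mu>"
  shows "emeasure \<mu> (cube d a l) < \<infinity>"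
proof -
  let ?K = "\<Pi>\<^sub>E i\<in>{..<d}. {a i..a i + l}"
  \<comment> \<open>Coordinates from \<open>d\<close> on are pinned to the single value
    \<open>undefined\<close>, so the box is a product of compact sets over all indices and
    Tychonoff's theorem applies.\<close>
  have eq: "?K = (\<Pi>\<^sub>E i\<in>UNIV. if i < d then {a i..a i + l} else {undefined})"
    by (auto simp: PiE_def Pi_def extensional_def split: if_splits)
  have "compactin (product_topology (\<lambda>i. euclidean) UNIV) ?K"
    unfolding eq by (subst compactin_PiE) auto
  then have "compact ?K"
    by (simp add: euclidean_product_topology)
  moreover have "?K \<subseteq> Rd d"
    by (auto simp: Rd_def PiE_def)
  ultimately have "emeasure \<mu> ?K < \<infinity>"
    using assms by (simp add: radon_measure_def)
  moreover have "?K \<in> sets \<mu>"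
    using assms by (auto simp: radon_measure_def intro: PiE_in_sets)
  moreover have "cube d a l \<subseteq> ?K"
    unfolding cube_def by (intro PiE_mono) auto
  ultimately show ?thesis
    using emeasure_mono by (metis le_less_trans)
qed

locale dyadic_grid =
  fixes d :: nat and \<omega> :: "int \<Rightarrow> nat \<Rightarrow> real"
  assumes d: "d \<ge> 1" and \<omega>: "i < d \<Longrightarrow> \<omega> j i \<in> {0, 1}"
begin

text \<open>Integer coordinates of the lattice cube of side \<open>2 powi k\<close> around
  \<open>x\<close>. Nesting and finiteness of cubes become statements about floors.\<close>

definition index :: "int \<Rightarrow> (nat \<Rightarrow> real) \<Rightarrow> nat \<Rightarrow> int" where
  "index k x = (\<lambda>i\<in>{..<d}. \<lfloor>(x i - lattice_offset \<omega> k i) / 2 powi k\<rfloor>)"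

definition dcell :: "int \<Rightarrow> (nat \<Rightarrow> real) \<Rightarrow> (nat \<Rightarrow> real) set" where
  "dcell k x = {y \<in> Rd d. index k y = index k x}"

definition lattice :: "(nat \<Rightarrow> real) set set" where
  "lattice = (\<Union>k. translate d (lattice_offset \<omega> k) ` standard_dyadic d k)"

text \<open>Splitting off the term \<open>k\<close> from \<open>infsum\<close> requires summability,
  obtained by comparison with a geometric series.\<close>

lemma lattice_offset_Suc:
  assumes i: "i < d"
  shows "lattice_offset \<omega> (k + 1) i = lattice_offset \<omega> k i + \<omega> k i * 2 powi k"
proof -
  have bounds: "0 \<le> \<omega> j i" "\<omega> j i \<le> 1" for j
    using \<omega>[OF i, of j] by auto
  have "(\<lambda>n. 2 powi (k - 1) * (1 / 2) ^ n :: real) summable_on UNIV"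
    by (intro norm_summable_imp_summable_on) (auto simp: norm_mult norm_power intro!: summable_mult summable_geometric)
  moreover have "bij_betw (\<lambda>n. k - 1 - int n) UNIV {..<k}"
    by (rule bij_betwI[of _ _ _ "\<lambda>j. nat (k - 1 - j)"]) auto
  moreover have "(2::real) powi (k - 1 - int n) = 2 powi (k - 1) * (1 / 2) ^ n" for n
    by (simp add: power_int_diff power_divide)
  ultimately have "(\<lambda>j. 2 powi j :: real) summable_on {..<k}"
    by (simp flip: summable_on_reindex_bij_betw)
  then have "(\<lambda>j. \<omega> j i * 2 powi j) summable_on {..<k}"
    by (rule summable_on_comparison_test) (auto simp: bounds mult_left_le_one_le)
  then have "infsum (\<lambda>j. \<omega> j i * 2 powi j) (insert k {..<k}) =
      \<omega> k i * 2 powi k + infsum (\<lambda>j. \<omega> j i * 2 powi j) {..<k}"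
    by (rule infsum_insert) simp
  moreover have "insert k {..<k} = {..<k + 1}" by auto
  ultimately show ?thesis by (simp add: lattice_offset_def)
qed

text \<open>Passing to the parent is integer division by 2 after subtracting the digit
  \<open>\<omega> k i\<close>, itself an integer. The nesting of the lattice rests on this.\<close>

lemma index_coarsen:
  assumes i: "i < d"
  shows "index (k + 1) x i = (index k x i - \<lfloor>\<omega> k i\<rfloor>) div 2"
proof -
  have "\<omega> k i = of_int \<lfloor>\<omega> k i\<rfloor>"
    using \<omega>[OF i, of k] by auto
  then have "(x i - lattice_offset \<omega> (k + 1) i) / 2 powi (k + 1) =
      ((x i - lattice_offset \<omega> k i) / 2 powi k - of_int \<lfloor>\<omega> k i\<rfloor>) / of_int 2"
    unfolding lattice_offset_Suc[OF i] by (simp add: power_int_add field_simps)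
  then have "\<lfloor>(x i - lattice_offset \<omega> (k + 1) i) / 2 powi (k + 1)\<rfloor> =
      \<lfloor>(x i - lattice_offset \<omega> k i) / 2 powi k - of_int \<lfloor>\<omega> k i\<rfloor>\<rfloor> div 2"
    by (metis floor_divide_real_eq_div zero_le_numeral)
  then show ?thesis
    using i by (simp add: index_def)
qed

lemma index_coarsen_eq:
  assumes "k \<le> l" "index k x = index k y"
  shows "index l x = index l y"
  using assms
proof (induction l rule: int_ge_induct)
  case (step l)
  then have "index (l + 1) x i = index (l + 1) y i" if "i < d" for i
    using that by (simp add: index_coarsen)
  then show ?case
    by (auto simp: index_def fun_eq_iff restrict_def)
qed

lemma dcell_subset: "dcell k x \<subseteq> Rd d"
  by (auto simp: dcell_def)

lemma self_in_dcell: "x \<in> Rd d \<Longrightarrow> x \<in> dcell k x"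
  by (simp add: dcell_def)

lemma dcell_eq_iff: "x \<in> Rd d \<Longrightarrow> dcell k x = dcell k y \<longleftrightarrow> x \<in> dcell k y"
  by (auto simp: dcell_def)

lemma dcell_eq: "y \<in> dcell k x \<Longrightarrow> dcell k y = dcell k x"
  by (auto simp: dcell_def)

lemma dcell_coarsen:
  assumes "k \<le> l" "x \<in> Rd d" "dcell k x = dcell k y"
  shows "dcell l x = dcell l y"
proof -
  have "index k x = index k y"
    using assms self_in_dcell[of x k] by (auto simp: dcell_def)
  with assms(1) have "index l x = index l y"
    by (rule index_coarsen_eq)
  then show ?thesis by (simp add: dcell_def)
qed

lemma dcell_mono: "k \<le> l \<Longrightarrow> dcell k x \<subseteq> dcell l x"
  unfolding dcell_def using index_coarsen_eq[of k l _ x] by blast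

lemma index_eq_iff:
  assumes "i < d"
  shows "index k x i = m \<longleftrightarrow>
    x i \<in> {lattice_offset \<omega> k i + 2 powi k * of_int m ..< lattice_offset \<omega> k i + 2 powi k * of_int m + 2 powi k}"
proof -
  have "(0::real) < 2 powi k" by simp
  then show ?thesis
    using assms by (auto simp: index_def floor_eq_iff field_simps)
qed

lemma dcell_eq_cube:
  "dcell k x = cube d (\<lambda>i. lattice_offset \<omega> k i + 2 powi k * of_int (index k x i)) (2 powi k)"
proof -
  let ?a = "\<lambda>i. lattice_offset \<omega> k i + 2 powi k * of_int (index k x i)"
  have "y \<in> dcell k x \<longleftrightarrow> y \<in> cube d ?a (2 powi k)" for y
  proof -
    have "index k y = index k x \<longleftrightarrow> (\<forall>i<d. index k y i = index k x i)"
      by (auto simp: index_def fun_eq_iff restrict_def)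
    also have "\<dots> \<longleftrightarrow> (\<forall>i<d. y i \<in> {?a i ..< ?a i + 2 powi k})"
      by (intro all_cong index_eq_iff)
    finally show ?thesis
      unfolding dcell_def cube_def Rd_def by (simp add: PiE_iff)
        (blast intro: conj_commute)
  qed
  then show ?thesis by blast
qed

lemma translate_cube: "translate d v (cube d a l) = cube d (\<lambda>i. v i + a i) l"
proof
  show "translate d v (cube d a l) \<subseteq> cube d (\<lambda>i. v i + a i) l"
  proof
    fix y assume "y \<in> translate d v (cube d a l)"
    then obtain x where "x \<in> cube d a l" "y = (\<lambda>i\<in>{..<d}. x i + v i)"
      by (auto simp: translate_def)
    then show "y \<in> cube d (\<lambda>i. v i + a i) l"
      by (simp add: cube_def PiE_iff add.commute add.left_commute)
  qed
  show "cube d (\<lambda>i. v i + a i) l \<subseteq> translate d v (cube d a l)"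
  proof
    fix y assume y: "y \<in> cube d (\<lambda>i. v i + a i) l"
    then have "y = (\<lambda>i\<in>{..<d}. (\<lambda>i\<in>{..<d}. y i - v i) i + v i)"
      by (auto simp: cube_def fun_eq_iff restrict_def PiE_def extensional_def)
    moreover have "(\<lambda>i\<in>{..<d}. y i - v i) \<in> cube d a l"
    proof -
      have "y i \<in> {v i + a i ..< v i + a i + l}" if "i < d" for i
        using y that by (simp add: cube_def PiE_iff)
      then show ?thesis
        by (auto simp: cube_def PiE_iff algebra_simps)
    qed
    ultimately show "y \<in> translate d v (cube d a l)"
      unfolding translate_def by (rule image_eqI)
  qed
qed

text \<open>A translated cube is nonempty, hence the \<open>dcell\<close> of any of its points; from
  here on cubes are handled through a level and a point.\<close>

lemma lattice_eq: "lattice = {dcell k x | k x. x \<in> Rd d}"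
proof -
  have "translate d (lattice_offset \<omega> k) ` standard_dyadic d k = dcell k ` Rd d" for k
  proof -
    have "translate d (lattice_offset \<omega> k) ` standard_dyadic d k =
        (\<lambda>m. cube d (\<lambda>i. lattice_offset \<omega> k i + 2 powi k * of_int (m i)) (2 powi k)) ` (UNIV :: (nat \<Rightarrow> int) set)"
      by (auto simp: standard_dyadic_def translate_cube image_image full_SetCompr_eq)
    also have "\<dots> = dcell k ` Rd d"
    proof (intro subset_antisym image_subsetI)
      fix m :: "nat \<Rightarrow> int"
      let ?Q = "cube d (\<lambda>i. lattice_offset \<omega> k i + 2 powi k * of_int (m i)) (2 powi k)"
      obtain x where x: "x \<in> ?Q"
        using cube_nonempty[of "2 powi k" d] by fastforce
      then have "index k x i = m i" if "i < d" for i
        using that by (auto simp: index_eq_iff cube_def PiE_iff)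
      then have "?Q = dcell k x"
        unfolding dcell_eq_cube cube_def by (intro PiE_cong) simp
      moreover have "x \<in> Rd d"
        using x by (auto simp: cube_def Rd_def PiE_iff)
      ultimately show "?Q \<in> dcell k ` Rd d" by blast
    qed (auto simp: dcell_eq_cube)
    finally show ?thesis .
  qed
  then show ?thesis by (auto simp: lattice_def)
qed

lemma side_length_dcell: "side_length d (dcell k x) = 2 powi k"
  unfolding dcell_eq_cube using d by (intro side_length_cube) auto

lemma volume_dcell: "volume d (dcell k x) = (2 powi k) ^ d"
  unfolding dcell_eq_cube by (intro volume_cube) auto

lemma dcell_in_cubes: "dcell k x \<in> cubes d"
  unfolding dcell_eq_cube by (rule cube_in_cubes) simp

lemma dcell_in_sets: "dcell k x \<in> sets (lebesgue_Rd d)"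
  unfolding dcell_eq_cube by (rule cube_in_sets)

lemma dcell_level_eq:
  assumes "dcell k x = dcell l y"
  shows "k = l"
proof -
  have "(2::real) powi k = 2 powi l"
    using assms side_length_dcell by metis
  then show ?thesis by (rule two_powi_inject)
qed

text \<open>The indices at scale \<open>k\<close> of points of a bounded cube lie in a finite box of
  integers.\<close>

lemma finite_subcells: "finite (dcell k ` dcell l x)"
proof -
  define a where "a i = lattice_offset \<omega> l i + 2 powi l * of_int (index l x i)" for i
  define o' where "o' = lattice_offset \<omega> k"
  have "index k y \<in> (\<Pi>\<^sub>E i\<in>{..<d}. {\<lfloor>(a i - o' i) / 2 powi k\<rfloor>..\<lfloor>(a i + 2 powi l - o' i) / 2 powi k\<rfloor>})"
    if "y \<in> dcell l x" for y
  proof -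
    have "a i \<le> y i \<and> y i \<le> a i + 2 powi l" if "i < d" for i
      using \<open>y \<in> dcell l x\<close> that unfolding dcell_eq_cube cube_def PiE_iff a_def by (auto dest: bspec)
    then show ?thesis
      by (auto simp: index_def PiE_iff o'_def intro!: floor_mono divide_right_mono)
  qed
  then have "index k ` dcell l x \<subseteq>
      (\<Pi>\<^sub>E i\<in>{..<d}. {\<lfloor>(a i - o' i) / 2 powi k\<rfloor>..\<lfloor>(a i + 2 powi l - o' i) / 2 powi k\<rfloor>})"
    by blast
  then have "finite (index k ` dcell l x)"
    by (rule finite_subset) (auto intro: finite_PiE)
  then have "finite ((\<lambda>m. {y \<in> Rd d. index k y = m}) ` index k ` dcell l x)"
    by (rule finite_imageI)
  then show ?thesis
    by (simp add: image_image dcell_def)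
qed

lemma descendants_dcell:
  assumes x: "x \<in> Rd d"
  shows "descendants d lattice m (dcell k x) = dcell (k - int m) ` dcell k x"
proof (intro subset_antisym subsetI)
  fix R assume "R \<in> descendants d lattice m (dcell k x)"
  then obtain j y where R: "R = dcell j y" "y \<in> Rd d" "R \<subseteq> dcell k x"
      "side_length d R = side_length d (dcell k x) / 2 ^ m"
    by (auto simp: descendants_def lattice_eq)
  then have "(2::real) powi j = 2 powi (k - int m)"
    by (simp add: side_length_dcell power_int_diff)
  then have "j = k - int m" by (rule two_powi_inject)
  with R show "R \<in> dcell (k - int m) ` dcell k x"
    using self_in_dcell by blast
next
  fix R assume "R \<in> dcell (k - int m) ` dcell k x"
  then obtain y where y: "y \<in> dcell k x" "R = dcell (k - int m) y" by auto
  have "dcell (k - int m) y \<subseteq> dcell k y"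
    by (rule dcell_mono) simp
  with y dcell_eq[OF y(1)] have "R \<subseteq> dcell k x" by simp
  moreover have "R \<in> lattice"
    unfolding lattice_eq using y dcell_subset by blast
  ultimately show "R \<in> descendants d lattice m (dcell k x)"
    by (simp add: descendants_def y side_length_dcell power_int_diff)
qed

end

subsection \<open>The kernel of a shift\<close>

text \<open>For sums over pairs of cubes in which the points \<open>x\<close> and \<open>y\<close>
  single out one term, so that no factor counting the cubes appears.\<close>

lemma norm_sum_le_single:
  fixes t :: "'i \<Rightarrow> 'b::real_normed_vector"
  assumes single: "\<And>a b. a \<in> S \<Longrightarrow> b \<in> S \<Longrightarrow> t a \<noteq> 0 \<Longrightarrow> t b \<noteq> 0 \<Longrightarrow> a = b"
    and le: "\<And>a. a \<in> S \<Longrightarrow> norm (t a) \<le> c" and c: "c \<ge> 0"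
  shows "norm (sum t S) \<le> c"
proof (cases "finite S \<and> (\<exists>a\<in>S. t a \<noteq> 0)")
  case True
  then obtain a where a: "a \<in> S" "t a \<noteq> 0" by auto
  have "sum t S = sum t {a}"
    using True a single by (intro sum.mono_neutral_right) auto
  then show ?thesis using le[OF a(1)] by simp
next
  case False
  then have "sum t S = 0"
    by (cases "finite S") auto
  then show ?thesis using c by simp
qed

context dyadic_grid
begin

lemma dcell_in_lattice: "x \<in> Rd d \<Longrightarrow> dcell k x \<in> lattice"
  by (auto simp: lattice_eq)

lemma descendants_dcellD:
  assumes "R \<in> descendants d lattice m (dcell k z)" "z \<in> Rd d" "y \<in> R"
  shows "R = dcell (k - int m) y" "y \<in> dcell k z"
proof -
  obtain t where "R = dcell (k - int m) t"
    using assms(1,2) by (auto simp: descendants_dcell)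
  then show "R = dcell (k - int m) y"
    using assms(3) dcell_eq by simp
  show "y \<in> dcell k z"
    using assms(1,3) by (auto simp: descendants_def)
qed

text \<open>Level \<open>j - 1\<close> is that of the children of \<open>R\<close>. Two points
  sharing such a cell lie both inside or both outside of \<open>R\<close>, and outside
  \<open>h\<close> vanishes.\<close>

lemma generalized_haar_const:
  assumes h: "generalized_haar d lattice R h" and R: "R = dcell j z" "z \<in> Rd d"
    and y: "y \<in> Rd d" "y' \<in> Rd d" "dcell (j - 1) y = dcell (j - 1) y'"
  shows "h y = h y'"
proof (cases "y \<in> R")
  case True
  have "dcell (j - 1) y \<in> descendants d lattice 1 R"
    unfolding R(1) using True R by (simp add: descendants_dcell)
  with h have "h constant_on dcell (j - 1) y"
    by (auto simp: generalized_haar_def)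
  moreover have "y \<in> dcell (j - 1) y" "y' \<in> dcell (j - 1) y"
    using y self_in_dcell by auto
  ultimately show ?thesis
    unfolding constant_on_def by metis
next
  case False
  have "dcell j y = dcell j y'"
    by (rule dcell_coarsen[of "j - 1"]) (use y in auto)
  then have "y' \<notin> R"
    using False y R dcell_eq_iff by metis
  with False h y show ?thesis
    by (auto simp: generalized_haar_def)
qed

end

locale dyadic_shift = dyadic_grid d \<omega> for d \<omega> +
  fixes m n :: nat and hin hout :: haar_family
  assumes shift: "finite_elementary_shift d lattice m n hin hout"
begin

abbreviation block :: "(nat \<Rightarrow> real) set \<Rightarrow> (nat \<Rightarrow> real) \<Rightarrow> (nat \<Rightarrow> real) \<Rightarrow> complex" where
  "block \<equiv> shift_block d lattice m n hin hout"

abbreviation kernel :: "(nat \<Rightarrow> real) \<Rightarrow> (nat \<Rightarrow> real) \<Rightarrow> complex" where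
  "kernel \<equiv> shift_kernel d lattice m n hin hout"

lemma haar:
  assumes "z \<in> Rd d" "Q' \<in> descendants d lattice m (dcell k z)" "Q'' \<in> descendants d lattice n (dcell k z)"
  shows "generalized_haar d lattice Q' (hin Q' Q'')" "generalized_haar d lattice Q'' (hout Q' Q'')"
    "sup_norm d (hin Q' Q'') * sup_norm d (hout Q' Q'') \<le> 1"
  using shift assms dcell_in_lattice[OF assms(1), of k] unfolding finite_elementary_shift_def by blast+

lemma haar_eq_0:
  assumes "z \<in> Rd d" "Q' \<in> descendants d lattice m (dcell k z)" "Q'' \<in> descendants d lattice n (dcell k z)"
    and "x \<in> Rd d"
  shows "x \<notin> Q' \<Longrightarrow> hin Q' Q'' x = 0" "x \<notin> Q'' \<Longrightarrow> hout Q' Q'' x = 0"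
  using haar[OF assms(1-3)] assms(4) by (auto simp: generalized_haar_def)

lemma block_supp:
  assumes z: "z \<in> Rd d" and x: "x \<in> Rd d" and y: "y \<in> Rd d" and nz: "block (dcell k z) x y \<noteq> 0"
  shows "x \<in> dcell k z" "y \<in> dcell k z"
proof -
  obtain Q' where Q': "Q' \<in> descendants d lattice m (dcell k z)"
    and "(\<Sum>Q''\<in>descendants d lattice n (dcell k z). hout Q' Q'' x * hin Q' Q'' y) \<noteq> 0"
    using nz unfolding shift_block_def by (meson sum.neutral)
  then obtain Q'' where Q'': "Q'' \<in> descendants d lattice n (dcell k z)"
    and "hout Q' Q'' x * hin Q' Q'' y \<noteq> 0"
    by (meson sum.neutral)
  then have "x \<in> Q''" "y \<in> Q'"
    using haar_eq_0[OF z Q' Q'' x] haar_eq_0[OF z Q' Q'' y] by auto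
  then show "x \<in> dcell k z" "y \<in> dcell k z"
    using Q' Q'' by (auto simp: descendants_def)
qed

text \<open>Only the pair with \<open>y\<close> in \<open>Q'\<close> and \<open>x\<close> in
  \<open>Q''\<close> contributes, so the bound for one product of Haar functions carries over to the
  block.\<close>

lemma block_bound:
  assumes z: "z \<in> Rd d" and x: "x \<in> Rd d" and y: "y \<in> Rd d"
  shows "cmod (block (dcell k z) x y) \<le> 1"
proof -
  let ?D = "descendants d lattice m (dcell k z) \<times> descendants d lattice n (dcell k z)"
  have "cmod (\<Sum>p\<in>?D. hout (fst p) (snd p) x * hin (fst p) (snd p) y) \<le> 1"
  proof (rule norm_sum_le_single)
    fix a b assume "a \<in> ?D" "b \<in> ?D"
      "hout (fst a) (snd a) x * hin (fst a) (snd a) y \<noteq> 0" "hout (fst b) (snd b) x * hin (fst b) (snd b) y \<noteq> 0"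
    moreover have "p = (dcell (k - int m) y, dcell (k - int n) x)"
      if "p \<in> ?D" "hout (fst p) (snd p) x * hin (fst p) (snd p) y \<noteq> 0" for p
    proof -
      have p: "fst p \<in> descendants d lattice m (dcell k z)" "snd p \<in> descendants d lattice n (dcell k z)"
        using that(1) by auto
      have "x \<in> snd p" "y \<in> fst p"
        using that(2) haar_eq_0[OF z p x] haar_eq_0[OF z p y] by auto
      then show ?thesis
        using descendants_dcellD(1)[OF p(1) z] descendants_dcellD(1)[OF p(2) z] by (simp add: prod_eq_iff)
    qed
    ultimately have "a = (dcell (k - int m) y, dcell (k - int n) x)"
        "b = (dcell (k - int m) y, dcell (k - int n) x)" by blast+
    then show "a = b" by simp
  next
    fix p assume "p \<in> ?D"
    then have p: "fst p \<in> descendants d lattice m (dcell k z)" "snd p \<in> descendants d lattice n (dcell k z)"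
      by auto
    have le: "ennreal (cmod (h t)) \<le> sup_norm d h" if "t \<in> Rd d" for h t
      using that unfolding sup_norm_def by (rule SUP_upper)
    have "ennreal (cmod (hin (fst p) (snd p) y)) * ennreal (cmod (hout (fst p) (snd p) x)) \<le>
        sup_norm d (hin (fst p) (snd p)) * sup_norm d (hout (fst p) (snd p))"
      using x y by (intro mult_mono le) auto
    also have "\<dots> \<le> 1"
      using haar(3)[OF z p] .
    finally have "ennreal (cmod (hin (fst p) (snd p) y) * cmod (hout (fst p) (snd p) x)) \<le> ennreal 1"
      by (simp add: ennreal_mult)
    then show "cmod (hout (fst p) (snd p) x * hin (fst p) (snd p) y) \<le> 1"
      by (simp add: norm_mult mult.commute)
  qed simp
  then show ?thesis
    unfolding shift_block_def sum.cartesian_product by (simp add: case_prod_unfold)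
qed

lemma block_const_left:
  assumes z: "z \<in> Rd d" and x: "x \<in> Rd d" "x' \<in> Rd d"
    and eq: "dcell (k - int n - 1) x = dcell (k - int n - 1) x'"
  shows "block (dcell k z) x y = block (dcell k z) x' y"
  unfolding shift_block_def
proof (intro sum.cong refl)
  fix Q' Q'' assume Q: "Q' \<in> descendants d lattice m (dcell k z)" "Q'' \<in> descendants d lattice n (dcell k z)"
  then obtain t where t: "Q'' = dcell (k - int n) t" "t \<in> Rd d"
    using z dcell_subset by (auto simp: descendants_dcell)
  have "hout Q' Q'' x = hout Q' Q'' x'"
    using haar(2)[OF z Q] t x eq by (rule generalized_haar_const)
  then show "hout Q' Q'' x * hin Q' Q'' y = hout Q' Q'' x' * hin Q' Q'' y" by simp
qed

lemma block_const_right: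
  assumes z: "z \<in> Rd d" and x: "y \<in> Rd d" "y' \<in> Rd d"
    and eq: "dcell (k - int m - 1) y = dcell (k - int m - 1) y'"
  shows "block (dcell k z) x y = block (dcell k z) x y'"
  unfolding shift_block_def
proof (intro sum.cong refl)
  fix Q' Q'' assume Q: "Q' \<in> descendants d lattice m (dcell k z)" "Q'' \<in> descendants d lattice n (dcell k z)"
  then obtain t where t: "Q' = dcell (k - int m) t" "t \<in> Rd d"
    using z dcell_subset by (auto simp: descendants_dcell)
  have "hin Q' Q'' y = hin Q' Q'' y'"
    using haar(1)[OF z Q] t x eq by (rule generalized_haar_const)
  then show "hout Q' Q'' x * hin Q' Q'' y = hout Q' Q'' x * hin Q' Q'' y'" by simp
qed

definition active :: "(nat \<Rightarrow> real) set set" where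
  "active = {Q \<in> lattice. \<exists>x\<in>Rd d. \<exists>y\<in>Rd d. block Q x y \<noteq> 0}"

lemma finite_active: "finite active"
  using shift by (simp add: active_def finite_elementary_shift_def)

text \<open>Finitely many active cubes have bounded scales. The margin \<open>max m n + 1\<close> at
  the lower end makes all blocks constant on cells of scale \<open>top - N\<close>.\<close>

lemma active_scales:
  obtains top :: int and N :: nat where
    "\<And>k z. z \<in> Rd d \<Longrightarrow> dcell k z \<in> active \<Longrightarrow> top - int N + int (max m n) + 1 \<le> k \<and> k \<le> top"
proof -
  have "\<forall>Q\<in>active. \<exists>k z. z \<in> Rd d \<and> Q = dcell k z"
    by (auto simp: active_def lattice_eq)
  then obtain \<kappa> where \<kappa>: "\<And>Q. Q \<in> active \<Longrightarrow> \<exists>z. z \<in> Rd d \<and> Q = dcell (\<kappa> Q) z"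
    by metis
  \<comment> \<open>Inserting 0 keeps \<open>Max\<close> and \<open>Min\<close> meaningful when no
    cube is active.\<close>
  define top where "top = Max (insert 0 (\<kappa> ` active))"
  define bot where "bot = Min (insert 0 (\<kappa> ` active)) - int (max m n) - 1"
  have bounds: "bot + int (max m n) + 1 \<le> \<kappa> Q" "\<kappa> Q \<le> top" if "Q \<in> active" for Q
    unfolding top_def bot_def using that finite_active by auto
  have "0 \<le> top"
    unfolding top_def using finite_active by (intro Max_ge) auto
  moreover have "Min (insert 0 (\<kappa> ` active)) \<le> 0"
    using finite_active by (intro Min_le) auto
  ultimately have "top - int (nat (top - bot)) = bot"
    by (simp add: bot_def)
  moreover have "\<kappa> (dcell k z) = k" if "dcell k z \<in> active" for k z
    using \<kappa>[OF that] dcell_level_eq by metis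
  ultimately show ?thesis
    using bounds by (intro that[of top "nat (top - bot)"]) metis
qed

end

locale scaled_shift = dyadic_shift d \<omega> m n hin hout for d \<omega> m n hin hout +
  fixes top :: int and N :: nat
  assumes scales: "\<lbrakk>z \<in> Rd d; dcell k z \<in> active\<rbrakk> \<Longrightarrow>
    top - int N + int (max m n) + 1 \<le> k \<and> k \<le> top"
begin

text \<open>Scales are reversed and shifted: level 0 is the coarsest and level \<open>N\<close> that
  of the leaves, as in \<open>partition_tower\<close>.\<close>

definition cube_at :: "nat \<Rightarrow> (nat \<Rightarrow> real) \<Rightarrow> (nat \<Rightarrow> real) set" where
  "cube_at j x = dcell (top - int j) x"

text \<open>The kernel \<open>K j\<close> of the finite model. The case distinction builds in that
  \<open>x\<close> and \<open>y\<close> share a cube, so the support condition of the model holds by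
  definition.\<close>

definition layer :: "nat \<Rightarrow> (nat \<Rightarrow> real) \<Rightarrow> (nat \<Rightarrow> real) \<Rightarrow> complex" where
  "layer j x y = (if cube_at j x = cube_at j y
    then of_real (inverse (volume d (cube_at j x))) * block (cube_at j x) x y else 0)"

lemma cube_at_coarsen:
  "j \<le> k \<Longrightarrow> x \<in> Rd d \<Longrightarrow> cube_at k x = cube_at k y \<Longrightarrow> cube_at j x = cube_at j y"
  unfolding cube_at_def by (rule dcell_coarsen[of "top - int k"]) auto

lemma cube_at_mono: "j \<le> k \<Longrightarrow> cube_at k x \<subseteq> cube_at j x"
  unfolding cube_at_def by (rule dcell_mono) simp

lemma layer_eq_0:
  assumes x: "x \<in> Rd d" and y: "y \<in> Rd d" and nz: "layer j x y \<noteq> 0"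
  shows "cube_at j x \<in> active" "j + max m n + 1 \<le> N"
proof -
  have "block (cube_at j x) x y \<noteq> 0"
    using nz by (auto simp: layer_def split: if_splits)
  then show *: "cube_at j x \<in> active"
    using x y dcell_in_lattice by (auto simp: active_def cube_at_def)
  show "j + max m n + 1 \<le> N"
    using scales[OF x, of "top - int j"] * by (simp add: cube_at_def)
qed

text \<open>A contributing cube is active and contains both points, so it is
  \<open>cube_at j x\<close> for some \<open>j \<le> N\<close>; distinct levels give distinct cubes.
  Hence the infinite sum is a finite one over levels.\<close>

lemma kernel_eq_sum_layers:
  assumes x: "x \<in> Rd d" and y: "y \<in> Rd d"
  shows "kernel x y = (\<Sum>j\<le>N. layer j x y)"
proof -
  define J where "J = {j. j \<le> N \<and> cube_at j x = cube_at j y}"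
  let ?t = "\<lambda>Q. of_real (inverse (volume d Q)) * block Q x y"
  have "kernel x y = infsum ?t ((\<lambda>j. cube_at j x) ` J)"
    unfolding shift_kernel_def
  proof (rule infsum_cong_neutral)
    fix Q assume "Q \<in> (\<lambda>j. cube_at j x) ` J - lattice"
    then show "?t Q = 0"
      using x dcell_in_lattice by (auto simp: cube_at_def)
  next
    fix Q assume Q: "Q \<in> lattice - (\<lambda>j. cube_at j x) ` J"
    then obtain k z where kz: "Q = dcell k z" "z \<in> Rd d"
      by (auto simp: lattice_eq)
    have "block Q x y = 0"
    proof (rule ccontr)
      assume nz: "block Q x y \<noteq> 0"
      then have "Q \<in> active"
        using Q x y by (auto simp: active_def)
      then have k: "top - int N \<le> k" "k \<le> top"
        using scales[OF kz(2), of k] kz(1) by auto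
      have "x \<in> Q" "y \<in> Q"
        using block_supp[OF kz(2) x y, of k] nz kz(1) by auto
      then have "Q = dcell k x" "dcell k x = dcell k y"
        using kz(1) dcell_eq by auto
      then have "Q = cube_at (nat (top - k)) x" "nat (top - k) \<in> J"
        using k by (auto simp: cube_at_def J_def)
      then show False using Q by blast
    qed
    then show "?t Q = 0" by simp
  qed simp
  also have "\<dots> = (\<Sum>Q\<in>(\<lambda>j. cube_at j x) ` J. ?t Q)"
    by (rule infsum_finite) (simp add: J_def)
  also have "\<dots> = (\<Sum>j\<in>J. ?t (cube_at j x))"
  proof (subst sum.reindex)
    show "inj_on (\<lambda>j. cube_at j x) J"
    proof (rule inj_onI)
      fix i j assume "cube_at i x = cube_at j x"
      then show "i = j"
        using dcell_level_eq[of "top - int i" x "top - int j" x] by (simp add: cube_at_def)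
    qed
  qed (simp only: o_def)
  also have "\<dots> = (\<Sum>j\<le>N. layer j x y)"
    by (intro sum.mono_neutral_cong_left) (auto simp: J_def layer_def)
  finally show ?thesis .
qed

lemma layer_const_left:
  assumes x: "x \<in> Rd d" "x' \<in> Rd d" and eq: "cube_at (j + max m n + 1) x = cube_at (j + max m n + 1) x'"
  shows "layer j x y = layer j x' y"
proof -
  have 1: "cube_at j x = cube_at j x'" and 2: "cube_at (j + n + 1) x = cube_at (j + n + 1) x'"
    by (rule cube_at_coarsen[OF _ x(1) eq], simp)+
  have 3: "block (cube_at j x) x y = block (cube_at j x) x' y"
    unfolding cube_at_def using 2 x
    by (intro block_const_left) (auto simp: cube_at_def algebra_simps)
  show ?thesis
    unfolding layer_def 3 unfolding 1 ..
qed

lemma layer_const_right: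
  assumes x: "x \<in> Rd d" and y: "y \<in> Rd d" "y' \<in> Rd d"
    and eq: "cube_at (j + max m n + 1) y = cube_at (j + max m n + 1) y'"
  shows "layer j x y = layer j x y'"
proof -
  have 1: "cube_at j y = cube_at j y'" and 2: "cube_at (j + m + 1) y = cube_at (j + m + 1) y'"
    by (rule cube_at_coarsen[OF _ y(1) eq], simp)+
  have 3: "block (cube_at j x) x y = block (cube_at j x) x y'"
    unfolding cube_at_def using 2 x y
    by (intro block_const_right) (auto simp: cube_at_def algebra_simps)
  show ?thesis
    unfolding layer_def 3 1 ..
qed

text \<open>A layer either is constant on cells of level \<open>j + max m n + 1 \<le> N\<close>, or
  vanishes because no cube that small is active.\<close>

lemma kernel_const_left:
  assumes x: "x \<in> Rd d" "x' \<in> Rd d" and y: "y \<in> Rd d" and eq: "cube_at N x = cube_at N x'"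
  shows "kernel x y = kernel x' y"
proof -
  have "layer j x y = layer j x' y" for j
  proof (cases "j + max m n + 1 \<le> N")
    case True
    from layer_const_left[OF x cube_at_coarsen[OF this x(1) eq]] show ?thesis .
  next
    case False
    then show ?thesis
      using layer_eq_0(2)[OF x(1) y, of j] layer_eq_0(2)[OF x(2) y, of j] by argo
  qed
  then show ?thesis
    using x y by (simp add: kernel_eq_sum_layers)
qed

lemma kernel_const_right:
  assumes x: "x \<in> Rd d" and y: "y \<in> Rd d" "y' \<in> Rd d" and eq: "cube_at N y = cube_at N y'"
  shows "kernel x y = kernel x y'"
proof -
  have "layer j x y = layer j x y'" for j
  proof (cases "j + max m n + 1 \<le> N")
    case True
    from layer_const_right[OF x y cube_at_coarsen[OF this y(1) eq]] show ?thesis .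
  next
    case False
    then show ?thesis
      using layer_eq_0(2)[OF x y(1), of j] layer_eq_0(2)[OF x y(2), of j] by argo
  qed
  then show ?thesis
    using x y by (simp add: kernel_eq_sum_layers)
qed

text \<open>The leaves are those of entire top cubes over the active cubes, not just those inside
  active cubes. This gives the last property, by which each cube of the tree is the union of its
  sampled leaves and cube measures are sums over samples.\<close>

lemma sample_points:
  obtains X where "finite X" "X \<subseteq> Rd d" "inj_on (cube_at N) X"
    "\<And>x y. x \<in> Rd d \<Longrightarrow> y \<in> Rd d \<Longrightarrow> kernel x y \<noteq> 0 \<Longrightarrow>
      cube_at N x \<in> cube_at N ` X \<and> cube_at N y \<in> cube_at N ` X"
    "\<And>x y. x \<in> X \<Longrightarrow> y \<in> cube_at 0 x \<Longrightarrow> cube_at N y \<in> cube_at N ` X"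
proof -
  \<comment> \<open>Any point of an active cube determines the same ancestor of level 0, so an
    arbitrary choice does.\<close>
  define U where "U = (\<Union>Q\<in>active. cube_at 0 (SOME z. z \<in> Q))"
  have "finite (cube_at N ` U)"
    unfolding U_def image_UN cube_at_def using finite_active finite_subcells by blast
  moreover obtain X where X: "X \<subseteq> U" "inj_on (cube_at N) X" "cube_at N ` U = cube_at N ` X"
    using subset_image_inj[of "cube_at N ` U" "cube_at N" U] by auto
  ultimately have "finite X"
    by (metis finite_imageD)
  have URd: "U \<subseteq> Rd d"
    unfolding U_def cube_at_def using dcell_subset by blast
  have mem: "x \<in> U" if x: "x \<in> Rd d" and Q: "cube_at j x \<in> active" for x j
  proof -
    define z where "z = (SOME z. z \<in> cube_at j x)"
    have "z \<in> cube_at j x"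
      unfolding z_def using self_in_dcell[OF x] by (metis cube_at_def someI)
    then have z: "cube_at j x = cube_at j z"
      unfolding cube_at_def using dcell_eq by metis
    have "cube_at 0 x = cube_at 0 z"
      by (rule cube_at_coarsen[OF _ x z]) simp
    then have "x \<in> cube_at 0 z"
      using self_in_dcell[OF x] by (metis cube_at_def)
    then show ?thesis
      unfolding U_def z_def using Q by blast
  qed
  have supp: "cube_at N x \<in> cube_at N ` X \<and> cube_at N y \<in> cube_at N ` X"
    if x: "x \<in> Rd d" and y: "y \<in> Rd d" and nz: "kernel x y \<noteq> 0" for x y
  proof -
    obtain j where j: "layer j x y \<noteq> 0"
      using nz kernel_eq_sum_layers[OF x y] by (metis sum.neutral)
    then have "cube_at j x = cube_at j y"
      by (auto simp: layer_def split: if_splits)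
    then have "x \<in> U" "y \<in> U"
      using mem[OF x, of j] mem[OF y, of j] layer_eq_0(1)[OF x y j] by auto
    then show ?thesis using X(3) by blast
  qed
  have sat: "cube_at N y \<in> cube_at N ` X" if "x \<in> X" and y: "y \<in> cube_at 0 x" for x y
  proof -
    obtain Q where Q: "Q \<in> active" "x \<in> cube_at 0 (SOME z. z \<in> Q)"
      using \<open>x \<in> X\<close> X(1) by (auto simp: U_def)
    then have "y \<in> cube_at 0 (SOME z. z \<in> Q)"
      using y dcell_eq unfolding cube_at_def by metis
    then show ?thesis
      using Q X(3) by (auto simp: U_def)
  qed
  show ?thesis
    using \<open>finite X\<close> X URd supp sat by (intro that[of X]) auto
qed

end

subsection \<open>Reduction to a finite tree\<close>

locale sampled_shift = scaled_shift d \<omega> m n hin hout top N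
  for d \<omega> m n hin hout top N +
  fixes X :: "(nat \<Rightarrow> real) set"
  assumes finite_samples: "finite X" and samples_subset: "X \<subseteq> Rd d" and inj_samples: "inj_on (cube_at N) X"
    and kernel_supp: "\<lbrakk>x \<in> Rd d; y \<in> Rd d; kernel x y \<noteq> 0\<rbrakk> \<Longrightarrow>
      cube_at N x \<in> cube_at N ` X \<and> cube_at N y \<in> cube_at N ` X"
    and saturated: "\<lbrakk>x \<in> X; y \<in> cube_at 0 x\<rbrakk> \<Longrightarrow> cube_at N y \<in> cube_at N ` X"
begin

sublocale partition_tower X cube_at
proof
  show "finite X" by (rule finite_samples)
  fix x y k assume "x \<in> X" "cube_at (Suc k) x = cube_at (Suc k) y"
  then show "cube_at k x = cube_at k y"
    using samples_subset by (intro cube_at_coarsen[of k "Suc k"]) auto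
qed

lemma in_cube_at_iff: "x \<in> Rd d \<Longrightarrow> x \<in> cube_at j y \<longleftrightarrow> cube_at j x = cube_at j y"
  unfolding cube_at_def by (simp add: dcell_eq_iff)

lemma cube_at_subset: "cube_at j x \<subseteq> Rd d"
  unfolding cube_at_def by (rule dcell_subset)

lemma in_cube_sampleD:
  assumes "x \<in> X" "y \<in> cube_at k x"
  shows "cube_at N y \<in> cube_at N ` X"
  using saturated[OF assms(1), of y] assms(2) cube_at_mono[of 0 k x] by blast

text \<open>The leaves of distinct samples are disjoint, so exactly one indicator survives.\<close>

lemma sum_samples:
  fixes G :: "(nat \<Rightarrow> real) \<Rightarrow> 'b::semiring_1"
  assumes y: "y \<in> Rd d" and z: "z \<in> X" "cube_at N y = cube_at N z"
  shows "(\<Sum>x\<in>X. G x * indicator (cube_at N x) y) = G z"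
proof -
  have "(\<Sum>x\<in>X. G x * indicator (cube_at N x) y) = (\<Sum>x\<in>X. if x = z then G x else 0)"
  proof (rule sum.cong[OF refl])
    fix x assume "x \<in> X"
    then have "y \<in> cube_at N x \<longleftrightarrow> x = z"
      using z inj_samples y by (auto simp: in_cube_at_iff inj_on_def)
    then show "G x * indicator (cube_at N x) y = (if x = z then G x else 0)"
      by (simp add: indicator_def)
  qed
  then show ?thesis using z finite_samples by simp
qed

lemma sum_samples_eq_0:
  fixes G :: "(nat \<Rightarrow> real) \<Rightarrow> 'b::semiring_1"
  assumes "y \<in> Rd d" "cube_at N y \<notin> cube_at N ` X"
  shows "(\<Sum>x\<in>X. G x * indicator (cube_at N x) y) = 0"
  using assms by (intro sum.neutral) (auto simp: in_cube_at_iff indicator_def)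

text \<open>Such a kernel amounts to a finite matrix over the leaves. It is stated for a general
  \<open>A\<close> so that the shift kernel and its adjoint share one reduction.\<close>

definition leafwise :: "((nat \<Rightarrow> real) \<Rightarrow> (nat \<Rightarrow> real) \<Rightarrow> complex) \<Rightarrow> bool" where
  "leafwise A \<longleftrightarrow>
    (\<forall>x\<in>Rd d. \<forall>x'\<in>Rd d. \<forall>y\<in>Rd d. cube_at N x = cube_at N x' \<longrightarrow> A x y = A x' y) \<and>
    (\<forall>x\<in>Rd d. \<forall>y\<in>Rd d. \<forall>y'\<in>Rd d. cube_at N y = cube_at N y' \<longrightarrow> A x y = A x y') \<and>
    (\<forall>x\<in>Rd d. \<forall>y\<in>Rd d. A x y \<noteq> 0 \<longrightarrow>
      cube_at N x \<in> cube_at N ` X \<and> cube_at N y \<in> cube_at N ` X)"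

lemma leafwiseD:
  assumes "leafwise A"
  shows "\<lbrakk>x \<in> Rd d; x' \<in> Rd d; y \<in> Rd d; cube_at N x = cube_at N x'\<rbrakk> \<Longrightarrow> A x y = A x' y"
    "\<lbrakk>x \<in> Rd d; y \<in> Rd d; y' \<in> Rd d; cube_at N y = cube_at N y'\<rbrakk> \<Longrightarrow> A x y = A x y'"
    "\<lbrakk>x \<in> Rd d; y \<in> Rd d; A x y \<noteq> 0\<rbrakk> \<Longrightarrow> cube_at N x \<in> cube_at N ` X"
    "\<lbrakk>x \<in> Rd d; y \<in> Rd d; A x y \<noteq> 0\<rbrakk> \<Longrightarrow> cube_at N y \<in> cube_at N ` X"
  using assms unfolding leafwise_def by blast+

lemma leafwise_kernel: "leafwise kernel"
  unfolding leafwise_def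
proof (intro conjI ballI impI)
  fix x x' y assume "x \<in> Rd d" "x' \<in> Rd d" "y \<in> Rd d" "cube_at N x = cube_at N x'"
  then show "kernel x y = kernel x' y" by (rule kernel_const_left)
next
  fix x y y' assume "x \<in> Rd d" "y \<in> Rd d" "y' \<in> Rd d" "cube_at N y = cube_at N y'"
  then show "kernel x y = kernel x y'" by (rule kernel_const_right)
next
  fix x y assume "x \<in> Rd d" "y \<in> Rd d" "kernel x y \<noteq> 0"
  note supp = kernel_supp[OF this]
  show "cube_at N x \<in> cube_at N ` X" by (rule conjunct1[OF supp])
  show "cube_at N y \<in> cube_at N ` X" by (rule conjunct2[OF supp])
qed

lemma leafwise_adjoint:
  assumes A: "leafwise A"
  shows "leafwise (\<lambda>y x. cnj (A x y))"
  unfolding leafwise_def complex_cnj_zero_iff complex_cnj_cancel_iff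
proof (intro conjI ballI impI)
  fix y x assume "y \<in> Rd d" "x \<in> Rd d" "A x y \<noteq> 0"
  then show "cube_at N y \<in> cube_at N ` X" "cube_at N x \<in> cube_at N ` X"
    using leafwiseD(3,4)[OF A, of x y] by simp_all
qed (rule leafwiseD[OF A]; assumption)+

section \<open>Integrals of leafwise functions against a Radon measure\<close>

context
  fixes \<mu> :: "(nat \<Rightarrow> real) measure"
  assumes radon: "radon_measure d \<mu>"
begin

lemma sets_eq: "sets \<mu> = sets (lebesgue_Rd d)"
  using radon by (simp add: radon_measure_def)

lemma space_eq: "space \<mu> = Rd d"
  using sets_eq_imp_space_eq[OF sets_eq] by (simp add: space_lebesgue_Rd)

lemma cube_at_in_sets [measurable]: "cube_at j x \<in> sets \<mu>"
  unfolding sets_eq cube_at_def by (rule dcell_in_sets)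

lemma emeasure_cube_at: "emeasure \<mu> (cube_at j x) < \<infinity>"
  unfolding cube_at_def dcell_eq_cube by (rule radon_measure_cube_finite[OF radon])

lemma emeasure_cube_at_eq: "emeasure \<mu> (cube_at j x) = ennreal (measure \<mu> (cube_at j x))"
  using emeasure_cube_at[of j x] by (intro emeasure_eq_ennreal_measure) (auto simp: less_top)

text \<open>A leafwise kernel sees \<open>f\<close> only through its integrals over the
  leaves.\<close>

lemma integral_op_leafwise:
  assumes A: "leafwise A" and x: "x \<in> Rd d"
    and f: "\<And>z. z \<in> X \<Longrightarrow> integrable \<mu> (\<lambda>y. f y * indicator (cube_at N z) y)"
  shows "integral_op A \<mu> f x = (\<Sum>z\<in>X. A x z * (LINT y|\<mu>. f y * indicator (cube_at N z) y))"
proof -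
  have "A x y * f y = (\<Sum>z\<in>X. A x z * (f y * indicator (cube_at N z) y))" if y: "y \<in> Rd d" for y
  proof (cases "cube_at N y \<in> cube_at N ` X")
    case True
    then obtain z where z: "z \<in> X" "cube_at N y = cube_at N z" by auto
    then have "A x y = A x z"
      using samples_subset x y by (intro leafwiseD(2)[OF A]) auto
    then show ?thesis
      using sum_samples[OF y z, of "\<lambda>z. A x z * f y"] by (simp add: mult.assoc)
  next
    case False
    then have "A x y = 0"
      using leafwiseD(4)[OF A x y] by blast
    then show ?thesis
      using sum_samples_eq_0[OF y False, of "\<lambda>z. A x z * f y"] by (simp add: mult.assoc)
  qed
  then have "integral_op A \<mu> f x = (LINT y|\<mu>. (\<Sum>z\<in>X. A x z * (f y * indicator (cube_at N z) y)))"
    unfolding integral_op_def by (intro Bochner_Integration.integral_cong refl) (simp add: space_eq)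
  also have "\<dots> = (\<Sum>z\<in>X. (LINT y|\<mu>. A x z * (f y * indicator (cube_at N z) y)))"
    using f by (intro Bochner_Integration.integral_sum) simp
  also have "\<dots> = (\<Sum>z\<in>X. A x z * (LINT y|\<mu>. f y * indicator (cube_at N z) y))"
    by simp
  finally show ?thesis .
qed

lemma integral_op_const:
  assumes A: "leafwise A" and x: "x \<in> Rd d" "x' \<in> Rd d" "cube_at N x = cube_at N x'"
  shows "integral_op A \<mu> f x = integral_op A \<mu> f x'"
  unfolding integral_op_def
proof (intro Bochner_Integration.integral_cong refl)
  fix y assume "y \<in> space \<mu>"
  then have "A x y = A x' y"
    using x by (intro leafwiseD(1)[OF A]) (auto simp: space_eq)
  then show "A x y * f y = A x' y * f y" by simp
qed

lemma integral_op_supp: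
  assumes A: "leafwise A" and x: "x \<in> Rd d" and nz: "integral_op A \<mu> f x \<noteq> 0"
  shows "cube_at N x \<in> cube_at N ` X"
proof (rule ccontr)
  assume "cube_at N x \<notin> cube_at N ` X"
  then have "A x y = 0" if "y \<in> Rd d" for y
    using leafwiseD(3)[OF A x that] by blast
  then have "integral_op A \<mu> f x = (LINT y|\<mu>. 0)"
    unfolding integral_op_def by (intro Bochner_Integration.integral_cong refl) (simp add: space_eq)
  with nz show False by simp
qed

lemma nn_integral_leafwise:
  fixes h :: "(nat \<Rightarrow> real) \<Rightarrow> real"
  assumes nonneg: "\<And>x. h x \<ge> 0"
    and const: "\<And>x z. x \<in> Rd d \<Longrightarrow> z \<in> X \<Longrightarrow> cube_at N x = cube_at N z \<Longrightarrow> h x = h z"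
    and supp: "\<And>x. x \<in> Rd d \<Longrightarrow> h x \<noteq> 0 \<Longrightarrow> cube_at N x \<in> cube_at N ` X"
  shows "(\<integral>\<^sup>+x. ennreal (h x) \<partial>\<mu>) = ennreal (\<Sum>z\<in>X. h z * measure \<mu> (cube_at N z))"
proof -
  have "ennreal (h x) = (\<Sum>z\<in>X. ennreal (h z) * indicator (cube_at N z) x)" if x: "x \<in> Rd d" for x
  proof (cases "cube_at N x \<in> cube_at N ` X")
    case True
    then obtain z where z: "z \<in> X" "cube_at N x = cube_at N z" by auto
    then show ?thesis
      using sum_samples[OF x z, of "\<lambda>z. ennreal (h z)"] const[OF x z] by simp
  next
    case False
    then have "h x = 0"
      using supp[OF x] by blast
    then show ?thesis
      using sum_samples_eq_0[OF x False, of "\<lambda>z. ennreal (h z)"] by simp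
  qed
  then have "(\<integral>\<^sup>+x. ennreal (h x) \<partial>\<mu>) = (\<integral>\<^sup>+x. (\<Sum>z\<in>X. ennreal (h z) * indicator (cube_at N z) x) \<partial>\<mu>)"
    by (intro nn_integral_cong) (simp add: space_eq)
  also have "\<dots> = (\<Sum>z\<in>X. ennreal (h z) * emeasure \<mu> (cube_at N z))"
    by (simp add: nn_integral_sum nn_integral_cmult_indicator)
  also have "\<dots> = ennreal (\<Sum>z\<in>X. h z * measure \<mu> (cube_at N z))"
    using nonneg by (simp add: emeasure_cube_at_eq ennreal_mult flip: sum_ennreal)
  finally show ?thesis .
qed

lemma sum_indicator_cube_at:
  fixes h :: "(nat \<Rightarrow> real) \<Rightarrow> 'b::semiring_1"
  shows "(\<Sum>z\<in>X. h z * indicator (cube_at k x) z) = (\<Sum>z\<in>cell k x. h z)"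
proof (rule sum.mono_neutral_cong_right)
  show "\<forall>z\<in>X - cell k x. h z * indicator (cube_at k x) z = 0"
    using samples_subset by (auto simp: cell_def in_cube_at_iff subset_eq)
  show "h z * indicator (cube_at k x) z = h z" if "z \<in> cell k x" for z
    using that samples_subset by (auto simp: cell_def in_cube_at_iff subset_eq)
qed (use finite_samples in_cellD in auto)

lemma cube_at_leaf:
  assumes k: "k \<le> N" and x: "x \<in> Rd d" "z \<in> Rd d" "cube_at N x = cube_at N z"
  shows "x \<in> cube_at k y \<longleftrightarrow> z \<in> cube_at k y"
  using cube_at_coarsen[OF k x(1,3)] x by (simp add: in_cube_at_iff)

text \<open>All leaves inside the cube are sampled, by saturation, so none is missing from the
  sum.\<close>

lemma measure_cube_at:
  assumes x: "x \<in> X" and k: "k \<le> N"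
  shows "measure \<mu> (cube_at k x) = (\<Sum>z\<in>cell k x. measure \<mu> (cube_at N z))"
proof -
  have "ennreal (measure \<mu> (cube_at k x)) = (\<integral>\<^sup>+z. ennreal (indicator (cube_at k x) z) \<partial>\<mu>)"
    by (simp add: ennreal_indicator emeasure_cube_at_eq)
  also have "\<dots> = ennreal (\<Sum>z\<in>X. indicator (cube_at k x) z * measure \<mu> (cube_at N z))"
  proof (rule nn_integral_leafwise)
    fix z z' assume "z \<in> Rd d" "z' \<in> X" "cube_at N z = cube_at N z'"
    then have "z \<in> cube_at k x \<longleftrightarrow> z' \<in> cube_at k x"
      using samples_subset by (intro cube_at_leaf[OF k]) auto
    then show "(indicator (cube_at k x) z :: real) = indicator (cube_at k x) z'"
      by (simp add: indicator_def)
  next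
    fix z assume "indicator (cube_at k x) z \<noteq> (0::real)"
    then show "cube_at N z \<in> cube_at N ` X"
      using in_cube_sampleD[OF x, of z k] by (simp add: indicator_def split: if_splits)
  qed simp
  also have "(\<Sum>z\<in>X. indicator (cube_at k x) z * measure \<mu> (cube_at N z)) =
      (\<Sum>z\<in>cell k x. measure \<mu> (cube_at N z))"
    using sum_indicator_cube_at[of "\<lambda>z. measure \<mu> (cube_at N z)" k x] by (simp add: mult.commute)
  finally show ?thesis
    by (simp add: sum_nonneg)
qed

lemma integral_op_indicator:
  assumes A: "leafwise A" and x: "x \<in> X" and k: "k \<le> N" and z: "z \<in> Rd d"
  shows "integral_op A \<mu> (indicator (cube_at k x)) z =
    (\<Sum>y\<in>cell k x. A z y * of_real (measure \<mu> (cube_at N y)))"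
proof -
  have *: "(\<lambda>t. indicator (cube_at k x) t * indicator (cube_at N y) t :: complex) =
      (\<lambda>t. of_real (indicator (cube_at N y \<inter> cube_at k x) t))" for y
    by (auto simp: indicator_def)
  have y: "cube_at N y \<inter> cube_at k x = (if y \<in> cube_at k x then cube_at N y else {})" if "y \<in> X" for y
  proof -
    have "y \<in> Rd d" using that samples_subset by auto
    have "t \<in> cube_at k x \<longleftrightarrow> y \<in> cube_at k x" if t: "t \<in> cube_at N y" for t
    proof (rule cube_at_leaf[OF k])
      show "t \<in> Rd d" using t cube_at_subset by blast
      then show "cube_at N t = cube_at N y" using t in_cube_at_iff by simp
    qed fact
    then show ?thesis by auto
  qed
  have int: "integrable \<mu> (indicator (cube_at N y \<inter> cube_at k x) :: _ \<Rightarrow> real)" for y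
    using emeasure_cube_at[of N y] emeasure_mono[of "cube_at N y \<inter> cube_at k x" "cube_at N y" \<mu>]
    by (intro integrable_real_indicator) (auto intro: le_less_trans)
  have "integral_op A \<mu> (indicator (cube_at k x)) z =
      (\<Sum>y\<in>X. A z y * (LINT t|\<mu>. indicator (cube_at k x) t * indicator (cube_at N y) t))"
    using A z int unfolding * by (intro integral_op_leafwise[THEN trans]) (auto simp: *)
  also have "\<dots> = (\<Sum>y\<in>X. A z y * of_real (measure \<mu> (cube_at N y)) * indicator (cube_at k x) y)"
  proof (rule sum.cong[OF refl])
    fix t assume "t \<in> X"
    then show "A z t * (LINT s|\<mu>. indicator (cube_at k x) s * indicator (cube_at N t) s) =
        A z t * of_real (measure \<mu> (cube_at N t)) * indicator (cube_at k x) t"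
      unfolding * y[OF \<open>t \<in> X\<close>] by (cases "t \<in> cube_at k x") simp_all
  qed
  also have "\<dots> = (\<Sum>y\<in>cell k x. A z y * of_real (measure \<mu> (cube_at N y)))"
    by (rule sum_indicator_cube_at)
  finally show ?thesis .
qed

text \<open>\<open>F\<close> is the average of \<open>f\<close> over a leaf. It has the same leaf
  integrals, so the operator does not distinguish it from \<open>f\<close>, and by Cauchy--Schwarz
  on each leaf its norm is no larger.\<close>

lemma leaf_average:
  assumes f: "f \<in> borel_measurable \<mu>" and L2: "(\<integral>\<^sup>+x. ennreal ((cmod (f x))\<^sup>2) \<partial>\<mu>) < \<infinity>"
  obtains F where "\<And>z. z \<in> X \<Longrightarrow> integrable \<mu> (\<lambda>y. f y * indicator (cube_at N z) y)"
    "\<And>z. z \<in> X \<Longrightarrow> (LINT y|\<mu>. f y * indicator (cube_at N z) y) = F z * of_real (measure \<mu> (cube_at N z))"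
    "ennreal (\<Sum>z\<in>X. (cmod (F z))\<^sup>2 * measure \<mu> (cube_at N z)) \<le> (\<integral>\<^sup>+x. ennreal ((cmod (f x))\<^sup>2) \<partial>\<mu>)"
proof -
  note [measurable] = f
  define u where "u z = measure \<mu> (cube_at N z)" for z
  define I where "I z = (LINT y|\<mu>. f y * indicator (cube_at N z) y)" for z
  define G where "G z = (\<integral>\<^sup>+y. ennreal ((cmod (f y))\<^sup>2) * indicator (cube_at N z) y \<partial>\<mu>)" for z
  have CS: "(\<integral>\<^sup>+y. ennreal (cmod (f y * indicator (cube_at N z) y)) \<partial>\<mu>)\<^sup>2 \<le> G z * ennreal (u z)" for z
  proof -
    have "(\<integral>\<^sup>+y. ennreal (cmod (f y * indicator (cube_at N z) y)) \<partial>\<mu>) =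
        (\<integral>\<^sup>+y. (ennreal (cmod (f y)) * indicator (cube_at N z) y) * indicator (cube_at N z) y \<partial>\<mu>)"
      by (intro nn_integral_cong) (simp add: indicator_def)
    also have "\<dots>\<^sup>2 \<le> (\<integral>\<^sup>+y. (ennreal (cmod (f y)) * indicator (cube_at N z) y)\<^sup>2 \<partial>\<mu>) *
        (\<integral>\<^sup>+y. (indicator (cube_at N z) y)\<^sup>2 \<partial>\<mu>)"
      by (rule Cauchy_Schwarz_nn_integral) measurable
    also have "(\<integral>\<^sup>+y. (indicator (cube_at N z) y)\<^sup>2 \<partial>\<mu>) = (\<integral>\<^sup>+y. indicator (cube_at N z) y \<partial>\<mu>)"
      by (intro nn_integral_cong) (simp add: indicator_def)
    also have "\<dots> = ennreal (u z)"
      by (simp add: emeasure_cube_at_eq u_def)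
    also have "(\<integral>\<^sup>+y. (ennreal (cmod (f y)) * indicator (cube_at N z) y)\<^sup>2 \<partial>\<mu>) = G z"
      unfolding G_def by (intro nn_integral_cong) (simp add: indicator_def ennreal_power)
    finally show ?thesis .
  qed
  have G: "G z \<le> (\<integral>\<^sup>+x. ennreal ((cmod (f x))\<^sup>2) \<partial>\<mu>)" for z
    unfolding G_def by (intro nn_integral_mono) (simp add: indicator_def)
  then have Gfin: "G z < \<infinity>" for z
    using L2 le_less_trans by blast
  have int: "integrable \<mu> (\<lambda>y. f y * indicator (cube_at N z) y)" for z
  proof (rule integrableI_bounded)
    have "G z * ennreal (u z) < \<infinity>"
      using Gfin[of z] by (simp add: ennreal_mult_less_top)
    then show "(\<integral>\<^sup>+y. ennreal (cmod (f y * indicator (cube_at N z) y)) \<partial>\<mu>) < \<infinity>"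
      using CS[of z] by (metis le_less_trans power_less_top_ennreal zero_neq_numeral infinity_ennreal_def)
  qed measurable
  have I: "(cmod (I z))\<^sup>2 \<le> enn2real (G z) * u z" for z
  proof -
    have "ennreal (cmod (I z)) \<le> (\<integral>\<^sup>+y. ennreal (cmod (f y * indicator (cube_at N z) y)) \<partial>\<mu>)"
      unfolding I_def using int by (rule integral_norm_bound_ennreal)
    then have "(ennreal (cmod (I z)))\<^sup>2 \<le> G z * ennreal (u z)"
      using CS[of z] power_mono by (metis (no_types, lifting) order_trans zero_le)
    also have "G z = ennreal (enn2real (G z))"
      using Gfin[of z] by simp
    finally have "ennreal ((cmod (I z))\<^sup>2) \<le> ennreal (enn2real (G z) * u z)"
      by (simp add: ennreal_power ennreal_mult u_def)
    then show ?thesis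
      by (simp add: u_def)
  qed
  define F where "F z = I z / of_real (u z)" for z
  \<comment> \<open>On a leaf of measure 0 the bound on \<open>I z\<close> forces the integral to
    vanish, in accordance with the default value of the quotient.\<close>
  have 1: "I z = F z * of_real (u z)" for z
    using I[of z] by (cases "u z = 0") (auto simp: F_def)
  have 2: "(cmod (F z))\<^sup>2 * u z \<le> enn2real (G z)" for z
  proof (cases "u z = 0")
    case False
    then have "u z > 0" by (simp add: u_def zero_less_measure_iff)
    then show ?thesis
      using I[of z] by (simp add: F_def norm_divide power_divide power2_eq_square[of "u z"] divide_simps)
  qed (simp add: u_def)
  have "ennreal (\<Sum>z\<in>X. (cmod (F z))\<^sup>2 * u z) \<le> ennreal (\<Sum>z\<in>X. enn2real (G z))"
    by (intro ennreal_leI sum_mono 2)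
  also have "\<dots> = (\<Sum>z\<in>X. G z)"
    using Gfin by (simp flip: sum_ennreal)
  also have "\<dots> = (\<integral>\<^sup>+y. (\<Sum>z\<in>X. ennreal ((cmod (f y))\<^sup>2) * indicator (cube_at N z) y) \<partial>\<mu>)"
    unfolding G_def by (rule nn_integral_sum[symmetric]) measurable
  also have "\<dots> \<le> (\<integral>\<^sup>+x. ennreal ((cmod (f x))\<^sup>2) \<partial>\<mu>)"
  proof (rule nn_integral_mono)
    fix y assume "y \<in> space \<mu>"
    then have y: "y \<in> Rd d" by (simp add: space_eq)
    show "(\<Sum>z\<in>X. ennreal ((cmod (f y))\<^sup>2) * indicator (cube_at N z) y) \<le> ennreal ((cmod (f y))\<^sup>2)"
    proof (cases "cube_at N y \<in> cube_at N ` X")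
      case True
      then obtain z where "z \<in> X" "cube_at N y = cube_at N z" by auto
      from sum_samples[OF y this, of "\<lambda>_. ennreal ((cmod (f y))\<^sup>2)"] show ?thesis by simp
    next
      case False
      from sum_samples_eq_0[OF y this, of "\<lambda>_. ennreal ((cmod (f y))\<^sup>2)"] show ?thesis by simp
    qed
  qed
  finally show ?thesis
    using int 1 by (intro that[of F]) (auto simp: I_def u_def)
qed

end

text \<open>The image of the indicator and the restriction to the cube are both leafwise, so the
  testing integral equals the testing sum of the finite model without loss.\<close>

lemma testing_integral:
  assumes \<mu>: "radon_measure d \<mu>" and \<nu>: "radon_measure d \<nu>" and A: "leafwise A"
    and x: "x \<in> X" and k: "k \<le> N"
  shows "(\<integral>\<^sup>+z\<in>cube_at k x. ennreal ((cmod (integral_op A \<mu> (indicator (cube_at k x)) z))\<^sup>2) \<partial>\<nu>) =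
    ennreal (\<Sum>z\<in>cell k x. (cmod (\<Sum>y\<in>cell k x. A z y * of_real (measure \<mu> (cube_at N y))))\<^sup>2
      * measure \<nu> (cube_at N z))"
proof -
  let ?h = "\<lambda>z. (cmod (integral_op A \<mu> (indicator (cube_at k x)) z))\<^sup>2 * indicator (cube_at k x) z"
  have "(\<integral>\<^sup>+z\<in>cube_at k x. ennreal ((cmod (integral_op A \<mu> (indicator (cube_at k x)) z))\<^sup>2) \<partial>\<nu>) =
      (\<integral>\<^sup>+z. ennreal (?h z) \<partial>\<nu>)"
    by (intro nn_integral_cong) (simp add: indicator_def)
  also have "\<dots> = ennreal (\<Sum>z\<in>X. ?h z * measure \<nu> (cube_at N z))"
  proof (rule nn_integral_leafwise[OF \<nu>])
    fix z z' assume z: "z \<in> Rd d" "z' \<in> X" "cube_at N z = cube_at N z'"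
    then have "z' \<in> Rd d" using samples_subset by auto
    then have "integral_op A \<mu> (indicator (cube_at k x)) z = integral_op A \<mu> (indicator (cube_at k x)) z'"
      using z by (intro integral_op_const[OF \<mu> A])
    moreover have "z \<in> cube_at k x \<longleftrightarrow> z' \<in> cube_at k x"
      using z \<open>z' \<in> Rd d\<close> by (intro cube_at_leaf[OF \<mu> k])
    ultimately show "?h z = ?h z'" by (simp add: indicator_def)
  next
    fix z assume "?h z \<noteq> 0"
    then show "cube_at N z \<in> cube_at N ` X"
      using in_cube_sampleD[OF x, of z k] by (simp add: indicator_def split: if_splits)
  qed simp
  also have "(\<Sum>z\<in>X. ?h z * measure \<nu> (cube_at N z)) =
      (\<Sum>z\<in>X. (cmod (integral_op A \<mu> (indicator (cube_at k x)) z))\<^sup>2 * measure \<nu> (cube_at N z)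
        * indicator (cube_at k x) z)"
    by (simp only: mult_ac)
  also have "\<dots> = (\<Sum>z\<in>cell k x. (cmod (integral_op A \<mu> (indicator (cube_at k x)) z))\<^sup>2
      * measure \<nu> (cube_at N z))"
    by (rule sum_indicator_cube_at[OF \<mu>])
  also have "\<dots> = (\<Sum>z\<in>cell k x. (cmod (\<Sum>y\<in>cell k x. A z y * of_real (measure \<mu> (cube_at N y))))\<^sup>2
      * measure \<nu> (cube_at N z))"
    using samples_subset in_cellD integral_op_indicator[OF \<mu> A x k]
    by (intro sum.cong refl) (auto simp: subset_eq)
  finally show ?thesis .
qed

lemma shift_model_leaves:
  fixes a B :: real
  assumes \<mu>: "radon_measure d \<mu>" and \<nu>: "radon_measure d \<nu>" and B: "B \<ge> 0" and a: "a \<ge> 0"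
    and A2: "A2_const d \<mu> \<nu> \<le> ennreal a"
    and test: "\<And>Q. Q \<in> lattice \<Longrightarrow>
      (\<integral>\<^sup>+x\<in>Q. ennreal ((cmod (integral_op kernel \<mu> (indicator Q) x))\<^sup>2) \<partial>\<nu>) \<le> ennreal B * emeasure \<mu> Q"
    and test_adj: "\<And>Q. Q \<in> lattice \<Longrightarrow>
      (\<integral>\<^sup>+y\<in>Q. ennreal ((cmod (integral_op_adj kernel \<nu> (indicator Q) y))\<^sup>2) \<partial>\<mu>) \<le> ennreal B * emeasure \<nu> Q"
  shows "shift_model X cube_at N (max m n) layer (\<lambda>j. (2 powi (top - int j)) ^ d)
    (\<lambda>z. measure \<mu> (cube_at N z)) (\<lambda>z. measure \<nu> (cube_at N z)) a B"
proof -
  have Rd: "x \<in> Rd d" if "x \<in> X" for x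
    using that samples_subset by auto
  have in_lattice: "cube_at k x \<in> lattice" if "x \<in> X" for k x
    unfolding cube_at_def using Rd[OF that] by (rule dcell_in_lattice)
  have vol: "volume d (cube_at j x) = (2 powi (top - int j)) ^ d" for j x
    unfolding cube_at_def by (rule volume_dcell)
  show ?thesis
  proof
    show "inj_on (cube_at N) X" by (rule inj_samples)
  next
    fix x y p assume "cube_at p x \<noteq> cube_at p y"
    then show "layer p x y = 0" by (simp add: layer_def)
  next
    fix x y p assume "x \<in> X" "y \<in> X"
    define b where "b = block (cube_at p x) x y"
    have b: "cmod b \<le> 1"
      unfolding b_def cube_at_def using \<open>x \<in> X\<close> \<open>y \<in> X\<close> by (intro block_bound Rd)
    have "cmod (layer p x y) \<le> inverse ((2 powi (top - int p)) ^ d) * cmod b"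
      unfolding layer_def vol b_def[symmetric]
      by (simp add: norm_divide norm_mult norm_inverse norm_power norm_power_int divide_inverse)
    also have "\<dots> \<le> inverse ((2 powi (top - int p)) ^ d) * 1"
      using b by (intro mult_left_mono) auto
    finally show "cmod (layer p x y) \<le> 1 / (2 powi (top - int p)) ^ d"
      by (simp add: divide_inverse)
  next
    fix x x' y p assume "x \<in> X" "x' \<in> X" "cube_at (p + max m n + 1) x = cube_at (p + max m n + 1) x'"
    then show "layer p x y = layer p x' y"
      by (intro layer_const_left Rd)
  next
    fix x y y' p assume "x \<in> X" "y \<in> X" "y' \<in> X" "cube_at (p + max m n + 1) y = cube_at (p + max m n + 1) y'"
    then show "layer p x y = layer p x y'"
      by (intro layer_const_right Rd)
  next
    fix p
    have "(2::real) powi (top - int p) = 2 * 2 powi (top - int (Suc p))"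
      using power_int_add[of "2::real" 1 "top - int (Suc p)"] by (simp add: algebra_simps)
    then have "((2::real) powi (top - int p)) ^ d = 2 ^ d * (2 powi (top - int (Suc p))) ^ d"
      by (simp add: power_mult_distrib)
    \<comment> \<open>The halving of \<open>w\<close> comes from \<open>d \<ge> 1\<close>: a child
      has \<open>2 ^ d\<close> times smaller volume.\<close>
    moreover have "(2::real) \<le> 2 ^ d"
      using d by (simp add: self_le_power)
    ultimately show "((2::real) powi (top - int (Suc p))) ^ d \<le> (2 powi (top - int p)) ^ d / 2"
      by (simp add: mult_right_mono)
  next
    fix x p assume x: "x \<in> X" and p: "p \<le> N"
    let ?Q = "cube_at p x"
    let ?w = "(2 powi (top - int p)) ^ d :: real"
    have w: "?w > 0" by simp
    have "average d \<mu> ?Q * average d \<nu> ?Q \<le> A2_const d \<mu> \<nu>"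
      unfolding A2_const_def cube_at_def by (intro SUP_upper dcell_in_cubes)
    then have "average d \<mu> ?Q * average d \<nu> ?Q \<le> ennreal a"
      using A2 by (rule order_trans)
    moreover have "average d \<mu> ?Q = ennreal (measure \<mu> ?Q / ?w)" "average d \<nu> ?Q = ennreal (measure \<nu> ?Q / ?w)"
      unfolding average_def vol using w
      by (simp_all add: emeasure_cube_at_eq[OF \<mu>] emeasure_cube_at_eq[OF \<nu>] divide_ennreal)
    ultimately have "ennreal (measure \<mu> ?Q / ?w * (measure \<nu> ?Q / ?w)) \<le> ennreal a"
      by (simp only: ennreal_mult[OF divide_nonneg_pos[OF measure_nonneg w] divide_nonneg_pos[OF measure_nonneg w]])
    then have "(measure \<mu> ?Q / ?w) * (measure \<nu> ?Q / ?w) \<le> a"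
      using a by simp
    then have "measure \<mu> ?Q * measure \<nu> ?Q \<le> a * ?w\<^sup>2"
      using w by (simp add: field_simps power2_eq_square)
    then show "(\<Sum>y\<in>cell p x. measure \<mu> (cube_at N y)) * (\<Sum>y\<in>cell p x. measure \<nu> (cube_at N y)) \<le> a * ?w\<^sup>2"
      by (simp only: measure_cube_at[OF \<mu> x p] measure_cube_at[OF \<nu> x p])
  next
    fix x k assume x: "x \<in> X" and k: "k \<le> N"
    have "(\<Sum>z\<in>cell k x. (cmod (\<Sum>y\<in>cell k x. (\<Sum>p\<le>N. layer p z y) * of_real (measure \<mu> (cube_at N y))))\<^sup>2
        * measure \<nu> (cube_at N z)) =
      (\<Sum>z\<in>cell k x. (cmod (\<Sum>y\<in>cell k x. kernel z y * of_real (measure \<mu> (cube_at N y))))\<^sup>2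
        * measure \<nu> (cube_at N z))"
      using Rd in_cellD by (simp add: kernel_eq_sum_layers cong: sum.cong)
    moreover have "ennreal \<dots> \<le> ennreal B * emeasure \<mu> (cube_at k x)"
      using test[OF in_lattice[OF x, of k]] testing_integral[OF \<mu> \<nu> leafwise_kernel x k] by simp
    then have "ennreal (\<Sum>z\<in>cell k x. (cmod (\<Sum>y\<in>cell k x. kernel z y * of_real (measure \<mu> (cube_at N y))))\<^sup>2
        * measure \<nu> (cube_at N z)) \<le> ennreal (B * measure \<mu> (cube_at k x))"
      using B by (simp add: emeasure_cube_at_eq[OF \<mu>] ennreal_mult)
    ultimately show "(\<Sum>z\<in>cell k x. (cmod (\<Sum>y\<in>cell k x. (\<Sum>p\<le>N. layer p z y) * of_real (measure \<mu> (cube_at N y))))\<^sup>2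
        * measure \<nu> (cube_at N z)) \<le> B * (\<Sum>y\<in>cell k x. measure \<mu> (cube_at N y))"
      using B by (simp add: measure_cube_at[OF \<mu> x k] sum_nonneg)
  next
    fix x k assume x: "x \<in> X" and k: "k \<le> N"
    have "(\<Sum>z\<in>cell k x. (cmod (\<Sum>y\<in>cell k x. (\<Sum>p\<le>N. layer p y z) * of_real (measure \<nu> (cube_at N y))))\<^sup>2
        * measure \<mu> (cube_at N z)) =
      (\<Sum>z\<in>cell k x. (cmod (\<Sum>y\<in>cell k x. cnj (kernel y z) * of_real (measure \<nu> (cube_at N y))))\<^sup>2
        * measure \<mu> (cube_at N z))"
    proof (rule sum.cong[OF refl])
      fix z assume z: "z \<in> cell k x"
      \<comment> \<open>The model tests the transposed kernel, the hypothesis its conjugate. The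
        weights are real, so the two sums are conjugate and have equal modulus.\<close>
      have "cmod (\<Sum>y\<in>cell k x. cnj (kernel y z) * of_real (measure \<nu> (cube_at N y))) =
          cmod (cnj (\<Sum>y\<in>cell k x. kernel y z * of_real (measure \<nu> (cube_at N y))))"
        by simp
      also have "\<dots> = cmod (\<Sum>y\<in>cell k x. kernel y z * of_real (measure \<nu> (cube_at N y)))"
        by (rule complex_mod_cnj)
      also have "\<dots> = cmod (\<Sum>y\<in>cell k x. (\<Sum>p\<le>N. layer p y z) * of_real (measure \<nu> (cube_at N y)))"
        using Rd in_cellD z by (simp add: kernel_eq_sum_layers cong: sum.cong)
      finally show "(cmod (\<Sum>y\<in>cell k x. (\<Sum>p\<le>N. layer p y z) * of_real (measure \<nu> (cube_at N y))))\<^sup>2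
          * measure \<mu> (cube_at N z) =
        (cmod (\<Sum>y\<in>cell k x. cnj (kernel y z) * of_real (measure \<nu> (cube_at N y))))\<^sup>2 * measure \<mu> (cube_at N z)"
        by simp
    qed
    moreover have "integral_op_adj kernel \<nu> = integral_op (\<lambda>y x. cnj (kernel x y)) \<nu>"
      by (simp add: fun_eq_iff integral_op_adj_def integral_op_def)
    then have "ennreal (\<Sum>z\<in>cell k x. (cmod (\<Sum>y\<in>cell k x. cnj (kernel y z) * of_real (measure \<nu> (cube_at N y))))\<^sup>2
        * measure \<mu> (cube_at N z)) \<le> ennreal B * emeasure \<nu> (cube_at k x)"
      using test_adj[OF in_lattice[OF x, of k]]
        testing_integral[OF \<nu> \<mu> leafwise_adjoint[OF leafwise_kernel] x k] by simp
    then have "ennreal (\<Sum>z\<in>cell k x. (cmod (\<Sum>y\<in>cell k x. cnj (kernel y z) * of_real (measure \<nu> (cube_at N y))))\<^sup>2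
        * measure \<mu> (cube_at N z)) \<le> ennreal (B * measure \<nu> (cube_at k x))"
      using B by (simp add: emeasure_cube_at_eq[OF \<nu>] ennreal_mult)
    ultimately show "(\<Sum>z\<in>cell k x. (cmod (\<Sum>y\<in>cell k x. (\<Sum>p\<le>N. layer p y z) * of_real (measure \<nu> (cube_at N y))))\<^sup>2
        * measure \<mu> (cube_at N z)) \<le> B * (\<Sum>y\<in>cell k x. measure \<nu> (cube_at N y))"
      using B by (simp add: measure_cube_at[OF \<nu> x k] sum_nonneg)
  qed (use a B in simp_all)
qed

lemma integral_op_L2_bound:
  fixes a B :: real
  assumes \<mu>: "radon_measure d \<mu>" and \<nu>: "radon_measure d \<nu>" and B: "B \<ge> 0" and a: "a \<ge> 0"
    and A2: "A2_const d \<mu> \<nu> \<le> ennreal a"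
    and test: "\<And>Q. Q \<in> lattice \<Longrightarrow>
      (\<integral>\<^sup>+x\<in>Q. ennreal ((cmod (integral_op kernel \<mu> (indicator Q) x))\<^sup>2) \<partial>\<nu>) \<le> ennreal B * emeasure \<mu> Q"
    and test_adj: "\<And>Q. Q \<in> lattice \<Longrightarrow>
      (\<integral>\<^sup>+y\<in>Q. ennreal ((cmod (integral_op_adj kernel \<nu> (indicator Q) y))\<^sup>2) \<partial>\<mu>) \<le> ennreal B * emeasure \<nu> Q"
    and f: "f \<in> borel_measurable \<mu>" and L2: "(\<integral>\<^sup>+x. ennreal ((cmod (f x))\<^sup>2) \<partial>\<mu>) < \<infinity>"
  shows "L2_norm \<nu> (integral_op kernel \<mu> f) \<le>
    ennreal (4 * sqrt B + 2 * real (max m n + 1) * (sqrt a + sqrt B) + (real (max m n + 1))\<^sup>2 * sqrt a)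
      * L2_norm \<mu> f"
proof -
  interpret M: shift_model X cube_at N "max m n" layer "\<lambda>j. (2 powi (top - int j)) ^ d"
    "\<lambda>z. measure \<mu> (cube_at N z)" "\<lambda>z. measure \<nu> (cube_at N z)" a B
    by (rule shift_model_leaves) fact+
  obtain F where F: "\<And>z. z \<in> X \<Longrightarrow> integrable \<mu> (\<lambda>y. f y * indicator (cube_at N z) y)"
    "\<And>z. z \<in> X \<Longrightarrow> (LINT y|\<mu>. f y * indicator (cube_at N z) y) = F z * of_real (measure \<mu> (cube_at N z))"
    "ennreal (\<Sum>z\<in>X. (cmod (F z))\<^sup>2 * measure \<mu> (cube_at N z)) \<le> (\<integral>\<^sup>+x. ennreal ((cmod (f x))\<^sup>2) \<partial>\<mu>)"
    using leaf_average[OF \<mu> f L2] by blast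
  let ?u = "\<lambda>z. measure \<mu> (cube_at N z)" and ?v = "\<lambda>z. measure \<nu> (cube_at N z)"
  let ?C = "4 * sqrt B + 2 * real (max m n + 1) * (sqrt a + sqrt B) + (real (max m n + 1))\<^sup>2 * sqrt a"
  have C: "?C \<ge> 0"
    using a B by (intro add_nonneg_nonneg mult_nonneg_nonneg) auto
  have op: "integral_op kernel \<mu> f x = M.op F x" if x: "x \<in> X" for x
  proof -
    have "x \<in> Rd d" using x samples_subset by auto
    then have "integral_op kernel \<mu> f x = (\<Sum>z\<in>X. kernel x z * (F z * of_real (?u z)))"
      using integral_op_leafwise[OF \<mu> leafwise_kernel _ F(1)] by (simp add: F(2) cong: sum.cong)
    then show ?thesis
      unfolding M.op_def M.ker_def using samples_subset \<open>x \<in> Rd d\<close>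
      by (simp add: kernel_eq_sum_layers subset_eq cong: sum.cong)
  qed
  have "(\<integral>\<^sup>+x. ennreal ((cmod (integral_op kernel \<mu> f x))\<^sup>2) \<partial>\<nu>) =
      ennreal (\<Sum>z\<in>X. (cmod (integral_op kernel \<mu> f z))\<^sup>2 * ?v z)"
  proof (rule nn_integral_leafwise[OF \<nu>])
    fix x z assume "x \<in> Rd d" "z \<in> X" "cube_at N x = cube_at N z"
    then show "(cmod (integral_op kernel \<mu> f x))\<^sup>2 = (cmod (integral_op kernel \<mu> f z))\<^sup>2"
      using integral_op_const[OF \<mu> leafwise_kernel, of x z f] samples_subset by auto
  next
    fix x assume "x \<in> Rd d" "(cmod (integral_op kernel \<mu> f x))\<^sup>2 \<noteq> 0"
    then show "cube_at N x \<in> cube_at N ` X"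
      using integral_op_supp[OF \<mu> leafwise_kernel, of x f] by simp
  qed simp
  also have "(\<Sum>z\<in>X. (cmod (integral_op kernel \<mu> f z))\<^sup>2 * ?v z) = (wnorm ?v (M.op F))\<^sup>2"
    by (simp add: wnorm_sq op cong: sum.cong)
  finally have left: "L2_norm \<nu> (integral_op kernel \<mu> f) = ennreal (wnorm ?v (M.op F))"
    by (simp add: L2_norm_def ennreal_sqrt_def)
  define I where "I = enn2real (\<integral>\<^sup>+x. ennreal ((cmod (f x))\<^sup>2) \<partial>\<mu>)"
  have I: "(\<integral>\<^sup>+x. ennreal ((cmod (f x))\<^sup>2) \<partial>\<mu>) = ennreal I"
    using L2 by (simp add: I_def)
  have I0: "I \<ge> 0" by (simp add: I_def)
  have "(wnorm ?u F)\<^sup>2 \<le> I"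
    using F(3) I0 unfolding I by (simp add: wnorm_sq)
  then have "wnorm ?u F \<le> sqrt I"
    by (rule real_le_rsqrt)
  then have "wnorm ?v (M.op F) \<le> ?C * sqrt I"
    using M.op_bound[of F] C by (meson mult_left_mono order_trans)
  then have "ennreal (wnorm ?v (M.op F)) \<le> ennreal ?C * ennreal (sqrt I)"
    using C I0 by (simp add: ennreal_leI flip: ennreal_mult)
  moreover have "L2_norm \<mu> f = ennreal (sqrt I)"
    using I0 by (simp add: L2_norm_def ennreal_sqrt_def I)
  ultimately show ?thesis
    unfolding left by simp
qed

end

text \<open>For an infinite \<open>A\<^sub>2\<close> constant the right-hand side of the theorem is
  infinity times the norm of \<open>f\<close>. In \<open>ennreal\<close> this is 0 if
  \<open>f\<close> has norm 0, so that case needs an argument.\<close>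

lemma L2_norm_integral_op_eq_0:
  assumes f: "f \<in> borel_measurable \<mu>" and "L2_norm \<mu> f = 0"
  shows "L2_norm \<nu> (integral_op A \<mu> f) = 0"
proof -
  have "enn2real (\<integral>\<^sup>+x. ennreal ((cmod (f x))\<^sup>2) \<partial>\<mu>) = 0" "(\<integral>\<^sup>+x. ennreal ((cmod (f x))\<^sup>2) \<partial>\<mu>) \<noteq> \<infinity>"
    using assms(2) by (auto simp: L2_norm_def ennreal_sqrt_def split: if_splits)
  then have "(\<integral>\<^sup>+x. ennreal ((cmod (f x))\<^sup>2) \<partial>\<mu>) = 0"
    by (auto simp: enn2real_eq_0_iff)
  then have "AE x in \<mu>. ennreal ((cmod (f x))\<^sup>2) = 0"
    using f by (subst (asm) nn_integral_0_iff_AE) auto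
  then have "AE x in \<mu>. f x = 0"
    by (auto elim: eventually_mono)
  then have "integral_op A \<mu> f x = 0" for x
    unfolding integral_op_def by (intro integral_eq_zero_AE) (auto elim: eventually_mono)
  then show ?thesis
    by (simp add: L2_norm_def ennreal_sqrt_def)
qed

lemma shift_L2_bound:
  fixes a B :: real
  assumes d: "d \<ge> 1" and \<mu>: "radon_measure d \<mu>" and \<nu>: "radon_measure d \<nu>"
    and D: "dyadic_lattice d D" and shift: "finite_elementary_shift d D m n hin hout"
    and B: "B \<ge> 0" and a: "a \<ge> 0" and A2: "A2_const d \<mu> \<nu> \<le> ennreal a"
    and test: "\<forall>Q\<in>D. (\<integral>\<^sup>+x\<in>Q. ennreal ((cmod (integral_op (shift_kernel d D m n hin hout) \<mu> (indicator Q) x))\<^sup>2) \<partial>\<nu>)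
      \<le> ennreal B * emeasure \<mu> Q"
    and test_adj: "\<forall>Q\<in>D. (\<integral>\<^sup>+y\<in>Q. ennreal ((cmod (integral_op_adj (shift_kernel d D m n hin hout) \<nu> (indicator Q) y))\<^sup>2) \<partial>\<mu>)
      \<le> ennreal B * emeasure \<nu> Q"
    and f: "f \<in> borel_measurable \<mu>" "L2_norm \<mu> f < \<infinity>"
  shows "L2_norm \<nu> (integral_op (shift_kernel d D m n hin hout) \<mu> f) \<le>
    ennreal (4 * sqrt B + 2 * real (max m n + 1) * (sqrt a + sqrt B) + (real (max m n + 1))\<^sup>2 * sqrt a)
      * L2_norm \<mu> f"
proof -
  obtain \<omega> where \<omega>: "\<forall>j. \<forall>i<d. \<omega> j i \<in> {0, 1}"
    and D_eq: "D = (\<Union>k. translate d (lattice_offset \<omega> k) ` standard_dyadic d k)"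
    using D by (auto simp: dyadic_lattice_def)
  interpret G: dyadic_grid d \<omega>
    using d \<omega> by unfold_locales auto
  have D_lattice: "D = G.lattice"
    by (simp add: D_eq G.lattice_def)
  interpret S: dyadic_shift d \<omega> m n hin hout
    using shift by unfold_locales (simp add: D_lattice)
  obtain top N where "\<And>k z. z \<in> Rd d \<Longrightarrow> G.dcell k z \<in> S.active \<Longrightarrow>
      top - int N + int (max m n) + 1 \<le> k \<and> k \<le> top"
    using S.active_scales by blast
  then interpret T: scaled_shift d \<omega> m n hin hout top N
    by unfold_locales
  obtain X where "finite X" "X \<subseteq> Rd d" "inj_on (T.cube_at N) X"
    "\<And>x y. x \<in> Rd d \<Longrightarrow> y \<in> Rd d \<Longrightarrow> S.kernel x y \<noteq> 0 \<Longrightarrow>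
      T.cube_at N x \<in> T.cube_at N ` X \<and> T.cube_at N y \<in> T.cube_at N ` X"
    "\<And>x y. x \<in> X \<Longrightarrow> y \<in> T.cube_at 0 x \<Longrightarrow> T.cube_at N y \<in> T.cube_at N ` X"
    using T.sample_points by blast
  then interpret U: sampled_shift d \<omega> m n hin hout top N X
    by unfold_locales
  have "(\<integral>\<^sup>+x. ennreal ((cmod (f x))\<^sup>2) \<partial>\<mu>) < \<infinity>"
    using f(2) by (auto simp: L2_norm_def ennreal_sqrt_def less_top split: if_splits)
  with \<mu> \<nu> B a A2 test test_adj f(1) show ?thesis
    unfolding D_lattice by (intro U.integral_op_L2_bound) auto
qed

theorem theorem3p4:
  shows "\<exists>C::real. C > 0 \<and>
    (\<forall>(d::nat) (\<mu>::(nat \<Rightarrow> real) measure) (\<nu>::(nat \<Rightarrow> real) measure) D (m::nat) (n::nat)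
        (hin::haar_family) (hout::haar_family) (B::real).
      d \<ge> 1 \<longrightarrow> radon_measure d \<mu> \<longrightarrow> radon_measure d \<nu> \<longrightarrow> dyadic_lattice d D \<longrightarrow>
      finite_elementary_shift d D m n hin hout \<longrightarrow> B \<ge> 0 \<longrightarrow>
      (\<forall>Q\<in>D.
        (\<integral>\<^sup>+x\<in>Q. ennreal ((cmod (integral_op (shift_kernel d D m n hin hout) \<mu> (indicator Q) x))\<^sup>2) \<partial>\<nu>)
          \<le> ennreal B * emeasure \<mu> Q) \<longrightarrow>
      (\<forall>Q\<in>D.
        (\<integral>\<^sup>+y\<in>Q. ennreal ((cmod (integral_op_adj (shift_kernel d D m n hin hout) \<nu> (indicator Q) y))\<^sup>2) \<partial>\<mu>)
          \<le> ennreal B * emeasure \<nu> Q) \<longrightarrow>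
      (\<forall>f \<in> borel_measurable \<mu>. L2_norm \<mu> f < \<infinity> \<longrightarrow>
        L2_norm \<nu> (integral_op (shift_kernel d D m n hin hout) \<mu> f)
          \<le> ennreal C *
             (ennreal (2 powr (real d / 2)) * ennreal (real (max m n) + 1)
                * (ennreal (sqrt B) + ennreal_sqrt (A2_const d \<mu> \<nu>))
              + ennreal ((real (max m n))\<^sup>2) * ennreal_sqrt (A2_const d \<mu> \<nu>))
             * L2_norm \<mu> f))"
proof (intro exI[of _ "8::real"] conjI allI impI ballI)
  fix d \<mu> \<nu> D and m n :: nat and hin hout :: haar_family and B :: real and f
  assume d: "1 \<le> d" and \<mu>: "radon_measure d \<mu>" and \<nu>: "radon_measure d \<nu>"
    and D: "dyadic_lattice d D" and shift: "finite_elementary_shift d D m n hin hout" and B: "0 \<le> B"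
    and test: "\<forall>Q\<in>D. (\<integral>\<^sup>+x\<in>Q. ennreal ((cmod (integral_op (shift_kernel d D m n hin hout) \<mu> (indicator Q) x))\<^sup>2) \<partial>\<nu>)
      \<le> ennreal B * emeasure \<mu> Q"
    and test_adj: "\<forall>Q\<in>D. (\<integral>\<^sup>+y\<in>Q. ennreal ((cmod (integral_op_adj (shift_kernel d D m n hin hout) \<nu> (indicator Q) y))\<^sup>2) \<partial>\<mu>)
      \<le> ennreal B * emeasure \<nu> Q"
    and f: "f \<in> borel_measurable \<mu>" "L2_norm \<mu> f < \<infinity>"
  let ?A = "ennreal_sqrt (A2_const d \<mu> \<nu>)"
  let ?r = "real (max m n)"
  let ?p = "2 powr (real d / 2)"
  let ?Tf = "integral_op (shift_kernel d D m n hin hout) \<mu> f"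
  \<comment> \<open>The bound from \<open>shift_L2_bound\<close> is free of the dimension; the
    dimensional factor, being at least 1, only enlarges it.\<close>
  have p: "?p \<ge> 1"
    by (intro ge_one_powr_ge_zero) auto
  show "L2_norm \<nu> ?Tf \<le> ennreal 8 * (ennreal ?p * ennreal (?r + 1) * (ennreal (sqrt B) + ?A)
      + ennreal (?r\<^sup>2) * ?A) * L2_norm \<mu> f"
  proof (cases "A2_const d \<mu> \<nu> = \<infinity>")
    case True
    show ?thesis
    proof (cases "L2_norm \<mu> f = 0")
      case True
      with L2_norm_integral_op_eq_0[OF f(1)] show ?thesis by simp
    next
      case False
      have "ennreal ?p * ennreal (?r + 1) * (ennreal (sqrt B) + ?A) = \<infinity>"
        using True p by (simp add: ennreal_sqrt_def ennreal_mult_eq_top_iff)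
      then show ?thesis
        using False by (simp add: ennreal_mult_eq_top_iff)
    qed
  next
    case False
    define a where "a = enn2real (A2_const d \<mu> \<nu>)"
    have a: "A2_const d \<mu> \<nu> = ennreal a" "a \<ge> 0"
      using False by (simp_all add: a_def less_top)
    then have A: "?A = ennreal (sqrt a)"
      by (simp add: ennreal_sqrt_def)
    have "L2_norm \<nu> ?Tf \<le>
        ennreal (4 * sqrt B + 2 * real (max m n + 1) * (sqrt a + sqrt B) + (real (max m n + 1))\<^sup>2 * sqrt a)
        * L2_norm \<mu> f"
      using a by (intro shift_L2_bound[OF d \<mu> \<nu> D shift B _ _ test test_adj f]) auto
    also have "\<dots> \<le> ennreal (8 * (?p * (?r + 1) * (sqrt B + sqrt a) + ?r\<^sup>2 * sqrt a)) * L2_norm \<mu> f"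
    proof (intro mult_right_mono ennreal_leI)
      have "1 * ((?r + 1) * (sqrt B + sqrt a)) \<le> ?p * ((?r + 1) * (sqrt B + sqrt a))"
        using p B a(2) by (intro mult_right_mono) auto
      then have "8 * ((?r + 1) * (sqrt B + sqrt a) + ?r\<^sup>2 * sqrt a) \<le>
          8 * (?p * (?r + 1) * (sqrt B + sqrt a) + ?r\<^sup>2 * sqrt a)"
        by (simp add: mult.assoc)
      \<comment> \<open>The constant 8 is chosen with room: the difference of the two sides is the
        expression below, a polynomial with nonnegative coefficients. At \<open>\<rho> = 0\<close>
        the coefficient of \<open>s\<close> is 6 on the left against 8 on the right.\<close>
      moreover have "4 * s + 2 * (\<rho> + 1) * (t + s) + (\<rho> + 1)\<^sup>2 * t \<le> 8 * ((\<rho> + 1) * (s + t) + \<rho>\<^sup>2 * t)"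
        if "s \<ge> 0" "t \<ge> 0" "\<rho> \<ge> 0" for s t \<rho> :: real
      proof -
        have "0 \<le> s * (6 * \<rho> + 2) + t * (4 * \<rho> + 5 + 7 * \<rho>\<^sup>2)"
          using that by (intro add_nonneg_nonneg mult_nonneg_nonneg) auto
        then show ?thesis by (simp add: power2_eq_square algebra_simps)
      qed
      from this[of "sqrt B" "sqrt a" ?r] have
        "4 * sqrt B + 2 * (?r + 1) * (sqrt a + sqrt B) + (?r + 1)\<^sup>2 * sqrt a
          \<le> 8 * ((?r + 1) * (sqrt B + sqrt a) + ?r\<^sup>2 * sqrt a)"
        using B a(2) by simp
      ultimately show "4 * sqrt B + 2 * real (max m n + 1) * (sqrt a + sqrt B) + (real (max m n + 1))\<^sup>2 * sqrt a
          \<le> 8 * (?p * (?r + 1) * (sqrt B + sqrt a) + ?r\<^sup>2 * sqrt a)"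
        unfolding of_nat_add of_nat_1 by (rule order_trans[rotated])
    qed simp
    also have "ennreal (8 * (?p * (?r + 1) * (sqrt B + sqrt a) + ?r\<^sup>2 * sqrt a)) =
        ennreal 8 * (ennreal ?p * ennreal (?r + 1) * (ennreal (sqrt B) + ?A) + ennreal (?r\<^sup>2) * ?A)"
      unfolding A using B a(2) by (simp only: ennreal_mult ennreal_plus powr_ge_zero zero_le_power2 real_sqrt_ge_zero add_nonneg_nonneg of_nat_0_le_iff zero_le_one
          mult_nonneg_nonneg zero_le_numeral)
    finally show ?thesis .
  qed
qed simp

end
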